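(* Let $H<\mathrm{Sym}(d)$ be transitive, $F=F_m$ free on $S=\{x_1,\ldots,x_m\}$, $\Delta=\langle w_1,w_2\rangle<F$ a non-cyclic subgroup generated by two reduced words, $\phi\in\mathrm{Hom}(F,W(H))$ Haar-random, $X_n=\mathcal{G}(F,S,L(n))$, $Y_n=\mathcal{G}(\Delta,\{w_1,w_2\},L(n))$ and $\iota_n:Y_n\to X_n$ the canonical immersion. Given $K\in\mathbb{N}$, there exist a random variable $N=N(K)\in\mathbb{N}$ and, for each connected component $Z$ of $Y_N$, random variables: a vertex $v(Z)\in Z$, elements $\alpha_1(Z),\ldots,\alpha_K(Z)\in\pi_1(Z,v(Z))$, and geometric edges $e_1(Z),\ldots,e_K(Z)$ of $X_N$, such that for all $1\le j,k\le K$ the directed path $\iota_N(\alpha_j(Z))$ passes through $e_k(Z)$ exactly once if $j=k$ and not at all if $j\ne k$.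
   Context: $T=T_d$ is the rooted $d$-ary tree with levels $L(n)$; $W(H)$ is the infinite iterated wreath product of $H$ acting on $T$, with Haar probability measure; $F$ acts on $T$ on the right via $\phi$. For a group $\Delta$ acting on $X$ and finite $S\subset\Delta$, $\mathcal{G}(\Delta,S,X)$ has vertices $X$ and a directed edge $x\to x^s$ for each $x\in X$, $s\in S\cup S^{-1}$, with $(x,s)$ and $(x^s,s^{-1})$ inverse to each other; a geometric edge is a pair $\{e,\overline e\}$ of mutually inverse edges. The map $\iota_n$ is the identity on vertices and sends the edge of $Y_n$ at $v$ labeled $w_i$ to the path in $X_n$ starting at $v$ following the letters of $w_i$; it extends to paths. A random variable is a measurable function of $\phi$ defined almost everywhere. *)

theory Defs
  imports "HOL-Probability.Probability" "HOL-Algebra.Product_Groups" "HOL-Algebra.Sym_Groups"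
begin

section \<open>Free groups\<close>

text \<open>
  The free group on \<open>x\<^sub>1, \<dots>, x\<^sub>m\<close> is realised on reduced words. The letter \<open>(i, True)\<close> stands for
  \<open>x\<^sub>i\<close> and \<open>(i, False)\<close> for its inverse.
\<close>

type_synonym letter = "nat \<times> bool"

definition inv_letter :: "letter \<Rightarrow> letter" where
  "inv_letter a = (fst a, \<not> snd a)"

definition reduced_word :: "letter list \<Rightarrow> bool" where
  "reduced_word w \<longleftrightarrow> successively (\<lambda>a b. b \<noteq> inv_letter a) w"

fun cons_letter :: "letter \<Rightarrow> letter list \<Rightarrow> letter list" where
  "cons_letter a [] = [a]"
| "cons_letter a (b # w) = (if b = inv_letter a then w else a # b # w)"

definition free_group :: "nat \<Rightarrow> letter list monoid" where
  "free_group m =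
     \<lparr>carrier = {w. reduced_word w \<and> fst ` set w \<subseteq> {1..m}},
      mult = (\<lambda>u v. foldr cons_letter u v),
      one = []\<rparr>"

definition free_gens :: "nat \<Rightarrow> letter list set" where
  "free_gens m = {[(i, True)] | i. i \<in> {1..m}}"


section \<open>The rooted tree and the infinite iterated wreath product\<close>

text \<open>Vertices are finite words over \<open>{1..d}\<close>; the children of \<open>v\<close> are the words \<open>v @ [i]\<close>.\<close>

definition tree :: "nat \<Rightarrow> nat list set" where
  "tree d = {v. set v \<subseteq> {1..d}}"

definition level :: "nat \<Rightarrow> nat \<Rightarrow> nat list set" where
  "level d n = {v \<in> tree d. length v = n}"

definition transitive_perms :: "nat \<Rightarrow> (nat \<Rightarrow> nat) set \<Rightarrow> bool" where
  "transitive_perms d H \<longleftrightarrow> (\<forall>i\<in>{1..d}. \<forall>j\<in>{1..d}. \<exists>h\<in>H. h i = j)"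

text \<open>
  The automorphisms of the tree acting on the children of every vertex by an element of \<open>H\<close>.
  These conditions force \<open>g\<close> to be a level-preserving automorphism, since the elements of \<open>H\<close> are
  permutations. The group acts on the right, so in a product the left factor is applied first.
\<close>

definition wreath :: "nat \<Rightarrow> (nat \<Rightarrow> nat) set \<Rightarrow> (nat list \<Rightarrow> nat list) monoid" where
  "wreath d H =
     \<lparr>carrier = {g \<in> extensional (tree d). g [] = [] \<and>
        (\<forall>v\<in>tree d. \<exists>h\<in>H. \<forall>i\<in>{1..d}. g (v @ [i]) = g v @ [h i])},
      mult = (\<lambda>g h. compose (tree d) h g),
      one = (\<lambda>v\<in>tree d. v)\<rparr>"

text \<open>
  The Borel sets of the profinite topology on the wreath product: the sets below form a countable
  subbasis.
\<close>

definition wreath_borel :: "nat \<Rightarrow> (nat \<Rightarrow> nat) set \<Rightarrow> (nat list \<Rightarrow> nat list) measure" where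
  "wreath_borel d H =
     sigma (carrier (wreath d H))
       {{g \<in> carrier (wreath d H). g v = u} | v u. v \<in> tree d}"


section \<open>Haar-random homomorphisms\<close>

definition haar_probability :: "('a, 'b) monoid_scheme \<Rightarrow> 'a measure \<Rightarrow> bool" where
  "haar_probability G M \<longleftrightarrow>
     prob_space M \<and> space M = carrier G \<and>
     (\<forall>g\<in>carrier G. \<forall>A\<in>sets M.
        (\<lambda>x. g \<otimes>\<^bsub>G\<^esub> x) ` A \<in> sets M \<and> emeasure M ((\<lambda>x. g \<otimes>\<^bsub>G\<^esub> x) ` A) = emeasure M A)"

definition Hom_wreath ::
  "nat \<Rightarrow> (nat \<Rightarrow> nat) set \<Rightarrow> nat \<Rightarrow> (letter list \<Rightarrow> nat list \<Rightarrow> nat list) set" where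
  "Hom_wreath d H m =
     hom (free_group m) (wreath d H) \<inter> extensional (carrier (free_group m))"

definition gen_images ::
  "nat \<Rightarrow> (letter list \<Rightarrow> nat list \<Rightarrow> nat list) \<Rightarrow> nat \<Rightarrow> nat list \<Rightarrow> nat list" where
  "gen_images m \<phi> = (\<lambda>i\<in>{1..m}. \<phi> [(i, True)])"

text \<open>
  \<open>P\<close> is the law of a Haar-random homomorphism. The map \<open>gen_images\<close> identifies the space of
  homomorphisms with the compact group \<open>W(H)\<^sup>m\<close>; the measurable structure is pulled back along it
  and the measure corresponds to Haar measure of \<open>W(H)\<^sup>m\<close>.
\<close>

definition haar_random_hom ::
  "nat \<Rightarrow> (nat \<Rightarrow> nat) set \<Rightarrow> nat \<Rightarrow> (letter list \<Rightarrow> nat list \<Rightarrow> nat list) measure \<Rightarrow> bool" where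
  "haar_random_hom d H m P \<longleftrightarrow>
     (let B = PiM {1..m} (\<lambda>_. wreath_borel d H) in
        space P = Hom_wreath d H m \<and>
        sets P = sets (vimage_algebra (Hom_wreath d H m) (gen_images m) B) \<and>
        haar_probability (product_group {1..m} (\<lambda>_. wreath d H)) (distr P B (gen_images m)))"


section \<open>Graphs with inverse edges\<close>

record ('v, 'e) dgraph =
  Verts :: "'v set"
  Edges :: "'e set"
  src :: "'e \<Rightarrow> 'v"
  tgt :: "'e \<Rightarrow> 'v"
  bar :: "'e \<Rightarrow> 'e"

fun is_path :: "('v, 'e) dgraph \<Rightarrow> 'v \<Rightarrow> 'e list \<Rightarrow> 'v \<Rightarrow> bool" where
  "is_path G u [] v \<longleftrightarrow> u \<in> Verts G \<and> u = v"
| "is_path G u (e # p) v \<longleftrightarrow> e \<in> Edges G \<and> src G e = u \<and> is_path G (tgt G e) p v"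

definition reduced_path :: "('v, 'e) dgraph \<Rightarrow> 'e list \<Rightarrow> bool" where
  "reduced_path G p \<longleftrightarrow> successively (\<lambda>e f. f \<noteq> bar G e) p"

text \<open>
  Elements of the fundamental group at \<open>v\<close> are represented by the reduced closed paths at \<open>v\<close>, the
  unique reduced representatives of the homotopy classes.
\<close>

definition pi1 :: "('v, 'e) dgraph \<Rightarrow> 'v \<Rightarrow> 'e list set" where
  "pi1 G v = {p. is_path G v p v \<and> reduced_path G p}"

definition component_verts :: "('v, 'e) dgraph \<Rightarrow> 'v set set" where
  "component_verts G = {{u. \<exists>p. is_path G v p u} | v. v \<in> Verts G}"

definition induced :: "('v, 'e) dgraph \<Rightarrow> 'v set \<Rightarrow> ('v, 'e) dgraph" where
  "induced G C = G\<lparr>Verts := C, Edges := {e \<in> Edges G. src G e \<in> C \<and> tgt G e \<in> C}\<rparr>"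

definition geom_edges :: "('v, 'e) dgraph \<Rightarrow> 'e set set" where
  "geom_edges G = {{e, bar G e} | e. e \<in> Edges G}"

text \<open>The number of times a path runs through a geometric edge, in either direction.\<close>

definition passes :: "'e list \<Rightarrow> 'e set \<Rightarrow> nat" where
  "passes p E = length (filter (\<lambda>e. e \<in> E) p)"


section \<open>Schreier graphs and the canonical immersion\<close>

text \<open>\<open>act x g\<close> is the image \<open>x\<^sup>g\<close> of \<open>x\<close> under the right action of \<open>g\<close>.\<close>

definition schreier ::
  "('g, 'b) monoid_scheme \<Rightarrow> 'g set \<Rightarrow> 'x set \<Rightarrow> ('x \<Rightarrow> 'g \<Rightarrow> 'x) \<Rightarrow> ('x, 'x \<times> 'g) dgraph" where
  "schreier G S V act =
     \<lparr>Verts = V,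
      Edges = V \<times> (S \<union> m_inv G ` S),
      src = fst,
      tgt = (\<lambda>(x, s). act x s),
      bar = (\<lambda>(x, s). (act x s, m_inv G s))\<rparr>"

definition hom_act :: "(letter list \<Rightarrow> nat list \<Rightarrow> nat list) \<Rightarrow> nat list \<Rightarrow> letter list \<Rightarrow> nat list" where
  "hom_act \<phi> x g = \<phi> g x"

definition X_graph ::
  "nat \<Rightarrow> nat \<Rightarrow> (letter list \<Rightarrow> nat list \<Rightarrow> nat list) \<Rightarrow> nat \<Rightarrow>
   (nat list, nat list \<times> letter list) dgraph" where
  "X_graph d m \<phi> n = schreier (free_group m) (free_gens m) (level d n) (hom_act \<phi>)"

definition Y_graph ::
  "nat \<Rightarrow> nat \<Rightarrow> letter list \<Rightarrow> letter list \<Rightarrow> (letter list \<Rightarrow> nat list \<Rightarrow> nat list) \<Rightarrow> nat \<Rightarrow>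
   (nat list, nat list \<times> letter list) dgraph" where
  "Y_graph d m w1 w2 \<phi> n =
     schreier (subgroup_generated (free_group m) {w1, w2}) {w1, w2} (level d n) (hom_act \<phi>)"

fun follow_word ::
  "(letter list \<Rightarrow> nat list \<Rightarrow> nat list) \<Rightarrow> nat list \<Rightarrow> letter list \<Rightarrow> (nat list \<times> letter list) list" where
  "follow_word \<phi> v [] = []"
| "follow_word \<phi> v (a # w) = (v, [a]) # follow_word \<phi> (hom_act \<phi> v [a]) w"

text \<open>
  The canonical immersion on paths: the edge at \<open>v\<close> labelled \<open>w\<close> becomes the path at \<open>v\<close> spelled by
  the letters of \<open>w\<close>. The concatenation is not reduced afterwards.
\<close>

definition iota_path ::
  "(letter list \<Rightarrow> nat list \<Rightarrow> nat list) \<Rightarrow> (nat list \<times> letter list) list \<Rightarrow>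
   (nat list \<times> letter list) list" where
  "iota_path \<phi> p = concat (map (\<lambda>(v, w). follow_word \<phi> v w) p)"

end

theory Submission
  imports Defs
begin

text \<open>
  Almost surely the girth of \<open>X\<^sub>n\<close> tends to infinity. Once no nonempty word shorter than \<open>w\<close> fixes
  a vertex, the path spelled by \<open>w\<close> from a fixed vertex runs through its first edge only once, so
  given the action on level \<open>n\<close> its monodromy on the children is a uniform element of the transitive
  group \<open>H\<close>: the number of fixed vertices of \<open>w\<close> is a martingale. From a positive value \<open>k\<close> it jumps
  to \<open>k d\<close> with probability at least \<open>|H|\<close> to the power \<open>- k |w|\<close>, so a strictly concave potential
  shows that it cannot stay bounded away from \<open>0\<close>, and it dies out.

  Large girth alone then yields the loops. Write \<open>w\<^sub>1 = c x c\<^sup>-\<^sup>1\<close> with \<open>x\<close> cyclically reduced; the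
  bi-infinite line of powers of \<open>w\<^sub>1\<close> at \<open>u\<close> passes the edge \<open>e\<close> spelled by the first letter of \<open>x\<close>
  only once, namely in the \<open>Y\<close>-edge at \<open>u\<close>. As \<open>w\<^sub>1\<close> and \<open>w\<^sub>2\<close> have no common power, the elements
  \<open>w\<^sub>1\<^sup>i w\<^sub>2\<^sup>j\<close> are distinct, so \<open>\<Delta>\<close> grows at least quadratically and moderately large subsets of a
  component have large boundary. A minimal set with at least \<open>L\<^sub>0\<close> elements and small boundary is
  therefore huge, and it contains far apart points \<open>u\<^sub>1, \<dots>, u\<^sub>K\<close> such that deleting all \<open>Y\<close>-edges
  that pass one of the edges \<open>e\<^sub>1, \<dots>, e\<^sub>K\<close> cannot separate their ends.
\<close>

section \<open>Reduced words and powers in the free group\<close>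

text \<open>The boundary budget \<open>M\<close> reproduces itself. A \<open>Y\<close>-edge labelled
  \<open>w\<close> that passes \<open>e_k\<close> is determined by a position in \<open>w\<close>
  and an end of \<open>e_k\<close>, so at most \<open>M\<close> edges are deleted in all. If they
  split a set with boundary at most \<open>M\<close>, the two boundaries sum to at most
  \<open>2 * M\<close> and one piece is within budget again. Quadratic growth gives a set of s
  elements a boundary at least of order sqrt s, which beats the constant \<open>M\<close> once s
  exceeds \<open>8 * M * M\<close>, as long as s is small compared with the girth.

  The first letter of \<open>x\<close> is used rather than that of \<open>w1\<close> because the
  arms \<open>c\<close> and its inverse cancel between consecutive powers while
  \<open>iota_path\<close> does not reduce: an edge on an arm may be passed several times.

  A nonnegative integer martingale may well settle at a positive value. The potential excludes this,
  since its expectation drops by a fixed multiple of the probability that the count equals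
  \<open>k\<close>.

  Randomness enters only through the girth, which is decided by one finite level. Hence the loops
  and edges may be picked arbitrarily at that level and are still measurable.\<close>

definition inv_word :: "letter list \<Rightarrow> letter list" where
  "inv_word w = rev (map inv_letter w)"

definition reduce :: "letter list \<Rightarrow> letter list" where
  "reduce w = foldr cons_letter w []"

lemma inv_letter_inv_letter [simp]: "inv_letter (inv_letter a) = a"
  by (simp add: inv_letter_def)

lemma inv_letter_neq [simp]: "inv_letter a \<noteq> a" "a \<noteq> inv_letter a"
  by (simp_all add: inv_letter_def prod_eq_iff)

lemma fst_inv_letter [simp]: "fst (inv_letter a) = fst a"
  by (simp add: inv_letter_def)

lemma inv_letter_eq_iff: "inv_letter a = b \<longleftrightarrow> a = inv_letter b"
  by auto

lemma inv_word_simps [simp]: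
  "inv_word [] = []" "inv_word (a # w) = inv_word w @ [inv_letter a]"
  "inv_word (u @ v) = inv_word v @ inv_word u" "length (inv_word w) = length w"
  "fst ` set (inv_word w) = fst ` set w" "inv_word w = [] \<longleftrightarrow> w = []"
  by (auto simp: inv_word_def image_image)

lemma inv_word_inv_word [simp]: "inv_word (inv_word w) = w"
  by (induction w) auto

lemma hd_inv_word: "w \<noteq> [] \<Longrightarrow> hd (inv_word w) = inv_letter (last w)"
  by (simp add: inv_word_def hd_rev last_map)

lemma last_inv_word: "w \<noteq> [] \<Longrightarrow> last (inv_word w) = inv_letter (hd w)"
  by (simp add: inv_word_def last_rev hd_map)

lemma reduced_word_Nil [simp]: "reduced_word []"
  by (simp add: reduced_word_def)

lemma reduced_word_Cons:
  "reduced_word (a # w) \<longleftrightarrow> reduced_word w \<and> (w = [] \<or> hd w \<noteq> inv_letter a)"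
  by (auto simp: reduced_word_def successively_Cons)

lemma reduced_word_append:
  "reduced_word (u @ v) \<longleftrightarrow>
     reduced_word u \<and> reduced_word v \<and> (u = [] \<or> v = [] \<or> hd v \<noteq> inv_letter (last u))"
  by (simp add: reduced_word_def successively_append_iff)

lemma reduced_word_inv_word [simp]: "reduced_word (inv_word w) \<longleftrightarrow> reduced_word w"
proof (induction w)
  case (Cons a w)
  then show ?case
    by (auto simp: reduced_word_append reduced_word_Cons last_inv_word inv_letter_eq_iff)
qed simp

lemma reduced_word_take: "reduced_word w \<Longrightarrow> reduced_word (take n w)"
  by (metis append_take_drop_id reduced_word_append)

lemma cons_letter_Cons: "reduced_word (a # w) \<Longrightarrow> cons_letter a w = a # w"
  by (cases w) (auto simp: reduced_word_Cons)

lemma reduced_word_cons_letter: "reduced_word w \<Longrightarrow> reduced_word (cons_letter a w)"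
  by (cases w) (auto simp: reduced_word_Cons)

lemma cons_letter_cancel:
  assumes "reduced_word w"
  shows "cons_letter a (cons_letter (inv_letter a) w) = w"
  using assms by (cases w rule: list.exhaust; cases "tl w") (auto simp: reduced_word_Cons)

lemma set_cons_letter: "fst ` set (cons_letter a w) \<subseteq> insert (fst a) (fst ` set w)"
  by (cases w) auto

lemma length_cons_letter: "length (cons_letter a w) \<le> Suc (length w)"
  by (cases w) auto

lemma reduced_word_foldr: "reduced_word w \<Longrightarrow> reduced_word (foldr cons_letter u w)"
  by (induction u) (auto intro: reduced_word_cons_letter)

lemma reduced_word_reduce [simp]: "reduced_word (reduce w)"
  by (simp add: reduce_def reduced_word_foldr)

lemma set_foldr_cons_letter:
  "fst ` set (foldr cons_letter u w) \<subseteq> fst ` set u \<union> fst ` set w"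
proof (induction u)
  case (Cons a u)
  have "fst ` set (foldr cons_letter (a # u) w) \<subseteq> insert (fst a) (fst ` set (foldr cons_letter u w))"
    using set_cons_letter by simp
  also have "\<dots> \<subseteq> insert (fst a) (fst ` set u \<union> fst ` set w)"
    using Cons by blast
  finally show ?case by simp
qed simp

lemma length_foldr_cons_letter: "length (foldr cons_letter u w) \<le> length u + length w"
proof (induction u)
  case (Cons a u)
  then show ?case using length_cons_letter[of a "foldr cons_letter u w"] by simp
qed simp

lemma foldr_cons_letter_append: "reduced_word (u @ w) \<Longrightarrow> foldr cons_letter u w = u @ w"
proof (induction u)
  case (Cons a u)
  then have "foldr cons_letter u w = u @ w" by (auto simp: reduced_word_Cons)
  with Cons.prems show ?case by (simp add: cons_letter_Cons)
qed simp

lemma reduce_reduced [simp]: "reduced_word w \<Longrightarrow> reduce w = w"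
  using foldr_cons_letter_append[of w "[]"] by (simp add: reduce_def)

text \<open>The only case with content is a head of \<open>s\<close> that cancels \<open>a\<close>,
  settled by \<open>cons_letter_cancel\<close>. With it, associativity of the free group is
  composition of the actions of letters on reduced words (van der Waerden's argument).\<close>

lemma foldr_cons_letter_cons_letter:
  assumes "reduced_word z" "reduced_word s"
  shows "foldr cons_letter (cons_letter a s) z = cons_letter a (foldr cons_letter s z)"
proof (cases s)
  case (Cons b s')
  have "reduced_word (foldr cons_letter s' z)" using assms by (simp add: reduced_word_foldr)
  then show ?thesis using Cons
    by (auto dest: cons_letter_cancel[where a = a])
qed simp

lemma foldr_cons_letter_assoc:
  assumes "reduced_word z" "reduced_word v"
  shows "foldr cons_letter (foldr cons_letter u v) z = foldr cons_letter u (foldr cons_letter v z)"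
proof (induction u)
  case (Cons a u)
  then show ?case using assms
    by (simp add: foldr_cons_letter_cons_letter reduced_word_foldr)
qed simp

lemma foldr_cons_letter_inv_word:
  assumes "reduced_word v"
  shows "foldr cons_letter (inv_word w) (foldr cons_letter w v) = v"
  using assms
proof (induction w arbitrary: v)
  case (Cons a w)
  have "cons_letter (inv_letter a) (cons_letter a (foldr cons_letter w v)) = foldr cons_letter w v"
    using cons_letter_cancel[of "foldr cons_letter w v" "inv_letter a"] Cons.prems
    by (simp add: reduced_word_foldr)
  then show ?case using Cons by simp
qed simp

lemma carrier_free_group: "w \<in> carrier (free_group m) \<longleftrightarrow> reduced_word w \<and> fst ` set w \<subseteq> {1..m}"
  by (simp add: free_group_def)

lemma mult_free_group: "u \<otimes>\<^bsub>free_group m\<^esub> v = foldr cons_letter u v"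
  by (simp add: free_group_def)

lemma one_free_group: "\<one>\<^bsub>free_group m\<^esub> = []"
  by (simp add: free_group_def)

lemma group_free_group: "group (free_group m)"
proof (rule groupI)
  fix u v assume "u \<in> carrier (free_group m)" "v \<in> carrier (free_group m)"
  then show "u \<otimes>\<^bsub>free_group m\<^esub> v \<in> carrier (free_group m)"
    using order.trans[OF set_foldr_cons_letter[of u v], of "{1..m}"]
    by (simp add: carrier_free_group mult_free_group reduced_word_foldr)
next
  fix u v w assume "u \<in> carrier (free_group m)" "v \<in> carrier (free_group m)"
    "w \<in> carrier (free_group m)"
  then show "u \<otimes>\<^bsub>free_group m\<^esub> v \<otimes>\<^bsub>free_group m\<^esub> w =
      u \<otimes>\<^bsub>free_group m\<^esub> (v \<otimes>\<^bsub>free_group m\<^esub> w)"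
    by (simp add: carrier_free_group mult_free_group foldr_cons_letter_assoc)
next
  fix w assume w: "w \<in> carrier (free_group m)"
  have "foldr cons_letter (inv_word w) w = []"
    using foldr_cons_letter_inv_word[of "[]" w] w
    by (simp add: carrier_free_group foldr_cons_letter_append)
  then show "\<exists>u\<in>carrier (free_group m). u \<otimes>\<^bsub>free_group m\<^esub> w = \<one>\<^bsub>free_group m\<^esub>"
    using w by (intro bexI[of _ "inv_word w"])
      (auto simp: carrier_free_group mult_free_group one_free_group)
qed (auto simp: carrier_free_group mult_free_group one_free_group)

interpretation free_group: group "free_group m" for m
  by (rule group_free_group)

lemma inv_word_closed: "w \<in> carrier (free_group m) \<Longrightarrow> inv_word w \<in> carrier (free_group m)"
  by (simp add: carrier_free_group)

lemma inv_free_group: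
  assumes "w \<in> carrier (free_group m)"
  shows "inv\<^bsub>free_group m\<^esub> w = inv_word w"
proof (rule free_group.inv_equality)
  show "inv_word w \<otimes>\<^bsub>free_group m\<^esub> w = \<one>\<^bsub>free_group m\<^esub>"
    using foldr_cons_letter_inv_word[of "[]" w] assms
    by (simp add: carrier_free_group mult_free_group one_free_group foldr_cons_letter_append)
qed (use assms inv_word_closed in auto)

lemma length_mult_free_group:
  "length (u \<otimes>\<^bsub>free_group m\<^esub> v) \<le> length u + length v"
  by (simp add: mult_free_group length_foldr_cons_letter)

lemma length_pow_free_group:
  "length (u [^]\<^bsub>free_group m\<^esub> (n::nat)) \<le> n * length u"
proof (induction n)
  case (Suc n)
  then show ?case
    using length_mult_free_group[of m "u [^]\<^bsub>free_group m\<^esub> n" u] by (simp add: add.commute)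
qed (simp add: one_free_group)

lemma mult_free_group_append:
  "reduced_word (u @ v) \<Longrightarrow> u \<otimes>\<^bsub>free_group m\<^esub> v = u @ v"
  by (simp add: mult_free_group foldr_cons_letter_append)

lemma reduce_append: "reduce (u @ v) = reduce u \<otimes>\<^bsub>free_group m\<^esub> reduce v"
proof -
  have "foldr cons_letter (reduce u) (reduce v) = foldr cons_letter u (foldr cons_letter [] (reduce v))"
    unfolding reduce_def by (rule foldr_cons_letter_assoc) (simp_all add: reduced_word_foldr)
  then show ?thesis
    by (simp add: mult_free_group) (simp add: reduce_def)
qed

lemma take_closed: "w \<in> carrier (free_group m) \<Longrightarrow> take n w \<in> carrier (free_group m)"
  using set_take_subset[of n w] by (auto simp: carrier_free_group reduced_word_take)

lemma append_closedD:
  assumes "u @ v \<in> carrier (free_group m)"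
  shows "u \<in> carrier (free_group m)" "v \<in> carrier (free_group m)"
  using assms by (auto simp: carrier_free_group reduced_word_append)

lemma finite_free_group_ball: "finite {w \<in> carrier (free_group m). length w \<le> n}"
proof (rule finite_subset)
  show "{w \<in> carrier (free_group m). length w \<le> n} \<subseteq>
      {w. set w \<subseteq> {1..m} \<times> UNIV \<and> length w \<le> n}"
    by (force simp: carrier_free_group)
  show "finite {w. set w \<subseteq> {1..m} \<times> (UNIV :: bool set) \<and> length w \<le> n}"
    by (rule finite_lists_length_le) simp
qed

section \<open>Cyclically reduced words and normal forms of powers\<close>

definition cyc_reduced :: "letter list \<Rightarrow> bool" where
  "cyc_reduced x \<longleftrightarrow> x \<noteq> [] \<and> reduced_word x \<and> hd x \<noteq> inv_letter (last x)"

text \<open>Matching outer letters are stripped until the ends no longer cancel. The core cannot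
  become empty, because the last two letters stripped would be adjacent inverses in a reduced
  word.\<close>

lemma conj_cyc_reduced:
  assumes "reduced_word w" "w \<noteq> []"
  obtains c x where "w = c @ x @ inv_word c" "cyc_reduced x"
  using assms
proof (induction "length w" arbitrary: w thesis rule: less_induct)
  case less
  show ?case
  proof (cases "hd w = inv_letter (last w)")
    case False
    then show ?thesis using less.prems(1)[of "[]" w] less.prems by (simp add: cyc_reduced_def)
  next
    case True
    obtain l v where w: "w = l # v" using less.prems by (cases w) auto
    with True have "v \<noteq> []" by auto
    then obtain v' b where v: "v = v' @ [b]" by (metis rev_exhaust)
    have b: "b = inv_letter l" using True w v by simp
    have "v' \<noteq> []" using less.prems(2) w v b by (auto simp: reduced_word_Cons)
    moreover have "reduced_word v'" using less.prems(2) w v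
      by (auto simp: reduced_word_Cons reduced_word_append)
    ultimately obtain c x where "v' = c @ x @ inv_word c" "cyc_reduced x"
      using less.hyps[of v'] w v by auto
    then show ?thesis using less.prems(1)[of "l # c" x] w v b by simp
  qed
qed

lemma hd_last_concat_replicate:
  "x \<noteq> [] \<Longrightarrow> concat (replicate (Suc n) x) \<noteq> [] \<and> hd (concat (replicate (Suc n) x)) = hd x
     \<and> last (concat (replicate (Suc n) x)) = last x"
proof (induction n)
  case (Suc n)
  then show ?case
    by (metis append_is_Nil_conv concat.simps(2) hd_append2 last_appendR replicate_Suc)
qed auto

lemma cyc_reduced_pow:
  assumes "cyc_reduced x"
  shows "reduced_word (concat (replicate n x))"
proof (induction n)
  case (Suc n)
  show ?case
  proof (cases n)
    case (Suc k)
    then have "concat (replicate n x) \<noteq> [] \<and> hd (concat (replicate n x)) = hd x"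
      using hd_last_concat_replicate assms by (metis cyc_reduced_def)
    then show ?thesis using Suc.IH assms by (simp add: reduced_word_append cyc_reduced_def)
  qed (use assms in \<open>simp add: cyc_reduced_def\<close>)
qed simp

text \<open>The power of \<open>x\<close> begins and ends with the same letters as \<open>x\<close>,
  so its junctions with the arms are those of the reduced word for \<open>n = 1\<close>.\<close>

lemma reduced_conj_pow:
  assumes "cyc_reduced x" "reduced_word (c @ x @ inv_word c)" "n > 0"
  shows "reduced_word (c @ concat (replicate n x) @ inv_word c)"
proof -
  obtain k where k: "n = Suc k" using assms(3) by (cases n) auto
  have x: "x \<noteq> []" using assms(1) by (simp add: cyc_reduced_def)
  note * = hd_last_concat_replicate[OF x, of k, folded k]
  show ?thesis using assms(2) cyc_reduced_pow[OF assms(1), of n] * x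
    by (auto simp: reduced_word_append simp del: replicate_Suc)
qed

lemma reduce_concat_replicate:
  assumes "reduce x \<in> carrier (free_group m)"
  shows "reduce (concat (replicate n x)) = reduce x [^]\<^bsub>free_group m\<^esub> n"
proof (induction n)
  case 0
  then show ?case by (simp add: one_free_group)
next
  case (Suc n)
  then show ?case using assms free_group.nat_pow_Suc2[OF assms, of n]
    by (simp add: reduce_append[where m = m])
qed

lemma conj_pow_free_group:
  assumes "c \<in> carrier (free_group m)" "x \<in> carrier (free_group m)"
  shows "(c \<otimes>\<^bsub>free_group m\<^esub> x \<otimes>\<^bsub>free_group m\<^esub> inv_word c) [^]\<^bsub>free_group m\<^esub> (n::nat)
      = c \<otimes>\<^bsub>free_group m\<^esub> x [^]\<^bsub>free_group m\<^esub> n \<otimes>\<^bsub>free_group m\<^esub> inv_word c"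
proof (induction n)
  case 0
  then show ?case using assms by (simp add: inv_free_group[symmetric])
next
  case (Suc n)
  have "c \<otimes>\<^bsub>free_group m\<^esub> x [^]\<^bsub>free_group m\<^esub> n \<otimes>\<^bsub>free_group m\<^esub> inv_word c
     \<otimes>\<^bsub>free_group m\<^esub> (c \<otimes>\<^bsub>free_group m\<^esub> x \<otimes>\<^bsub>free_group m\<^esub> inv_word c) =
     c \<otimes>\<^bsub>free_group m\<^esub> x [^]\<^bsub>free_group m\<^esub> n \<otimes>\<^bsub>free_group m\<^esub> (inv_word c
     \<otimes>\<^bsub>free_group m\<^esub> c) \<otimes>\<^bsub>free_group m\<^esub> x \<otimes>\<^bsub>free_group m\<^esub> inv_word c"
    using assms by (simp add: free_group.m_assoc inv_word_closed)
  also have "inv_word c \<otimes>\<^bsub>free_group m\<^esub> c = \<one>\<^bsub>free_group m\<^esub>"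
    using assms by (simp add: inv_free_group[symmetric])
  finally show ?case using Suc assms by (simp add: free_group.m_assoc inv_word_closed)
qed

text \<open>Only the inner arms \<open>inv_word c\<close> and \<open>c\<close> cancel in a power.
  The explicit normal form is what allows powers of two words to be compared letter by
  letter.\<close>

lemma reduced_pow_free_group:
  assumes w: "w \<in> carrier (free_group m)" "w = c @ x @ inv_word c" and x: "cyc_reduced x" and n: "n > 0"
  shows "w [^]\<^bsub>free_group m\<^esub> n = c @ concat (replicate n x) @ inv_word c"
proof -
  have c: "c \<in> carrier (free_group m)" and xc: "x \<in> carrier (free_group m)"
    using w by (auto dest: append_closedD)
  have rx: "reduce x = x" and rc: "reduce c = c" "reduce (inv_word c) = inv_word c"
    using c xc by (simp_all add: carrier_free_group)
  have "w = c \<otimes>\<^bsub>free_group m\<^esub> x \<otimes>\<^bsub>free_group m\<^esub> inv_word c"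
    using w by (metis append_assoc reduce_append reduce_reduced carrier_free_group rc rx)
  then have "w [^]\<^bsub>free_group m\<^esub> n = c \<otimes>\<^bsub>free_group m\<^esub> x [^]\<^bsub>free_group m\<^esub> n \<otimes>\<^bsub>free_group m\<^esub> inv_word c"
    using conj_pow_free_group[OF c xc] by simp
  also have "\<dots> = reduce (c @ concat (replicate n x) @ inv_word c)"
    using c xc rx rc reduce_concat_replicate[of x m n]
    by (simp add: reduce_append[where m = m] free_group.m_assoc inv_word_closed)
  also have "\<dots> = c @ concat (replicate n x) @ inv_word c"
    using reduced_conj_pow[OF x _ n] w by (simp add: carrier_free_group)
  finally show ?thesis .
qed

section \<open>Common roots and noncyclic subgroups\<close>

lemma append_eq_append_takeI:
  assumes "xs @ ys = zs @ us" "length xs \<le> length zs"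
  shows "xs = take (length xs) zs"
  using assms by (metis append_eq_append_conv_if append_eq_conv_conj)

text \<open>Both \<open>x\<close> and \<open>y\<close> commute with the common power
  \<open>P\<close>, so \<open>x @ y\<close> and \<open>y @ x\<close> are prefixes of
  \<open>P @ P\<close> of equal length.\<close>

lemma concat_replicate_eq_commute:
  assumes "concat (replicate a x) = concat (replicate b y)" "a > 0" "b > 0"
  shows "x @ y = y @ (x::'a list)"
proof -
  define P where "P = concat (replicate a x)"
  have Px: "x @ P = P @ x" and Py: "y @ P = P @ y"
    using replicate_append_same[of a x] replicate_append_same[of b y] assms unfolding P_def
    by (metis concat.simps concat_append append_Nil2 replicate_Suc replicate_app_Cons_same)+
  have lx: "length x \<le> length P" using assms(2) unfolding P_def by (cases a) auto
  have ly: "length y \<le> length P" using assms(3) unfolding P_def assms(1) by (cases b) auto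
  have "(x @ y) @ P @ P = (P @ P) @ x @ y" "(y @ x) @ P @ P = (P @ P) @ y @ x"
    by (metis Px Py append_assoc)+
  note * = this[THEN append_eq_append_takeI]
  have le: "length (x @ y) \<le> length (P @ P)" "length (y @ x) \<le> length (P @ P)"
    using lx ly by simp_all
  have "x @ y = take (length (x @ y)) (P @ P)" by (rule *(1)[OF le(1)])
  moreover have "y @ x = take (length (y @ x)) (P @ P)" by (rule *(2)[OF le(2)])
  ultimately show ?thesis by (metis add.commute length_append)
qed

text \<open>If \<open>d\<close> were longer than \<open>c\<close>, its letter at position
  \<open>length c\<close> would be the first letter of \<open>X\<close> and, read from the right
  end, the inverse of the last one, so \<open>X\<close> would not be cyclically reduced. Applied in
  both directions, this makes the arms equal.\<close>

lemma conj_prefix_le: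
  assumes eq: "c @ X @ inv_word c = d @ Y @ inv_word d" and X: "cyc_reduced X"
  shows "length d \<le> length c"
proof (rule ccontr)
  assume "\<not> ?thesis"
  then have less: "length c < length d" by simp
  let ?W = "c @ X @ inv_word c"
  have X0: "X \<noteq> []" using X by (simp add: cyc_reduced_def)
  have "?W ! length c = hd X" using X0 by (simp add: nth_append hd_conv_nth)
  moreover have "?W ! length c = d ! length c" unfolding eq using less by (simp add: nth_append)
  moreover have "rev ?W ! length c = last X"
    using X0 by (simp add: nth_append inv_word_def hd_rev[symmetric] hd_conv_nth del: hd_rev)
  moreover have "rev ?W ! length c = inv_letter (d ! length c)"
    unfolding eq using less by (simp add: nth_append inv_word_def)
  ultimately show False using X by (simp add: cyc_reduced_def)
qed

text \<open>The normal forms of the two powers have the same arms, so the cores have a common power,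
  commute, and are powers of one word \<open>z\<close>; conjugating \<open>z\<close> back gives the
  root.\<close>

lemma pow_eq_common_root:
  assumes w: "w1 \<in> carrier (free_group m)" "w2 \<in> carrier (free_group m)" "w1 \<noteq> []" "w2 \<noteq> []"
    and eq: "w1 [^]\<^bsub>free_group m\<^esub> (a::nat) = w2 [^]\<^bsub>free_group m\<^esub> (b::nat)" and ab: "a > 0" "b > 0"
  obtains s p q where "s \<in> carrier (free_group m)" "p > 0" "q > 0"
    "w1 = s [^]\<^bsub>free_group m\<^esub> (p::nat)" "w2 = s [^]\<^bsub>free_group m\<^esub> (q::nat)"
proof -
  obtain c x where 1: "w1 = c @ x @ inv_word c" "cyc_reduced x"
    using conj_cyc_reduced w by (metis carrier_free_group)
  obtain d y where 2: "w2 = d @ y @ inv_word d" "cyc_reduced y"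
    using conj_cyc_reduced w by (metis carrier_free_group)
  have cyc: "cyc_reduced (concat (replicate n z))" if z: "cyc_reduced z" and n: "n > 0" for n z
  proof -
    obtain k where k: "n = Suc k" using n by (cases n) auto
    have "z \<noteq> []" using z by (simp add: cyc_reduced_def)
    from hd_last_concat_replicate[OF this, of k, folded k] show ?thesis
      using z cyc_reduced_pow[OF z, of n] by (simp add: cyc_reduced_def del: concat_eq_Nil_conv)
  qed
  have E: "c @ concat (replicate a x) @ inv_word c = d @ concat (replicate b y) @ inv_word d"
    using reduced_pow_free_group[OF w(1) 1 ab(1)] reduced_pow_free_group[OF w(2) 2 ab(2)] eq by simp
  have "length c = length d"
    using conj_prefix_le[OF E cyc[OF 1(2) ab(1)]] conj_prefix_le[OF E[symmetric] cyc[OF 2(2) ab(2)]]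
    by simp
  with E have cd: "c = d" "concat (replicate a x) = concat (replicate b y)" by auto
  obtain p q z where z: "concat (replicate p z) = x" "concat (replicate q z) = y"
    using comm_append_are_replicate[OF concat_replicate_eq_commute[OF cd(2) ab]] by blast
  have "p > 0" "q > 0" using z 1 2 by (auto simp: cyc_reduced_def intro: Nat.gr0I)
  have xm: "x \<in> carrier (free_group m)" and cm: "c \<in> carrier (free_group m)"
    using w 1 by (auto dest: append_closedD)
  have zm: "z \<in> carrier (free_group m)"
    using z(1) xm \<open>p > 0\<close> by (cases p) (auto dest: append_closedD)
  have rz: "reduce z = z" "reduce c = c" "reduce (inv_word c) = inv_word c"
    using zm cm by (simp_all add: carrier_free_group)
  let ?s = "c \<otimes>\<^bsub>free_group m\<^esub> z \<otimes>\<^bsub>free_group m\<^esub> inv_word c"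
  have red: "?s [^]\<^bsub>free_group m\<^esub> n = reduce (c @ concat (replicate n z) @ inv_word c)" for n
    using cm zm rz reduce_concat_replicate[of z m n] conj_pow_free_group[OF cm zm]
    by (simp add: reduce_append[where m = m] free_group.m_assoc inv_word_closed)
  have "?s [^]\<^bsub>free_group m\<^esub> p = w1" "?s [^]\<^bsub>free_group m\<^esub> q = w2"
    unfolding red z using w 1 2 cd(1) by (simp_all add: carrier_free_group)
  then show ?thesis
    using that[of ?s p q] \<open>p > 0\<close> \<open>q > 0\<close> zm cm by (simp add: inv_word_closed)
qed

text \<open>By Bezout the power of \<open>s\<close> with exponent \<open>gcd p q\<close> lies in the
  subgroup, and both generators are powers of it.\<close>

lemma cyclic_if_common_root:
  assumes s: "s \<in> carrier (free_group m)"
    and w: "w1 = s [^]\<^bsub>free_group m\<^esub> (p::int)" "w2 = s [^]\<^bsub>free_group m\<^esub> (q::int)"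
  shows "cyclic_group (subgroup_generated (free_group m) {w1, w2})"
proof -
  let ?D = "subgroup_generated (free_group m) {w1, w2}"
  interpret D: group ?D by simp
  have wc: "w1 \<in> carrier (free_group m)" "w2 \<in> carrier (free_group m)" using s w by auto
  have sub: "{w1, w2} \<subseteq> carrier ?D"
    by (rule free_group.subgroup_generated_subset_carrier_subset) (use wc in auto)
  obtain u v where uv: "u * p + v * q = gcd p q" using bezout_int by blast
  let ?x = "s [^]\<^bsub>free_group m\<^esub> gcd p q"
  have "?x = w1 [^]\<^bsub>free_group m\<^esub> u \<otimes>\<^bsub>free_group m\<^esub> w2 [^]\<^bsub>free_group m\<^esub> v"
    using s w by (simp add: uv[symmetric] free_group.int_pow_mult free_group.int_pow_pow mult.commute)
  also have "\<dots> = w1 [^]\<^bsub>?D\<^esub> u \<otimes>\<^bsub>?D\<^esub> w2 [^]\<^bsub>?D\<^esub> v"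
    using sub by (simp add: free_group.int_pow_subgroup_generated)
  also have "\<dots> \<in> carrier ?D"
    by (intro D.m_closed D.int_pow_closed) (use sub in auto)
  finally have xD: "?x \<in> carrier ?D" .
  have "w1 = ?x [^]\<^bsub>free_group m\<^esub> (p div gcd p q)" "w2 = ?x [^]\<^bsub>free_group m\<^esub> (q div gcd p q)"
    using s w by (simp_all add: free_group.int_pow_pow)
  then have "w1 \<in> carrier (subgroup_generated (free_group m) {?x})"
    "w2 \<in> carrier (subgroup_generated (free_group m) {?x})"
    using s by (auto simp: free_group.carrier_subgroup_generated_by_singleton)
  then have "carrier ?D \<subseteq> carrier (subgroup_generated (free_group m) {?x})"
    by (intro free_group.subgroup_generated_minimal free_group.subgroup_subgroup_generated) auto
  also have "\<dots> = range (\<lambda>n::int. ?x [^]\<^bsub>?D\<^esub> n)"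
    using s xD by (simp add: free_group.carrier_subgroup_generated_by_singleton
        free_group.int_pow_subgroup_generated)
  finally have "carrier ?D = range (\<lambda>n::int. ?x [^]\<^bsub>?D\<^esub> n)"
    using xD by auto
  then show ?thesis using xD D.cyclic_group by blast
qed

lemma pow_free_group_eq_one:
  assumes "w \<in> carrier (free_group m)" "w [^]\<^bsub>free_group m\<^esub> (n::nat) = []" "w \<noteq> []"
  shows "n = 0"
proof (rule ccontr)
  assume "n \<noteq> 0"
  obtain c x where x: "w = c @ x @ inv_word c" "cyc_reduced x"
    using conj_cyc_reduced assms by (metis carrier_free_group)
  with reduced_pow_free_group[OF assms(1) x, of n] assms(2) \<open>n \<noteq> 0\<close> show False
    by (auto simp: cyc_reduced_def)
qed

lemma noncyclic_pow_neq:
  assumes w: "w1 \<in> carrier (free_group m)" "w2 \<in> carrier (free_group m)"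
    and nc: "\<not> cyclic_group (subgroup_generated (free_group m) {w1, w2})"
  shows "w1 \<noteq> []" "w2 \<noteq> []"
    "w1 [^]\<^bsub>free_group m\<^esub> (a::nat) = w2 [^]\<^bsub>free_group m\<^esub> (b::nat) \<Longrightarrow> a = 0 \<and> b = 0"
    "w1 [^]\<^bsub>free_group m\<^esub> a = inv_word w2 [^]\<^bsub>free_group m\<^esub> b \<Longrightarrow> a = 0 \<and> b = 0"
proof -
  have "cyclic_group (subgroup_generated (free_group m) {w1, w2})" if "w1 = []"
    by (rule cyclic_if_common_root[of w2 m _ 0 _ 1]) (use w that in \<open>simp_all add: one_free_group\<close>)
  then show 1: "w1 \<noteq> []" using nc by blast
  have "cyclic_group (subgroup_generated (free_group m) {w1, w2})" if "w2 = []"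
    by (rule cyclic_if_common_root[of w1 m _ 1 _ 0]) (use w that in \<open>simp_all add: one_free_group\<close>)
  then show 2: "w2 \<noteq> []" using nc by blast
  \<comment> \<open>The exponent \<open>e = 1\<close> serves \<open>v = w2\<close> and
    \<open>e = -1\<close> serves \<open>v = inv_word w2\<close>; passing to the inverse keeps both
    exponents of the relation natural numbers.\<close>
  have key: "a = 0 \<and> b = 0"
    if v: "v \<in> carrier (free_group m)" "v \<noteq> []"
      and eq: "w1 [^]\<^bsub>free_group m\<^esub> a = v [^]\<^bsub>free_group m\<^esub> b"
      and e: "w2 = v [^]\<^bsub>free_group m\<^esub> (e::int)" for v e and a b :: nat
  proof (rule ccontr)
    assume n: "\<not> (a = 0 \<and> b = 0)"
    have "b = 0" if "a = 0"
      using eq pow_free_group_eq_one[OF v(1) _ v(2), of b] that by (simp add: one_free_group)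
    moreover have "a = 0" if "b = 0"
      using eq pow_free_group_eq_one[OF w(1) _ 1, of a] that by (simp add: one_free_group)
    ultimately have "a > 0" "b > 0" using n by auto
    then obtain s p q where s: "s \<in> carrier (free_group m)"
      "w1 = s [^]\<^bsub>free_group m\<^esub> (p::nat)" "v = s [^]\<^bsub>free_group m\<^esub> (q::nat)"
      using pow_eq_common_root[OF w(1) v(1) 1 v(2) eq] by blast
    then have "w1 = s [^]\<^bsub>free_group m\<^esub> int p" "w2 = s [^]\<^bsub>free_group m\<^esub> (int q * e)"
      using e by (simp_all add: int_pow_int free_group.int_pow_pow[symmetric])
    then show False using cyclic_if_common_root[OF s(1)] nc by blast
  qed
  show "a = 0 \<and> b = 0" if "w1 [^]\<^bsub>free_group m\<^esub> a = w2 [^]\<^bsub>free_group m\<^esub> b"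
    using key[OF w(2) 2 that, of 1] w by simp
  show "a = 0 \<and> b = 0" if "w1 [^]\<^bsub>free_group m\<^esub> a = inv_word w2 [^]\<^bsub>free_group m\<^esub> b"
    using key[OF inv_word_closed[OF w(2)] _ that, of "-1"] 2 w
    by (simp add: inv_word_closed free_group.int_pow_neg inv_free_group)
qed

text \<open>Cancelling leaves \<open>w1\<close> to the power \<open>i - k\<close> equal to
  \<open>w2\<close> to the power \<open>l - j\<close>, with \<open>k \<le> i\<close> by symmetry;
  the two signs of \<open>l - j\<close> are the last two claims of
  \<open>noncyclic_pow_neq\<close>.\<close>

lemma noncyclic_pow_mult_inj:
  assumes w: "w1 \<in> carrier (free_group m)" "w2 \<in> carrier (free_group m)"
    and nc: "\<not> cyclic_group (subgroup_generated (free_group m) {w1, w2})"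
    and eq: "w1 [^]\<^bsub>free_group m\<^esub> (i::nat) \<otimes>\<^bsub>free_group m\<^esub> w2 [^]\<^bsub>free_group m\<^esub> (j::nat) =
      w1 [^]\<^bsub>free_group m\<^esub> (k::nat) \<otimes>\<^bsub>free_group m\<^esub> w2 [^]\<^bsub>free_group m\<^esub> (l::nat)"
  shows "i = k \<and> j = l"
proof -
  have main: "i = k \<and> j = l"
    if eq: "w1 [^]\<^bsub>free_group m\<^esub> i \<otimes>\<^bsub>free_group m\<^esub> w2 [^]\<^bsub>free_group m\<^esub> j =
      w1 [^]\<^bsub>free_group m\<^esub> k \<otimes>\<^bsub>free_group m\<^esub> w2 [^]\<^bsub>free_group m\<^esub> l" and ik: "k \<le> i" for i j k l :: nat
  proof -
    let ?F = "free_group m"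
    have "w1 [^]\<^bsub>?F\<^esub> k \<otimes>\<^bsub>?F\<^esub> (w1 [^]\<^bsub>?F\<^esub> (i - k) \<otimes>\<^bsub>?F\<^esub> w2 [^]\<^bsub>?F\<^esub> j) =
        w1 [^]\<^bsub>?F\<^esub> k \<otimes>\<^bsub>?F\<^esub> w2 [^]\<^bsub>?F\<^esub> l"
      using eq ik w by (simp add: free_group.m_assoc[symmetric] free_group.nat_pow_mult)
    then have 1: "w1 [^]\<^bsub>?F\<^esub> (i - k) \<otimes>\<^bsub>?F\<^esub> w2 [^]\<^bsub>?F\<^esub> j = w2 [^]\<^bsub>?F\<^esub> l"
      using w by simp
    have "w1 [^]\<^bsub>?F\<^esub> (i - k) = w2 [^]\<^bsub>?F\<^esub> l \<otimes>\<^bsub>?F\<^esub> inv\<^bsub>?F\<^esub> (w2 [^]\<^bsub>?F\<^esub> j)"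
      using w unfolding 1[symmetric] by (simp add: free_group.m_assoc)
    also have "\<dots> = w2 [^]\<^bsub>?F\<^esub> (int l - int j)"
      using w by (simp add: free_group.int_pow_diff int_pow_int)
    finally have 2: "w1 [^]\<^bsub>?F\<^esub> (i - k) = w2 [^]\<^bsub>?F\<^esub> (int l - int j)" .
    show ?thesis
    proof (cases "j \<le> l")
      case True
      then have "w1 [^]\<^bsub>?F\<^esub> (i - k) = w2 [^]\<^bsub>?F\<^esub> (l - j)"
        using 2 by (simp flip: of_nat_diff add: int_pow_int)
      then show ?thesis using noncyclic_pow_neq(3)[OF w nc] ik True by fastforce
    next
      case False
      then have "w1 [^]\<^bsub>?F\<^esub> (i - k) = w2 [^]\<^bsub>?F\<^esub> (- int (j - l))" using 2 by simp
      also have "\<dots> = inv_word w2 [^]\<^bsub>?F\<^esub> (j - l)"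
        using w by (simp only: free_group.int_pow_neg int_pow_int inv_free_group[symmetric]
            free_group.nat_pow_inv)
      finally show ?thesis using noncyclic_pow_neq(4)[OF w nc] False by fastforce
    qed
  qed
  show ?thesis
  proof (cases "k \<le> i")
    case True
    then show ?thesis using main[OF eq] by blast
  next
    case False
    then show ?thesis using main[OF eq[symmetric]] by simp
  qed
qed

section \<open>Free group actions of large girth\<close>

text \<open>After \<open>k\<close> full turns a further prefix of \<open>w\<close> cannot bring the
  walk back to \<open>c\<close>: inside the arm it only undoes part of the last
  \<open>inv_word c\<close>, beyond the arm it undoes all of it and then lengthens the power of
  \<open>x\<close>.\<close>

lemma length_pow_mult_take:
  assumes w: "w \<in> carrier (free_group m)" "w = c @ x @ inv_word c" and x: "cyc_reduced x" and k: "k > 0"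
  shows "length (w [^]\<^bsub>free_group m\<^esub> (k::nat) \<otimes>\<^bsub>free_group m\<^esub> take p w) \<ge> length c + length x"
proof -
  let ?X = "concat (replicate k x)"
  have W: "w [^]\<^bsub>free_group m\<^esub> k = c @ ?X @ inv_word c"
    by (rule reduced_pow_free_group[OF w x k])
  have Wc: "c @ ?X @ inv_word c \<in> carrier (free_group m)"
    using w(1) by (simp flip: W)
  have lX: "length x \<le> length ?X" using k by (cases k) auto
  show ?thesis
  proof (cases "p \<le> length c")
    case True
    let ?u = "c @ ?X @ inv_word (drop p c)" and ?t = "take p c"
    have "inv_word c = inv_word (drop p c) @ inv_word ?t"
      by (metis append_take_drop_id inv_word_simps(3))
    then have ut: "c @ ?X @ inv_word c = ?u @ inv_word ?t" by simp
    then have c: "?u \<in> carrier (free_group m)" "inv_word ?t \<in> carrier (free_group m)"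
      using Wc append_closedD by metis+
    then have t: "?t \<in> carrier (free_group m)" using inv_word_closed by fastforce
    have "w [^]\<^bsub>free_group m\<^esub> k \<otimes>\<^bsub>free_group m\<^esub> ?t = ?u \<otimes>\<^bsub>free_group m\<^esub> inv_word ?t \<otimes>\<^bsub>free_group m\<^esub> ?t"
      using Wc unfolding W ut by (subst mult_free_group_append) (auto simp: carrier_free_group)
    also have "\<dots> = ?u"
      using c t by (simp add: free_group.m_assoc inv_free_group[symmetric])
    finally have "w [^]\<^bsub>free_group m\<^esub> k \<otimes>\<^bsub>free_group m\<^esub> take p w = ?u"
      using True w(2) by simp
    then show ?thesis using lX by simp
  next
    case False
    define s where "s = take (p - length c) (x @ inv_word c)"
    have tk: "take p w = c @ s" using False w(2) by (simp add: s_def)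
    have "c @ concat (replicate (Suc k) x) @ inv_word c \<in> carrier (free_group m)"
      using reduced_pow_free_group[OF w x, of "Suc k"] w(1) by (metis free_group.nat_pow_closed zero_less_Suc)
    moreover have "concat (replicate (Suc k) x) = ?X @ x"
      by (metis concat.simps(1,2) concat_append append_Nil2 replicate_Suc replicate_append_same)
    ultimately have "(c @ ?X) @ (x @ inv_word c) \<in> carrier (free_group m)" by (metis append_assoc)
    then have "((c @ ?X) @ s) @ drop (p - length c) (x @ inv_word c) \<in> carrier (free_group m)"
      unfolding s_def by (metis append_assoc append_take_drop_id)
    then have cXs: "(c @ ?X) @ s \<in> carrier (free_group m)" by (rule append_closedD)
    then have cX: "c @ ?X \<in> carrier (free_group m)" and s: "s \<in> carrier (free_group m)"
      by (rule append_closedD)+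
    have cc: "c \<in> carrier (free_group m)" using w by (auto dest: append_closedD)
    have cs: "c @ s \<in> carrier (free_group m)" using w(1) tk take_closed by metis
    have "w [^]\<^bsub>free_group m\<^esub> k \<otimes>\<^bsub>free_group m\<^esub> (c @ s)
       = ((c @ ?X) \<otimes>\<^bsub>free_group m\<^esub> inv_word c) \<otimes>\<^bsub>free_group m\<^esub> (c \<otimes>\<^bsub>free_group m\<^esub> s)"
      using Wc cs unfolding W by (simp add: mult_free_group_append carrier_free_group)
    also have "\<dots> = (c @ ?X) \<otimes>\<^bsub>free_group m\<^esub> ((inv_word c \<otimes>\<^bsub>free_group m\<^esub> c) \<otimes>\<^bsub>free_group m\<^esub> s)"
      using cX cc s by (simp add: free_group.m_assoc inv_word_closed)
    also have "inv_word c \<otimes>\<^bsub>free_group m\<^esub> c = \<one>\<^bsub>free_group m\<^esub>"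
      using cc by (simp add: inv_free_group[symmetric])
    also have "(c @ ?X) \<otimes>\<^bsub>free_group m\<^esub> (\<one>\<^bsub>free_group m\<^esub> \<otimes>\<^bsub>free_group m\<^esub> s) = (c @ ?X) @ s"
      using cXs s mult_free_group_append[of "c @ ?X" s m] by (simp add: carrier_free_group)
    finally show ?thesis using lX tk by simp
  qed
qed

lemma length_follow_word [simp]: "length (follow_word \<phi> v w) = length w"
  by (induction w arbitrary: v) auto

lemma passes_append [simp]: "passes (p @ q) E = passes p E + passes q E"
  by (simp add: passes_def)

lemma passes_Nil [simp]: "passes [] E = 0"
  by (simp add: passes_def)

lemma iota_path_append [simp]: "iota_path \<phi> (p @ q) = iota_path \<phi> p @ iota_path \<phi> q"
  by (simp add: iota_path_def)

lemma iota_path_Nil [simp]: "iota_path \<phi> [] = []"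
  by (simp add: iota_path_def)

lemma iota_path_Cons: "iota_path \<phi> ((x, s) # p) = follow_word \<phi> x s @ iota_path \<phi> p"
  by (simp add: iota_path_def)

lemma card_filter_split:
  assumes "finite A"
  shows "card A = card {x \<in> A. P x} + card {x \<in> A. \<not> P x}"
proof -
  have "A = {x \<in> A. P x} \<union> {x \<in> A. \<not> P x}" by blast
  moreover have "card ({x \<in> A. P x} \<union> {x \<in> A. \<not> P x}) = card {x \<in> A. P x} + card {x \<in> A. \<not> P x}"
    by (rule card_Un_disjoint) (use assms in auto)
  ultimately show ?thesis by simp
qed

lemma card_filter_sum: "finite A \<Longrightarrow> card {x \<in> A. P x} = (\<Sum>x\<in>A. if P x then 1 else 0)"
  by (simp add: sum.If_cases Int_def)

lemma is_path_append: "is_path G u p x \<Longrightarrow> is_path G x q v \<Longrightarrow> is_path G u (p @ q) v"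
  by (induction p arbitrary: u) auto

text \<open>A right action of the free group on the vertex set \<open>V\<close>, the image \<open>v\<^sup>g\<close> being \<open>\<phi> g v\<close>.\<close>

locale free_action =
  fixes m :: nat and V :: "nat list set" and \<phi> :: "letter list \<Rightarrow> nat list \<Rightarrow> nat list"
  assumes finite_V: "finite V"
    and act_closed: "\<And>v g. v \<in> V \<Longrightarrow> g \<in> carrier (free_group m) \<Longrightarrow> \<phi> g v \<in> V"
    and act_one: "\<And>v. v \<in> V \<Longrightarrow> \<phi> [] v = v"
    and act_mult: "\<And>v g h. v \<in> V \<Longrightarrow> g \<in> carrier (free_group m) \<Longrightarrow> h \<in> carrier (free_group m) \<Longrightarrow>
      \<phi> (g \<otimes>\<^bsub>free_group m\<^esub> h) v = \<phi> h (\<phi> g v)"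
begin

abbreviation FG where "FG \<equiv> free_group m"

lemma act_inv:
  assumes "v \<in> V" "g \<in> carrier FG"
  shows "\<phi> (inv_word g) (\<phi> g v) = v" "\<phi> g (\<phi> (inv_word g) v) = v"
  using assms act_mult[of v g "inv_word g"] act_mult[of v "inv_word g" g] act_one[of v]
  by (simp_all add: inv_word_closed inv_free_group[symmetric])
     (simp_all add: one_free_group)

lemma act_inj:
  assumes "u \<in> V" "v \<in> V" "g \<in> carrier FG" "\<phi> g u = \<phi> g v"
  shows "u = v"
  using assms act_inv(1) by metis

definition girth_gt :: "nat \<Rightarrow> bool" where
  "girth_gt \<gamma> \<longleftrightarrow> (\<forall>v\<in>V. \<forall>g\<in>carrier FG. g \<noteq> [] \<and> length g \<le> \<gamma> \<longrightarrow> \<phi> g v \<noteq> v)"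

text \<open>The form in which girth is used: short words are separated by their images of a single
  vertex, since otherwise \<open>g\<close> times the inverse of \<open>h\<close> would fix
  it.\<close>

lemma girth_eq:
  assumes \<gamma>: "girth_gt \<gamma>" and v: "v \<in> V" and gh: "g \<in> carrier FG" "h \<in> carrier FG" "length g + length h \<le> \<gamma>"
    and eq: "\<phi> g v = \<phi> h v"
  shows "g = h"
proof -
  have hi: "inv_word h \<in> carrier FG" by (rule inv_word_closed[OF gh(2)])
  have "\<phi> (g \<otimes>\<^bsub>FG\<^esub> inv_word h) v = v"
    using v gh eq hi by (simp add: act_mult act_inv)
  moreover have "length (g \<otimes>\<^bsub>FG\<^esub> inv_word h) \<le> \<gamma>"
    using length_mult_free_group[of m g "inv_word h"] gh(3) by simp
  ultimately have "g \<otimes>\<^bsub>FG\<^esub> inv_word h = \<one>\<^bsub>FG\<^esub>"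
    using \<gamma> v gh hi unfolding girth_gt_def by (auto simp: one_free_group)
  then show ?thesis
    using gh hi by (metis free_group.inv_equality free_group.inv_inv inv_free_group)
qed

section \<open>Boundaries of vertex sets and the isoperimetric bound\<close>

definition esc :: "nat list set \<Rightarrow> letter list \<Rightarrow> nat" where
  "esc A g = card {u \<in> A. \<phi> g u \<notin> A}"

text \<open>A point of \<open>A\<close> that stays under \<open>g\<close> but leaves under the
  product is carried by \<open>g\<close>, injectively, to a point of \<open>A\<close> leaving under
  \<open>h\<close>.\<close>

lemma esc_mult:
  assumes "A \<subseteq> V" "g \<in> carrier FG" "h \<in> carrier FG"
  shows "esc A (g \<otimes>\<^bsub>FG\<^esub> h) \<le> esc A g + esc A h"
proof -
  have fA: "finite A" using assms(1) finite_V finite_subset by blast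
  let ?B = "{u \<in> A. \<phi> g u \<in> A \<and> \<phi> h (\<phi> g u) \<notin> A}"
  have "card ?B = card (\<phi> g ` ?B)"
    by (rule card_image[symmetric]) (use assms act_inj in \<open>blast intro: inj_onI\<close>)
  also have "\<dots> \<le> esc A h"
    unfolding esc_def by (rule card_mono) (use fA in auto)
  finally have B: "card ?B \<le> esc A h" .
  have "esc A (g \<otimes>\<^bsub>FG\<^esub> h) \<le> card ({u \<in> A. \<phi> g u \<notin> A} \<union> ?B)"
    unfolding esc_def by (rule card_mono) (use fA assms act_mult in auto)
  also have "\<dots> \<le> esc A g + card ?B" unfolding esc_def by (rule card_Un_le)
  finally show ?thesis using B by simp
qed

lemma esc_pow:
  assumes "A \<subseteq> V" "g \<in> carrier FG"
  shows "esc A (g [^]\<^bsub>FG\<^esub> (k::nat)) \<le> k * esc A g"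
proof (induction k)
  case 0
  have "\<phi> [] u = u" if "u \<in> A" for u using that assms act_one by auto
  then have "{u \<in> A. \<phi> [] u \<notin> A} = {}" by auto
  then have "esc A [] = 0" unfolding esc_def by (metis card.empty)
  then show ?case by (simp add: one_free_group)
next
  case (Suc k)
  then show ?case using esc_mult[OF assms(1), of "g [^]\<^bsub>FG\<^esub> k" g] assms by simp
qed

text \<open>In a finite set as many points leave under \<open>g\<close> as under its inverse,
  because the translation matches the points that stay.\<close>

lemma esc_inv:
  assumes A: "A \<subseteq> V" "g \<in> carrier FG"
  shows "esc A (inv_word g) = esc A g"
proof -
  have gi: "inv_word g \<in> carrier FG" by (rule inv_word_closed[OF A(2)])
  have fA: "finite A" using A finite_V finite_subset by blast
  have le: "card {u \<in> A. \<phi> g u \<notin> A} \<le> card {u \<in> A. \<phi> (inv_word g) u \<notin> A}"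
    if g: "g \<in> carrier FG" for g
  proof -
    have gi: "inv_word g \<in> carrier FG" by (rule inv_word_closed[OF g])
    let ?S = "{u \<in> A. \<phi> g u \<in> A}"
    have 1: "card A = card ?S + card {u \<in> A. \<phi> g u \<notin> A}"
      by (rule card_filter_split[OF fA])
    let ?T = "{u \<in> A. \<phi> (inv_word g) u \<in> A}"
    have 2: "card A = card ?T + card {u \<in> A. \<phi> (inv_word g) u \<notin> A}"
      by (rule card_filter_split[OF fA])
    have "card ?T = card (\<phi> (inv_word g) ` ?T)"
      by (rule card_image[symmetric]) (use A gi act_inj in \<open>blast intro: inj_onI\<close>)
    also have "\<dots> \<le> card ?S"
      by (rule card_mono) (use fA A act_inv[OF _ g] in auto)
    finally show ?thesis using 1 2 by simp
  qed
  show ?thesis using le[OF A(2)] le[OF gi] unfolding esc_def by simp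
qed

definition bd :: "letter list \<Rightarrow> letter list \<Rightarrow> nat list set \<Rightarrow> nat" where
  "bd w1 w2 A = esc A w1 + esc A w2"

text \<open>Counting the pairs \<open>(u, (i, j))\<close> such that the translation by \<open>w\<^sub>1\<^sup>i w\<^sub>2\<^sup>j\<close> moves \<open>u\<close> out of \<open>A\<close>.\<close>

lemma isoperimetric:
  assumes \<gamma>: "girth_gt \<gamma>" and A: "A \<subseteq> V" "r * r < 2 * card A" "2 * card A \<le> Suc r * Suc r"
    and w: "w1 \<in> carrier FG" "w2 \<in> carrier FG"
    and nc: "\<not> cyclic_group (subgroup_generated FG {w1, w2})"
    and len: "2 * r * (length w1 + length w2) \<le> \<gamma>"
  shows "card A \<le> 2 * r * bd w1 w2 A"
proof -
  have fA: "finite A" using A finite_V finite_subset by blast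
  define S where "S = {0..r} \<times> {0..r}"
  define N where "N = Suc r * Suc r"
  define g where "g = (\<lambda>(i::nat, j::nat). w1 [^]\<^bsub>FG\<^esub> i \<otimes>\<^bsub>FG\<^esub> w2 [^]\<^bsub>FG\<^esub> j)"
  have S: "finite S" "card S = N" by (simp_all add: S_def N_def)
  have gc: "g s \<in> carrier FG" for s using w by (simp add: g_def split: prod.split)
  have gl: "length (g s) \<le> r * (length w1 + length w2)" if "s \<in> S" for s
  proof -
    obtain i j where s: "s = (i, j)" by (cases s)
    have ij: "i \<le> r" "j \<le> r" using that s by (auto simp: S_def)
    have "length (g s) \<le> i * length w1 + j * length w2"
      using length_mult_free_group[of m "w1 [^]\<^bsub>FG\<^esub> i" "w2 [^]\<^bsub>FG\<^esub> j"]
        length_pow_free_group[of m w1 i] length_pow_free_group[of m w2 j] by (simp add: g_def s)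
    also have "\<dots> \<le> r * length w1 + r * length w2"
      using ij by (intro add_mono mult_right_mono) auto
    finally show ?thesis by (simp add: distrib_left)
  qed
  have inj: "inj_on (\<lambda>s. \<phi> (g s) u) S" if u: "u \<in> V" for u
  proof (rule inj_onI)
    fix s t assume st: "s \<in> S" "t \<in> S" "\<phi> (g s) u = \<phi> (g t) u"
    have "g s = g t"
      by (rule girth_eq[OF \<gamma> u gc gc _ st(3)]) (use gl[OF st(1)] gl[OF st(2)] len in simp)
    then show "s = t"
      using noncyclic_pow_mult_inj[OF w nc] by (auto simp: g_def split: prod.splits)
  qed
  \<comment> \<open>The \<open>N\<close> translates of \<open>u\<close> are distinct and
    \<open>A\<close> has at most \<open>N / 2\<close> elements, so at least half of them leave
    \<open>A\<close>.\<close>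
  have half: "N \<le> 2 * card {s \<in> S. \<phi> (g s) u \<notin> A}" if u: "u \<in> A" for u
  proof -
    have uV: "u \<in> V" using u A by auto
    have "card {s \<in> S. \<phi> (g s) u \<in> A} = card ((\<lambda>s. \<phi> (g s) u) ` {s \<in> S. \<phi> (g s) u \<in> A})"
      by (rule card_image[symmetric]) (rule inj_on_subset[OF inj[OF uV]], auto)
    also have "\<dots> \<le> card A" by (rule card_mono) (use fA in auto)
    finally have "card {s \<in> S. \<phi> (g s) u \<in> A} \<le> card A" .
    moreover have "card S = card {s \<in> S. \<phi> (g s) u \<in> A} + card {s \<in> S. \<phi> (g s) u \<notin> A}"
      by (rule card_filter_split[OF S(1)])
    ultimately show ?thesis using A(3) S N_def by linarith
  qed
  have "card A * N \<le> (\<Sum>u\<in>A. 2 * card {s \<in> S. \<phi> (g s) u \<notin> A})"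
    using sum_mono[of A "\<lambda>_. N", OF half] by simp
  also have "\<dots> = 2 * (\<Sum>u\<in>A. card {s \<in> S. \<phi> (g s) u \<notin> A})" by (simp add: sum_distrib_left)
  also have "(\<Sum>u\<in>A. card {s \<in> S. \<phi> (g s) u \<notin> A}) = (\<Sum>s\<in>S. esc A (g s))"
    unfolding esc_def card_filter_sum[OF fA] card_filter_sum[OF S(1)] by (rule sum.swap)
  also have "\<dots> \<le> (\<Sum>s\<in>S. r * bd w1 w2 A)"
  proof (rule sum_mono)
    fix s assume "s \<in> S"
    then obtain i j where s: "s = (i, j)" "i \<le> r" "j \<le> r" by (auto simp: S_def)
    have "esc A (g s) \<le> i * esc A w1 + j * esc A w2"
      using esc_mult[OF A(1), of "w1 [^]\<^bsub>FG\<^esub> i" "w2 [^]\<^bsub>FG\<^esub> j"] esc_pow[OF A(1) w(1), of i]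
        esc_pow[OF A(1) w(2), of j] w by (simp add: g_def s)
    also have "\<dots> \<le> r * esc A w1 + r * esc A w2"
      using s by (intro add_mono mult_right_mono) auto
    finally show "esc A (g s) \<le> r * bd w1 w2 A" by (simp add: bd_def distrib_left)
  qed
  also have "\<dots> = N * (r * bd w1 w2 A)" using S by simp
  finally have "N * card A \<le> N * (2 * r * bd w1 w2 A)" by (simp only: mult.commute mult.left_commute mult.assoc)
  moreover have "N > 0" by (simp add: N_def)
  ultimately show ?thesis by simp
qed

text \<open>Origin of \<open>8 * M * M\<close>: a boundary of at most \<open>M\<close> gives
  \<open>card A \<le> 2 * r * M\<close> with \<open>r * r < 2 * card A\<close>, and squaring yields
  \<open>card A \<le> 8 * M * M\<close>. The upper bound \<open>L\<close> keeps the words involved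
  within the girth.\<close>

lemma no_medium_sets:
  assumes \<gamma>: "girth_gt \<gamma>" and A: "A \<subseteq> V" "8 * M * M < card A" "card A \<le> L"
    and w: "w1 \<in> carrier FG" "w2 \<in> carrier FG"
    and nc: "\<not> cyclic_group (subgroup_generated FG {w1, w2})"
    and len: "4 * L * (length w1 + length w2) \<le> \<gamma>"
  shows "M < bd w1 w2 A"
proof (rule ccontr)
  assume "\<not> ?thesis"
  then have M: "bd w1 w2 A \<le> M" by simp
  define r where "r = (LEAST r. 2 * card A \<le> Suc r * Suc r)"
  have r: "2 * card A \<le> Suc r * Suc r"
    unfolding r_def by (rule LeastI[of _ "2 * card A"]) simp
  have r': "r * r < 2 * card A"
  proof (cases r)
    case (Suc q)
    have "q < r" using Suc by simp
    then have "\<not> 2 * card A \<le> Suc q * Suc q"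
      unfolding r_def by (rule not_less_Least)
    then show ?thesis using Suc by simp
  qed (use A in auto)
  \<comment> \<open>This crude way to bound \<open>r\<close> by \<open>2 * L\<close> is the source
    of the factor \<open>4 * L\<close> in the girth hypothesis.\<close>
  have "r \<le> r * r" by (cases r) auto
  then have "r \<le> 2 * L" using r' A(3) by linarith
  then have "2 * r * (length w1 + length w2) \<le> 2 * (2 * L) * (length w1 + length w2)"
    by (intro mult_right_mono mult_left_mono) auto
  then have "card A \<le> 2 * r * bd w1 w2 A"
    by (intro isoperimetric[OF \<gamma> A(1) r' r w nc]) (use len in linarith)
  also have "\<dots> \<le> 2 * r * M" using M by simp
  finally have 1: "card A \<le> 2 * r * M" .
  have "card A * card A \<le> (2 * r * M) * (2 * r * M)" by (intro mult_mono 1) auto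
  also have "\<dots> = (r * r) * (4 * M * M)" by (simp add: algebra_simps)
  also have "\<dots> \<le> (2 * card A) * (4 * M * M)" using r' by (intro mult_right_mono) auto
  also have "\<dots> = card A * (8 * M * M)" by simp
  finally have "card A * card A \<le> card A * (8 * M * M)" .
  moreover have "card A * (8 * M * M) < card A * card A"
    by (rule mult_strict_left_mono) (use A(2) in auto)
  ultimately show False by simp
qed

text \<open>A point leaving its piece either leaves \<open>A\<close> or has an edge across the cut,
  which puts it in \<open>B1\<close> or \<open>B2\<close>; as the pieces are disjoint, it is counted
  once for each generator.\<close>

lemma bd_cut:
  assumes A: "A \<subseteq> V"
    and C: "\<And>u. u \<in> V \<Longrightarrow> u \<notin> B1 \<Longrightarrow> u \<in> C \<longleftrightarrow> \<phi> w1 u \<in> C"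
      "\<And>u. u \<in> V \<Longrightarrow> u \<notin> B2 \<Longrightarrow> u \<in> C \<longleftrightarrow> \<phi> w2 u \<in> C"
    and B: "B1 \<subseteq> V" "B2 \<subseteq> V"
  shows "bd w1 w2 (A \<inter> C) + bd w1 w2 (A - C) \<le> bd w1 w2 A + card B1 + card B2"
proof -
  have fA: "finite A" using A finite_V finite_subset by blast
  have "esc (A \<inter> C) g + esc (A - C) g \<le> esc A g + card B"
    if "\<And>u. u \<in> V \<Longrightarrow> u \<notin> B \<Longrightarrow> u \<in> C \<longleftrightarrow> \<phi> g u \<in> C" "B \<subseteq> V" for g B
  proof -
    have fB: "finite B" using that finite_V finite_subset by blast
    have "esc (A \<inter> C) g + esc (A - C) g =
        card ({u \<in> A \<inter> C. \<phi> g u \<notin> A \<inter> C} \<union> {u \<in> A - C. \<phi> g u \<notin> A - C})"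
      unfolding esc_def by (rule card_Un_disjoint[symmetric]) (use fA in auto)
    also have "\<dots> \<le> card ({u \<in> A. \<phi> g u \<notin> A} \<union> B)"
      by (rule card_mono) (use fA fB A that in auto)
    also have "\<dots> \<le> esc A g + card B" unfolding esc_def by (rule card_Un_le)
    finally show ?thesis .
  qed
  from this[OF C(1) B(1)] this[OF C(2) B(2)] show ?thesis by (simp add: bd_def)
qed

text \<open>Greedy choice: each chosen point excludes at most one ball of radius \<open>D\<close>.
  Excluding the images of old points under short words excludes the preimages as well, by inverse
  words.\<close>

lemma far_points:
  assumes A: "A \<subseteq> V" "K * card {g \<in> carrier FG. length g \<le> D} < card A"
  shows "\<exists>u :: nat \<Rightarrow> nat list. \<forall>j\<in>{1..K}. u j \<in> A \<and>
    (\<forall>i\<in>{1..K}. i \<noteq> j \<longrightarrow> (\<forall>g\<in>carrier FG. length g \<le> D \<longrightarrow> \<phi> g (u i) \<noteq> u j))"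
  using A(2)
proof (induction K)
  case (Suc K)
  let ?G = "{g \<in> carrier FG. length g \<le> D}"
  have fA: "finite A" using A(1) finite_V finite_subset by blast
  have fG: "finite ?G" by (rule finite_free_group_ball)
  have "K * card ?G < card A" using Suc.prems by simp
  from Suc.IH[OF this] obtain u :: "nat \<Rightarrow> nat list" where u: "\<forall>j\<in>{1..K}. u j \<in> A \<and>
      (\<forall>i\<in>{1..K}. i \<noteq> j \<longrightarrow> (\<forall>g\<in>carrier FG. length g \<le> D \<longrightarrow> \<phi> g (u i) \<noteq> u j))" ..
  let ?X = "(\<lambda>(i, g). \<phi> g (u i)) ` ({1..K} \<times> ?G)"
  have "card ?X \<le> card ({1..K} \<times> ?G)" by (rule card_image_le) (use fG in simp)
  also have "\<dots> = K * card ?G" by (simp add: card_cartesian_product)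
  finally have "card ?X < card A" using Suc.prems by simp
  moreover have "finite ?X" using fG by simp
  ultimately have "\<not> A \<subseteq> ?X" using card_mono[of ?X A] by linarith
  then obtain x where x: "x \<in> A" "x \<notin> ?X" by blast
  have new1: "\<phi> g (u i) \<noteq> x" if "i \<in> {1..K}" "g \<in> carrier FG" "length g \<le> D" for i g
  proof
    assume "\<phi> g (u i) = x"
    then have "x \<in> ?X" using that by (intro image_eqI[of _ _ "(i, g)"]) auto
    then show False using x(2) by contradiction
  qed
  have new2: "\<phi> g x \<noteq> u i" if "i \<in> {1..K}" "g \<in> carrier FG" "length g \<le> D" for i g
  proof
    assume "\<phi> g x = u i"
    then have "\<phi> (inv_word g) (u i) = x" using act_inv(1)[of x g] x A that by auto
    then show False using new1[OF that(1) inv_word_closed[OF that(2)]] that by simp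
  qed
  show ?case
  proof (intro exI[of _ "u(Suc K := x)"] ballI conjI impI)
    fix j assume j: "j \<in> {1..Suc K}"
    have "u j \<in> A" if "j \<noteq> Suc K" using u j that by force
    then show "(u(Suc K := x)) j \<in> A" using x(1) by simp
    fix i g assume ig: "i \<in> {1..Suc K}" "i \<noteq> j" "g \<in> carrier FG" "length g \<le> D"
    consider "j = Suc K" "i \<in> {1..K}" | "i = Suc K" "j \<in> {1..K}" | "i \<in> {1..K}" "j \<in> {1..K}"
      using ig(1,2) j by (cases "i = Suc K"; cases "j = Suc K") auto
    then show "\<phi> g ((u(Suc K := x)) i) \<noteq> (u(Suc K := x)) j"
    proof cases
      case 1
      then show ?thesis using new1 ig by simp
    next
      case 2
      then show ?thesis using new2 ig by simp
    next
      case 3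
      then have "\<phi> g (u i) \<noteq> u j" using u ig by blast
      with 3 show ?thesis by auto
    qed
  qed
qed simp


section \<open>Passages through a geometric edge\<close>

definition geom_edge :: "nat list \<Rightarrow> letter \<Rightarrow> (nat list \<times> letter list) set" where
  "geom_edge y a = {(y, [a]), (\<phi> [a] y, [inv_letter a])}"

lemma letter_closed: "fst a \<in> {1..m} \<Longrightarrow> [a] \<in> carrier FG"
  by (simp add: carrier_free_group reduced_word_Cons)

lemma act_append:
  assumes "v \<in> V" "u @ w \<in> carrier FG"
  shows "\<phi> (u @ w) v = \<phi> w (\<phi> u v)"
  using assms append_closedD[OF assms(2)] act_mult[of v u w]
  by (simp add: mult_free_group_append carrier_free_group)

lemma nth_follow_word:
  assumes "v \<in> V" "w \<in> carrier FG" "p < length w"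
  shows "follow_word \<phi> v w ! p = (\<phi> (take p w) v, [w ! p])"
  using assms
proof (induction w arbitrary: v p)
  case (Cons a w)
  have c: "[a] @ w \<in> carrier FG" using Cons.prems by simp
  note aw = append_closedD[OF c]
  show ?case
  proof (cases p)
    case 0
    then show ?thesis using Cons.prems act_one by simp
  next
    case (Suc q)
    have "take (Suc q) (a # w) \<in> carrier FG" using Cons.prems(2) by (rule take_closed)
    then have "\<phi> (take (Suc q) (a # w)) v = \<phi> (take q w) (\<phi> [a] v)"
      using act_append[of v "[a]" "take q w"] Cons.prems by simp
    then show ?thesis
      using Cons.IH[of "\<phi> [a] v" q] aw act_closed[OF Cons.prems(1) aw(1)] Cons.prems Suc
      by (simp add: hom_act_def)
  qed
qed simp

lemma passes_follow_word:
  assumes "v \<in> V" "w \<in> carrier FG"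
  shows "passes (follow_word \<phi> v w) E = card {p. p < length w \<and> (\<phi> (take p w) v, [w ! p]) \<in> E}"
  unfolding passes_def length_filter_conv_card
  by (rule arg_cong[where f = card]) (use nth_follow_word[OF assms] in auto)

lemma act_take_Suc:
  assumes "v \<in> V" "w \<in> carrier FG" "p < length w"
  shows "\<phi> (take (Suc p) w) v = \<phi> [w ! p] (\<phi> (take p w) v)"
  using act_append[of v "take p w" "[w ! p]"] take_closed[OF assms(2), of "Suc p"] assms
  by (simp add: take_Suc_conv_app_nth)

lemma nth_letter_closed:
  assumes "w \<in> carrier FG" "p < length w"
  shows "[w ! p] \<in> carrier FG"
  using assms by (intro letter_closed) (auto simp: carrier_free_group dest!: nth_mem)

text \<open>A path running through a geometric edge visits both of its ends.\<close>

lemma passes_zero_if_avoids: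
  assumes v: "v \<in> V" "w \<in> carrier FG" and y: "y \<in> V" "[a] \<in> carrier FG"
    and av: "z \<in> {y, \<phi> [a] y}" "\<And>p. \<phi> (take p w) v \<noteq> z"
  shows "passes (follow_word \<phi> v w) (geom_edge y a) = 0"
proof -
  have "(\<phi> (take p w) v, [w ! p]) \<notin> geom_edge y a" if p: "p < length w" for p
  proof
    assume "(\<phi> (take p w) v, [w ! p]) \<in> geom_edge y a"
    then consider "\<phi> (take p w) v = y" "w ! p = a" | "\<phi> (take p w) v = \<phi> [a] y" "w ! p = inv_letter a"
      by (auto simp: geom_edge_def)
    then have "z = \<phi> (take p w) v \<or> z = \<phi> (take (Suc p) w) v"
    proof cases
      case 1
      then show ?thesis using act_take_Suc[OF v p] av(1) by auto
    next
      case 2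
      have "\<phi> [inv_letter a] (\<phi> [a] y) = y" using act_inv(1)[OF y] by simp
      then have "\<phi> (take (Suc p) w) v = y" using act_take_Suc[OF v p] 2 by simp
      with 2 show ?thesis using av(1) by auto
    qed
    then show False using av(2) by metis
  qed
  then show ?thesis by (auto simp: passes_follow_word[OF v])
qed

lemma follow_word_inv:
  assumes "v \<in> V" "w \<in> carrier FG"
  shows "follow_word \<phi> (\<phi> w v) (inv_word w) = rev (map (\<lambda>(x, s). (\<phi> s x, inv_word s)) (follow_word \<phi> v w))"
proof (rule nth_equalityI)
  fix p assume "p < length (follow_word \<phi> (\<phi> w v) (inv_word w))"
  then have p: "p < length w" by simp
  define q where "q = length w - Suc p"
  have q: "q < length w" "length w - p = Suc q" using p by (auto simp: q_def)
  have nth: "inv_word w ! p = inv_letter (w ! q)"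
    using p by (simp add: inv_word_def rev_nth q_def)
  have tc: "take (Suc q) w \<in> carrier FG" by (rule take_closed[OF assms(2)])
  have dc: "drop (Suc q) w \<in> carrier FG"
    using append_closedD(2)[of "take (Suc q) w" "drop (Suc q) w" m] assms(2) by simp
  have "\<phi> w v = \<phi> (drop (Suc q) w) (\<phi> (take (Suc q) w) v)"
    using act_append[of v "take (Suc q) w" "drop (Suc q) w"] assms by simp
  moreover have "take p (inv_word w) = inv_word (drop (Suc q) w)"
    using p by (simp add: inv_word_def take_rev drop_map q(2))
  ultimately have "\<phi> (take p (inv_word w)) (\<phi> w v) = \<phi> (take (Suc q) w) v"
    using act_inv(1)[OF act_closed[OF assms(1) tc] dc] by simp
  then show "follow_word \<phi> (\<phi> w v) (inv_word w) ! p =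
      rev (map (\<lambda>(x, s). (\<phi> s x, inv_word s)) (follow_word \<phi> v w)) ! p"
    using p q nth nth_follow_word[OF act_closed[OF assms] inv_word_closed[OF assms(2)], of p]
      nth_follow_word[OF assms q(1)] act_take_Suc[OF assms q(1)]
    by (simp add: rev_nth q_def[symmetric])
qed simp

text \<open>The reversed path runs through the inverse edges, and a geometric edge contains its
  inverses. So passing an edge of \<open>X\<close> is a property of the geometric edges of
  \<open>Y\<close>.\<close>

lemma passes_inv:
  assumes v: "v \<in> V" "w \<in> carrier FG" and y: "y \<in> V" "[a] \<in> carrier FG"
  shows "passes (follow_word \<phi> (\<phi> w v) (inv_word w)) (geom_edge y a) =
    passes (follow_word \<phi> v w) (geom_edge y a)"
proof -
  let ?E = "geom_edge y a" and ?b = "\<lambda>(x, s). (\<phi> s x, inv_word s)"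
  have bE: "?b e \<in> ?E \<longleftrightarrow> e \<in> ?E" if "e \<in> set (follow_word \<phi> v w)" for e
  proof -
    obtain p where p: "p < length w" "e = (\<phi> (take p w) v, [w ! p])"
      using \<open>e \<in> _\<close> nth_follow_word[OF v] by (auto simp: in_set_conv_nth)
    have 1: "?b f \<in> ?E" if "f \<in> ?E" for f
      using that act_inv(1)[OF y] by (auto simp: geom_edge_def)
    have x: "\<phi> (take p w) v \<in> V" by (intro act_closed v take_closed)
    have "?b (?b e) = e"
      using p(2) act_inv(1)[OF x nth_letter_closed[OF v(2) p(1)]] by simp
    then show ?thesis using 1[of e] 1[of "?b e"] by auto
  qed
  show ?thesis
    unfolding follow_word_inv[OF v] passes_def
    using filter_cong[OF refl bE, of "follow_word \<phi> v w"]
    by (simp add: filter_map comp_def flip: rev_filter)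
qed

text \<open>Distinct prefixes of \<open>w\<close> reach distinct vertices, so a second passage could
  only be a reverse one made immediately after the first, which is impossible in a reduced
  word.\<close>

lemma passes_own_edge:
  assumes \<gamma>: "girth_gt \<gamma>" "2 * length w \<le> \<gamma>"
    and u: "u \<in> V" "w \<in> carrier FG" and q: "q < length w"
  shows "passes (follow_word \<phi> u w) (geom_edge (\<phi> (take q w) u) (w ! q)) = 1"
proof -
  have "p = q" if p: "p < length w" and
    e: "(\<phi> (take p w) u, [w ! p]) \<in> geom_edge (\<phi> (take q w) u) (w ! q)" for p
  proof -
    have eq: "r = s" if "\<phi> (take r w) u = \<phi> (take s w) u" "r \<le> length w" "s \<le> length w" for r s
    proof -
      have "take r w = take s w"
        by (rule girth_eq[OF \<gamma>(1) u(1) take_closed[OF u(2)] take_closed[OF u(2)] _ that(1)])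
          (use \<gamma>(2) in simp)
      then have "length (take r w) = length (take s w)" by simp
      then show ?thesis using that by simp
    qed
    consider "\<phi> (take p w) u = \<phi> (take q w) u"
      | "\<phi> (take p w) u = \<phi> (take (Suc q) w) u" "w ! p = inv_letter (w ! q)"
      using e act_take_Suc[OF u q] by (auto simp: geom_edge_def)
    then show ?thesis
    proof cases
      case 1
      then show ?thesis using eq p q by simp
    next
      case 2
      then have "p = Suc q" using eq p q by simp
      then have False
        using 2 p u(2) successively_nth[of "\<lambda>a b. b \<noteq> inv_letter a" w q]
        by (simp add: carrier_free_group reduced_word_def)
      then show ?thesis ..
    qed
  qed
  then have "{p. p < length w \<and> (\<phi> (take p w) u, [w ! p]) \<in> geom_edge (\<phi> (take q w) u) (w ! q)} = {q}"
    using q by (auto simp: geom_edge_def)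
  then show ?thesis by (simp add: passes_follow_word[OF u])
qed

text \<open>For each \<open>k\<close> and each position in \<open>w\<close>, the starting vertex is
  determined by which end of the edge is met there; hence the bound
  \<open>2 * K * length w\<close>.\<close>

lemma card_passing:
  assumes w: "w \<in> carrier FG" and y: "\<And>k. k \<in> {1..K::nat} \<Longrightarrow> y k \<in> V" and a: "[a] \<in> carrier FG"
  shows "card {u \<in> V. \<not> (\<forall>k\<in>{1..K}. passes (follow_word \<phi> u w) (geom_edge (y k) a) = 0)} \<le> 2 * K * length w"
proof -
  let ?S = "\<lambda>(k, p). {u \<in> V. \<phi> (take p w) u \<in> {y k, \<phi> [a] (y k)}}"
  have fin: "finite (?S kp)" for kp using finite_V by (cases kp) auto
  have "{u \<in> V. \<not> (\<forall>k\<in>{1..K}. passes (follow_word \<phi> u w) (geom_edge (y k) a) = 0)}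
      \<subseteq> (\<Union>kp\<in>{1..K} \<times> {..<length w}. ?S kp)"
  proof
    fix u assume u: "u \<in> {u \<in> V. \<not> (\<forall>k\<in>{1..K}. passes (follow_word \<phi> u w) (geom_edge (y k) a) = 0)}"
    then obtain k where k: "k \<in> {1..K}" "passes (follow_word \<phi> u w) (geom_edge (y k) a) \<noteq> 0" by blast
    have uV: "u \<in> V" using u by simp
    have "{p. p < length w \<and> (\<phi> (take p w) u, [w ! p]) \<in> geom_edge (y k) a} \<noteq> {}"
      using k(2) unfolding passes_follow_word[OF uV w] by (metis card.empty)
    then obtain p where "p < length w" "(\<phi> (take p w) u, [w ! p]) \<in> geom_edge (y k) a" by blast
    then show "u \<in> (\<Union>kp\<in>{1..K} \<times> {..<length w}. ?S kp)"
      using k(1) uV by (intro UN_I[of "(k, p)"]) (auto simp: geom_edge_def)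
  qed
  then have "card {u \<in> V. \<not> (\<forall>k\<in>{1..K}. passes (follow_word \<phi> u w) (geom_edge (y k) a) = 0)}
      \<le> card (\<Union>kp\<in>{1..K} \<times> {..<length w}. ?S kp)"
    by (rule card_mono[rotated]) (use fin in blast)
  also have "\<dots> \<le> (\<Sum>kp\<in>{1..K} \<times> {..<length w}. card (?S kp))"
    by (rule card_UN_le) simp
  also have "\<dots> \<le> (\<Sum>kp\<in>{1..K} \<times> {..<length w}. 2)"
  proof (rule sum_mono)
    fix kp assume "kp \<in> {1..K} \<times> {..<length w}"
    then obtain k p where kp: "kp = (k, p)" by (cases kp) auto
    have tc: "take p w \<in> carrier FG" by (rule take_closed[OF w])
    have "card (?S kp) = card (\<phi> (take p w) ` ?S kp)"
      by (rule card_image[symmetric]) (use act_inj[OF _ _ tc] in \<open>auto intro!: inj_onI simp: kp\<close>)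
    also have "\<dots> \<le> card {y k, \<phi> [a] (y k)}" by (rule card_mono) (auto simp: kp)
    also have "\<dots> \<le> 2" by (simp add: card_insert_if)
    finally show "card (?S kp) \<le> 2" .
  qed
  also have "\<dots> = 2 * K * length w" by (simp add: card_cartesian_product)
  finally show ?thesis .
qed

definition deep :: "nat list set \<Rightarrow> letter list \<Rightarrow> nat \<Rightarrow> nat list set" where
  "deep A w L = {u \<in> A. \<forall>k\<in>{1..L}. \<phi> (w [^]\<^bsub>FG\<^esub> k) u \<in> A \<and> \<phi> (inv_word w [^]\<^bsub>FG\<^esub> k) u \<in> A}"

text \<open>Each power \<open>k \<le> L\<close> loses at most \<open>k\<close> times the boundary in
  either direction. A large set with small boundary therefore has many deep points, and rays of
  length \<open>L\<close> from these stay in the set.\<close>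

lemma card_deep:
  assumes A: "A \<subseteq> V" and w: "w \<in> carrier FG"
  shows "card A \<le> card (deep A w L) + 2 * L * L * esc A w"
proof -
  have fA: "finite A" using A finite_V finite_subset by blast
  have wi: "inv_word w \<in> carrier FG" by (rule inv_word_closed[OF w])
  let ?E = "\<lambda>g. {u \<in> A. \<phi> g u \<notin> A}"
  have "card A \<le> card (deep A w L \<union> (\<Union>k\<in>{1..L}. ?E (w [^]\<^bsub>FG\<^esub> k) \<union> ?E (inv_word w [^]\<^bsub>FG\<^esub> k)))"
    by (rule card_mono) (use fA in \<open>auto simp: deep_def\<close>)
  also have "\<dots> \<le> card (deep A w L) + card (\<Union>k\<in>{1..L}. ?E (w [^]\<^bsub>FG\<^esub> k) \<union> ?E (inv_word w [^]\<^bsub>FG\<^esub> k))"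
    by (rule card_Un_le)
  also have "card (\<Union>k\<in>{1..L}. ?E (w [^]\<^bsub>FG\<^esub> k) \<union> ?E (inv_word w [^]\<^bsub>FG\<^esub> k))
      \<le> (\<Sum>k\<in>{1..L}. card (?E (w [^]\<^bsub>FG\<^esub> k) \<union> ?E (inv_word w [^]\<^bsub>FG\<^esub> k)))"
    by (rule card_UN_le) simp
  also have "\<dots> \<le> (\<Sum>k\<in>{1..L}. 2 * L * esc A w)"
  proof (rule sum_mono)
    fix k assume k: "k \<in> {1..L}"
    have "card (?E (w [^]\<^bsub>FG\<^esub> k) \<union> ?E (inv_word w [^]\<^bsub>FG\<^esub> k)) \<le> k * esc A w + k * esc A (inv_word w)"
      using card_Un_le[of "?E (w [^]\<^bsub>FG\<^esub> k)" "?E (inv_word w [^]\<^bsub>FG\<^esub> k)"]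
        esc_pow[OF A w, of k] esc_pow[OF A wi, of k] unfolding esc_def by linarith
    also have "\<dots> = 2 * k * esc A w" using esc_inv[OF A w] by simp
    also have "\<dots> \<le> 2 * L * esc A w" using k by (intro mult_right_mono) auto
    finally show "card (?E (w [^]\<^bsub>FG\<^esub> k) \<union> ?E (inv_word w [^]\<^bsub>FG\<^esub> k)) \<le> 2 * L * esc A w" .
  qed
  also have "\<dots> = 2 * L * L * esc A w" by simp
  finally show ?thesis by simp
qed

end

section \<open>Rays of powers avoid the distinguished edge\<close>

lemma cyc_reduced_inv_word: "cyc_reduced x \<Longrightarrow> cyc_reduced (inv_word x)"
  by (auto simp: cyc_reduced_def hd_inv_word last_inv_word)

lemma pow_free_group_inj:
  assumes g: "g \<in> carrier (free_group m)" "g \<noteq> []"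
    and eq: "g [^]\<^bsub>free_group m\<^esub> (i::nat) = g [^]\<^bsub>free_group m\<^esub> (j::nat)"
  shows "i = j"
proof -
  have main: "i = j" if "i \<le> j" "g [^]\<^bsub>free_group m\<^esub> i = g [^]\<^bsub>free_group m\<^esub> j" for i j :: nat
  proof -
    have "g [^]\<^bsub>free_group m\<^esub> i \<otimes>\<^bsub>free_group m\<^esub> g [^]\<^bsub>free_group m\<^esub> (j - i) = g [^]\<^bsub>free_group m\<^esub> j"
      using that(1) g(1) by (simp add: free_group.nat_pow_mult)
    then have "g [^]\<^bsub>free_group m\<^esub> i \<otimes>\<^bsub>free_group m\<^esub> g [^]\<^bsub>free_group m\<^esub> (j - i) = g [^]\<^bsub>free_group m\<^esub> i"
      by (simp only: that(2))
    then have "g [^]\<^bsub>free_group m\<^esub> (j - i) = \<one>\<^bsub>free_group m\<^esub>"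
      using free_group.r_cancel_one[of "g [^]\<^bsub>free_group m\<^esub> i" m "g [^]\<^bsub>free_group m\<^esub> (j - i)"] g
        free_group.l_cancel_one[of "g [^]\<^bsub>free_group m\<^esub> i" m "g [^]\<^bsub>free_group m\<^esub> (j - i)"] by simp
    then show ?thesis
      using pow_free_group_eq_one[OF g(1) _ g(2), of "j - i"] that by (simp add: one_free_group)
  qed
  show ?thesis using main[of i j] main[of j i] eq by (cases "i \<le> j") simp_all
qed

context free_action begin

text \<open>A passage would visit the near end \<open>\<phi> c u\<close>, and by girth the word
  leading there would equal \<open>c\<close>; but after \<open>k > 0\<close> turns that word is
  longer than \<open>c\<close>.\<close>

lemma ray_forward:
  assumes \<gamma>: "girth_gt \<gamma>" "(k + 2) * length w \<le> \<gamma>"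
    and u: "u \<in> V" and w: "w \<in> carrier FG" "w = c @ x @ inv_word c" "cyc_reduced x" and k: "k > 0"
  shows "passes (follow_word \<phi> (\<phi> (w [^]\<^bsub>FG\<^esub> (k::nat)) u) w) (geom_edge (\<phi> c u) (hd x)) = 0"
proof -
  have x0: "x \<noteq> []" using w by (simp add: cyc_reduced_def)
  have c: "c \<in> carrier FG" using w by (auto dest: append_closedD)
  have a: "[hd x] \<in> carrier FG"
    using w(1,2) x0 by (intro letter_closed) (cases x, auto simp: carrier_free_group)
  have "\<phi> (take p w) (\<phi> (w [^]\<^bsub>FG\<^esub> k) u) \<noteq> \<phi> c u" for p
  proof
    assume eq: "\<phi> (take p w) (\<phi> (w [^]\<^bsub>FG\<^esub> k) u) = \<phi> c u"
    let ?g = "w [^]\<^bsub>FG\<^esub> k \<otimes>\<^bsub>FG\<^esub> take p w"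
    have tp: "take p w \<in> carrier FG" by (rule take_closed[OF w(1)])
    have "\<phi> ?g u = \<phi> c u" using eq act_mult[OF u _ tp, of "w [^]\<^bsub>FG\<^esub> k"] w(1) by simp
    moreover have "length ?g + length c \<le> \<gamma>"
      using length_mult_free_group[of m "w [^]\<^bsub>FG\<^esub> k" "take p w"] length_pow_free_group[of m w k]
        w(2) \<gamma>(2) by (simp add: algebra_simps)
    ultimately have "?g = c"
      using girth_eq[OF \<gamma>(1) u _ c] tp w(1) by simp
    then show False
      using length_pow_mult_take[OF w k, of p] x0 by simp
  qed
  then show ?thesis
    by (intro passes_zero_if_avoids[where z = "\<phi> c u"]) (use u w c a act_closed in auto)
qed

text \<open>The argument of the forward case fails at the near end \<open>\<phi> c u\<close>, which
  is visited when \<open>k = 0\<close>; it is the far end \<open>\<phi> (c @ [a]) u\<close> that is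
  avoided. One additional turn of \<open>inv_word w\<close> moves \<open>c @ [a]\<close> to
  \<open>c @ inv_word x'\<close>, which is one letter too short for
  \<open>length_pow_mult_take\<close>.\<close>

lemma ray_backward:
  assumes \<gamma>: "girth_gt \<gamma>" "(k + 4) * length w \<le> \<gamma>"
    and u: "u \<in> V" and w: "w \<in> carrier FG" "w = c @ x @ inv_word c" "cyc_reduced x"
  shows "passes (follow_word \<phi> (\<phi> (inv_word w [^]\<^bsub>FG\<^esub> (k::nat)) u) (inv_word w)) (geom_edge (\<phi> c u) (hd x)) = 0"
proof -
  have x0: "x \<noteq> []" using w by (simp add: cyc_reduced_def)
  then obtain a x' where x: "x = a # x'" by (cases x) auto
  let ?i = "inv_word w"
  have i: "?i \<in> carrier FG" by (rule inv_word_closed[OF w(1)])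
  have iw: "?i = c @ inv_word x @ inv_word c" using w(2) by simp
  have c: "c \<in> carrier FG" using w by (auto dest: append_closedD)
  have a: "[a] \<in> carrier FG"
    using w(1,2) x by (intro letter_closed) (auto simp: carrier_free_group)
  have "(c @ [a]) @ x' @ inv_word c \<in> carrier FG" using w x by simp
  then have ca: "c @ [a] \<in> carrier FG" by (rule append_closedD)
  have "(c @ inv_word x') @ [inv_letter a] @ inv_word c \<in> carrier FG" using i iw x by simp
  then have cx: "c @ inv_word x' \<in> carrier FG" by (rule append_closedD)
  have ix: "inv_word x' \<in> carrier FG" using append_closedD[OF cx] by simp
  have "?i = (c @ inv_word x') \<otimes>\<^bsub>FG\<^esub> inv_word (c @ [a])"
    using i iw x by (subst mult_free_group_append) (auto simp: carrier_free_group)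
  then have ica: "?i \<otimes>\<^bsub>FG\<^esub> (c @ [a]) = c @ inv_word x'"
    using cx ca by (simp add: free_group.m_assoc inv_free_group[symmetric] del: inv_word_simps)
  have "\<phi> (take p ?i) (\<phi> (?i [^]\<^bsub>FG\<^esub> k) u) \<noteq> \<phi> (c @ [a]) u" for p
  proof
    assume eq: "\<phi> (take p ?i) (\<phi> (?i [^]\<^bsub>FG\<^esub> k) u) = \<phi> (c @ [a]) u"
    let ?g = "?i [^]\<^bsub>FG\<^esub> k \<otimes>\<^bsub>FG\<^esub> take p ?i"
    have tp: "take p ?i \<in> carrier FG" by (rule take_closed[OF i])
    have "\<phi> ?g u = \<phi> (c @ [a]) u" using eq act_mult[OF u _ tp, of "?i [^]\<^bsub>FG\<^esub> k"] i by simp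
    moreover have "length ?g + length (c @ [a]) \<le> \<gamma>"
      using length_mult_free_group[of m "?i [^]\<^bsub>FG\<^esub> k" "take p ?i"] length_pow_free_group[of m ?i k]
        w(2) x \<gamma>(2) by (simp add: algebra_simps)
    ultimately have "?g = c @ [a]"
      using girth_eq[OF \<gamma>(1) u _ ca] tp i by simp
    then have "?i \<otimes>\<^bsub>FG\<^esub> ?g = c @ inv_word x'" using ica by simp
    moreover have "?i \<otimes>\<^bsub>FG\<^esub> ?g = ?i [^]\<^bsub>FG\<^esub> Suc k \<otimes>\<^bsub>FG\<^esub> take p ?i"
      unfolding free_group.nat_pow_Suc2[OF i] using i tp by (simp add: free_group.m_assoc)
    moreover have "length c + length (inv_word x) \<le> length (?i [^]\<^bsub>FG\<^esub> Suc k \<otimes>\<^bsub>FG\<^esub> take p ?i)"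
      by (rule length_pow_mult_take[OF i iw cyc_reduced_inv_word[OF w(3)]]) simp
    ultimately have "length c + length (inv_word x) \<le> length (c @ inv_word x')" by metis
    then show False using x by simp
  qed
  moreover have "\<phi> (c @ [a]) u = \<phi> [a] (\<phi> c u)" by (rule act_append[OF u ca])
  ultimately show ?thesis
    using x by (intro passes_zero_if_avoids[where z = "\<phi> (c @ [a]) u"]) (use u i c a act_closed in auto)
qed

text \<open>Meeting the edge based at \<open>u'\<close> would give a word of length at most
  \<open>D\<close> from \<open>u\<close> to \<open>u'\<close>: out along \<open>g\<close> and part
  of \<open>s\<close>, back along \<open>c\<close>.\<close>

lemma passes_far:
  assumes u: "u \<in> V" "u' \<in> V" and g: "g \<in> carrier FG" and s: "s \<in> carrier FG"
    and c: "c \<in> carrier FG" and a: "[a] \<in> carrier FG"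
    and far: "\<And>h. h \<in> carrier FG \<Longrightarrow> length h \<le> D \<Longrightarrow> \<phi> h u \<noteq> u'"
    and D: "length g + length s + length c \<le> D"
  shows "passes (follow_word \<phi> (\<phi> g u) s) (geom_edge (\<phi> c u') a) = 0"
proof -
  have "\<phi> (take p s) (\<phi> g u) \<noteq> \<phi> c u'" for p
  proof
    assume eq: "\<phi> (take p s) (\<phi> g u) = \<phi> c u'"
    have tp: "take p s \<in> carrier FG" by (rule take_closed[OF s])
    have ci: "inv_word c \<in> carrier FG" by (rule inv_word_closed[OF c])
    let ?h = "g \<otimes>\<^bsub>FG\<^esub> take p s \<otimes>\<^bsub>FG\<^esub> inv_word c"
    have "\<phi> ?h u = u'" using act_inv(1)[OF u(2) c] eq u g tp ci by (simp add: act_mult)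
    moreover have "length ?h \<le> D"
      using length_mult_free_group[of m "g \<otimes>\<^bsub>FG\<^esub> take p s" "inv_word c"]
        length_mult_free_group[of m g "take p s"] D by simp
    ultimately show False using far[of ?h] g tp ci by simp
  qed
  then show ?thesis
    by (intro passes_zero_if_avoids[where z = "\<phi> c u'"]) (use u g s c a act_closed in auto)
qed

section \<open>Paths in the Schreier graph of the subgroup\<close>

abbreviation YG :: "letter list \<Rightarrow> letter list \<Rightarrow> (nat list, nat list \<times> letter list) dgraph" where
  "YG w1 w2 \<equiv> schreier (subgroup_generated FG {w1, w2}) {w1, w2} V (hom_act \<phi>)"

abbreviation gens :: "letter list \<Rightarrow> letter list \<Rightarrow> letter list set" where
  "gens w1 w2 \<equiv> {w1, w2, inv_word w1, inv_word w2}"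

context
  fixes w1 w2
  assumes w12: "w1 \<in> carrier FG" "w2 \<in> carrier FG"
begin

lemma gens_subgroup: "s \<in> gens w1 w2 \<Longrightarrow> s \<in> carrier (subgroup_generated FG {w1, w2})"
  and m_inv_gens: "s \<in> gens w1 w2 \<Longrightarrow> inv\<^bsub>subgroup_generated FG {w1, w2}\<^esub> s = inv_word s"
proof -
  interpret D: group "subgroup_generated FG {w1, w2}" by simp
  have sub: "{w1, w2} \<subseteq> carrier (subgroup_generated FG {w1, w2})"
    by (rule free_group.subgroup_generated_subset_carrier_subset) (use w12 in auto)
  have "inv_word w \<in> carrier (subgroup_generated FG {w1, w2})" if "w \<in> {w1, w2}" for w
    using D.inv_closed[of w] sub that w12 by (auto simp: inv_free_group)
  then show *: "s \<in> gens w1 w2 \<Longrightarrow> s \<in> carrier (subgroup_generated FG {w1, w2})" for s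
    using sub by auto
  show "inv\<^bsub>subgroup_generated FG {w1, w2}\<^esub> s = inv_word s" if s: "s \<in> gens w1 w2"
  proof -
    have "s \<in> carrier FG" using s w12 inv_word_closed by auto
    then show ?thesis
      by (simp add: free_group.inv_subgroup_generated[OF *[OF s]] inv_free_group)
  qed
qed

lemma gens_closed: "s \<in> gens w1 w2 \<Longrightarrow> s \<in> carrier FG" "s \<in> gens w1 w2 \<Longrightarrow> inv_word s \<in> gens w1 w2"
  using w12 inv_word_closed by auto

lemma YG_simps [simp]:
  "Verts (YG w1 w2) = V" "Edges (YG w1 w2) = V \<times> gens w1 w2"
  "src (YG w1 w2) e = fst e" "tgt (YG w1 w2) (x, s) = \<phi> s x"
  using m_inv_gens by (auto simp: schreier_def hom_act_def)

lemma bar_YG: "s \<in> gens w1 w2 \<Longrightarrow> bar (YG w1 w2) (x, s) = (\<phi> s x, inv_word s)"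
  using m_inv_gens by (simp add: schreier_def hom_act_def)

lemma is_path_snoc:
  assumes "is_path (YG w1 w2) u p x" "s \<in> gens w1 w2"
  shows "x \<in> V" "is_path (YG w1 w2) u (p @ [(x, s)]) (\<phi> s x)"
proof -
  show x: "x \<in> V" using assms by (induction p arbitrary: u) auto
  have "is_path (YG w1 w2) x [(x, s)] (\<phi> s x)" using x assms(2) act_closed gens_closed by auto
  then show "is_path (YG w1 w2) u (p @ [(x, s)]) (\<phi> s x)"
    by (rule is_path_append[OF assms(1)])
qed

lemma is_path_cancel:
  assumes "is_path (YG w1 w2) u (p @ [e, bar (YG w1 w2) e] @ q) v"
  shows "is_path (YG w1 w2) u (p @ q) v"
  using assms
proof (induction p arbitrary: u)
  case Nil
  obtain x s where e: "e = (x, s)" by (cases e)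
  then have "x \<in> V" "s \<in> gens w1 w2" using Nil by auto
  then show ?case using Nil e act_inv(1)[of x s] gens_closed(1)[of s] by (auto simp: bar_YG)
qed auto

lemma is_path_induced:
  assumes Z: "Z \<subseteq> V" "\<And>x s. x \<in> Z \<Longrightarrow> s \<in> gens w1 w2 \<Longrightarrow> \<phi> s x \<in> Z"
    and p: "is_path (YG w1 w2) u p v" "u \<in> Z"
  shows "is_path (induced (YG w1 w2) Z) u p v"
  using p
proof (induction p arbitrary: u)
  case (Cons e p)
  then show ?case using Z by (cases e) (auto simp: induced_def)
qed (auto simp: induced_def)

text \<open>Cancelling a backtracking removes an even number of passages, hence none from an edge that is
  passed at most once.\<close>

lemma reduced_representative:
  assumes y: "\<And>k. k \<in> I \<Longrightarrow> y k \<in> V" "[a] \<in> carrier FG"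
    and p: "is_path (YG w1 w2) v p v" "\<And>k. k \<in> I \<Longrightarrow> passes (iota_path \<phi> p) (geom_edge (y k) a) = n k"
    and n: "\<And>k. k \<in> I \<Longrightarrow> n k \<le> (1::nat)"
  shows "\<exists>q. is_path (YG w1 w2) v q v \<and> reduced_path (YG w1 w2) q \<and>
     (\<forall>k\<in>I. passes (iota_path \<phi> q) (geom_edge (y k) a) = n k)"
  using p
proof (induction "length p" arbitrary: p rule: less_induct)
  case less
  show ?case
  proof (cases "reduced_path (YG w1 w2) p")
    case True
    then show ?thesis using less.prems by blast
  next
    case False
    then obtain i where i: "Suc i < length p" "p ! Suc i = bar (YG w1 w2) (p ! i)"
      unfolding reduced_path_def successively_conv_nth by blast
    define r t where rt: "r = take i p" "t = drop (Suc (Suc i)) p"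
    have dec: "p = r @ [p ! i, bar (YG w1 w2) (p ! i)] @ t"
      using i id_take_nth_drop[of i p] Cons_nth_drop_Suc[of "Suc i" p] by (simp add: rt)
    obtain x s where xs: "p ! i = (x, s)" by (cases "p ! i")
    have e: "x \<in> V \<and> s \<in> gens w1 w2"
    proof -
      have "set p \<subseteq> Edges (YG w1 w2)" if "is_path (YG w1 w2) u p v" for u p
        using that by (induction p arbitrary: u) auto
      from this[OF less.prems(1)]
      show ?thesis using xs i nth_mem[of i p] by auto
    qed
    have path: "is_path (YG w1 w2) v (r @ t) v"
      using is_path_cancel[of v r "p ! i" t v] less.prems(1) dec by simp
    have "passes (iota_path \<phi> (r @ t)) (geom_edge (y k) a) = n k" if k: "k \<in> I" for k
    proof -
      have "n k = passes (iota_path \<phi> (r @ [(x, s), (\<phi> s x, inv_word s)] @ t)) (geom_edge (y k) a)"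
        using less.prems(2)[OF k] dec xs bar_YG[of s x] e by metis
      also have "\<dots> = passes (iota_path \<phi> (r @ t)) (geom_edge (y k) a)
          + 2 * passes (follow_word \<phi> x s) (geom_edge (y k) a)"
        using passes_inv[OF _ gens_closed(1) y(1)[OF k] y(2), of x s] e by (simp add: iota_path_Cons)
      finally show ?thesis using n[OF k] by simp
    qed
    then show ?thesis
      using less.hyps[OF _ path] i(1) by (simp add: rt)
  qed
qed

end

lemma geom_edge_X:
  assumes "y \<in> V" "[a] \<in> carrier FG"
  shows "geom_edge y a \<in> geom_edges (schreier FG (free_gens m) V (hom_act \<phi>))"
proof -
  obtain i b where a: "a = (i, b)" by (cases a)
  have i: "i \<in> {1..m}" using assms(2) a by (simp add: carrier_free_group)
  have inv: "inv\<^bsub>FG\<^esub> [a] = [inv_letter a]" using assms(2) by (simp add: inv_free_group)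
  have "[a] \<in> free_gens m \<union> m_inv FG ` free_gens m"
  proof (cases b)
    case True
    then show ?thesis using a i by (auto simp: free_gens_def)
  next
    case False
    have "[(i, True)] \<in> carrier FG" using letter_closed[of "(i, True)"] i by simp
    then have "inv\<^bsub>FG\<^esub> [(i, True)] = [a]" using False a by (simp add: inv_free_group inv_letter_def)
    moreover have "[(i, True)] \<in> free_gens m" using i by (auto simp: free_gens_def)
    ultimately show ?thesis by (metis UnCI imageI)
  qed
  then show ?thesis
    unfolding geom_edges_def geom_edge_def
    by (intro CollectI exI[of _ "(y, [a])"]) (simp add: schreier_def hom_act_def inv assms(1))
qed


text \<open>It depends on \<open>m\<close>, \<open>K\<close> and the words but not on the action, so
  it can be fixed before the random level. \<open>M\<close> bounds the number of deleted
  \<open>Y\<close>-edges; \<open>L0\<close> is the first size beyond the threshold of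
  \<open>no_medium_sets\<close>; \<open>D\<close> covers \<open>L0 + 4\<close> turns of
  \<open>w1\<close>, that is, a ray and the words compared along it; beyond size \<open>L1\<close>
  enough deep points remain to choose \<open>K\<close> of them at distance more than
  \<open>D\<close>. The two summands of the result serve \<open>no_medium_sets\<close> and the
  comparisons of words along rays.\<close>

definition girth_bound :: "nat \<Rightarrow> letter list \<Rightarrow> letter list \<Rightarrow> nat" where
  "girth_bound K w1 w2 =
     (let l = length w1 + length w2; M = 2 * K * l; L0 = 8 * M * M + 1; D = (L0 + 4) * l;
          L1 = L0 + 2 * L0 * L0 * M + K * card {g \<in> carrier FG. length g \<le> D}
      in 4 * L1 * l + 4 * D)"

text \<open>The extremal argument: in a smallest set \<open>A\<close> with small boundary and at least \<open>L\<^sub>0\<close> elements, the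
  two ends of every edge \<open>(u\<^sub>j, w\<^sub>1)\<close> start rays of length \<open>L\<^sub>0\<close> inside \<open>A\<close> which avoid all the edges
  \<open>e\<^sub>k\<close>. If deleting the \<open>Y\<close>-edges passing some \<open>e\<^sub>k\<close> separated two of these ends, it would cut \<open>A\<close> into
  two such sets, one of them with small boundary.\<close>

theorem loops_if_large_girth:
  assumes w: "w1 \<in> carrier FG" "w2 \<in> carrier FG"
    and nc: "\<not> cyclic_group (subgroup_generated FG {w1, w2})"
    and \<gamma>: "girth_gt (girth_bound K w1 w2)" and K: "K > 0"
    and Z: "Z \<in> component_verts (YG w1 w2)"
  shows "\<exists>v \<alpha> e. v \<in> Z \<and> (\<forall>j\<in>{1..K}. \<alpha> j \<in> pi1 (induced (YG w1 w2) Z) v) \<and>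
    (\<forall>k\<in>{1..K}. e k \<in> geom_edges (schreier FG (free_gens m) V (hom_act \<phi>))) \<and>
    (\<forall>j\<in>{1..K}. \<forall>k\<in>{1..K}. passes (iota_path \<phi> (\<alpha> j)) (e k) = (if j = k then 1 else 0))"
proof -
  define l where "l = length w1 + length w2"
  define M where "M = 2 * K * l"
  define L0 where "L0 = 8 * M * M + 1"
  define D where "D = (L0 + 4) * l"
  define L1 where "L1 = L0 + 2 * L0 * L0 * M + K * card {g \<in> carrier FG. length g \<le> D}"
  define g where "g = girth_bound K w1 w2"
  have g: "g = 4 * L1 * l + 4 * D"
    by (simp only: g_def girth_bound_def l_def M_def L0_def D_def L1_def Let_def)
  have \<gamma>: "girth_gt g" using \<gamma> by (simp add: g_def)
  have w1l: "k * length w1 \<le> D" if "k \<le> L0 + 4" for k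
    unfolding D_def using that by (intro mult_mono) (auto simp: l_def)
  have w10: "w1 \<noteq> []" using noncyclic_pow_neq[OF w nc] by simp
  obtain c x where dec: "w1 = c @ x @ inv_word c" and x: "cyc_reduced x"
    using conj_cyc_reduced[of w1] w w10 by (auto simp: carrier_free_group)
  define a where "a = hd x"
  have x0: "x \<noteq> []" using x by (simp add: cyc_reduced_def)
  have c: "c \<in> carrier FG" using w dec by (auto dest: append_closedD)
  have a: "[a] \<in> carrier FG"
    unfolding a_def using w(1) dec x0 by (intro letter_closed) (cases x, auto simp: carrier_free_group)
  have aw: "w1 ! length c = a" "take (length c) w1 = c" "length c < length w1"
    using dec x0 by (simp_all add: a_def nth_append hd_conv_nth)
  define iw where "iw = inv_word w1"
  have iw: "iw \<in> carrier FG" "iw \<noteq> []" "length iw = length w1"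
    using w w10 inv_word_closed by (simp_all add: iw_def)
  obtain v0 where v0: "v0 \<in> V" and Zdef: "Z = {u. \<exists>p. is_path (YG w1 w2) v0 p u}"
    using Z by (auto simp: component_verts_def YG_simps[OF w])
  have Zclosed: "x \<in> V \<and> \<phi> s x \<in> Z" if "x \<in> Z" "s \<in> gens w1 w2" for x s
    using that is_path_snoc[OF w, of v0 _ x s] unfolding Zdef by blast
  have v0Z: "v0 \<in> Z" using v0 unfolding Zdef by (intro CollectI exI[of _ "[]"]) (simp add: YG_simps[OF w])
  have ZV: "Z \<subseteq> V" using Zclosed[of _ w1] by auto
  have pow_Z: "\<phi> (w1 [^]\<^bsub>FG\<^esub> (k::nat)) v0 \<in> Z" for k
  proof (induction k)
    case 0
    then show ?case using v0Z v0 act_one by (simp add: one_free_group)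
  next
    case (Suc k)
    then show ?case using Zclosed[of _ w1] act_mult[OF v0, of "w1 [^]\<^bsub>FG\<^esub> k" w1] w by simp
  qed
  have card_ray: "card ((\<lambda>k. \<phi> (h [^]\<^bsub>FG\<^esub> k) u) ` {1..L0}) = L0"
    if h: "h \<in> {w1, iw}" and u: "u \<in> V" for h u
  proof -
    have hc: "h \<in> carrier FG" "h \<noteq> []" "length h = length w1" using h w w10 iw by auto
    have "inj_on (\<lambda>k. \<phi> (h [^]\<^bsub>FG\<^esub> k) u) {1..L0}"
    proof (rule inj_onI)
      fix i j assume ij: "i \<in> {1..L0}" "j \<in> {1..L0}" "\<phi> (h [^]\<^bsub>FG\<^esub> i) u = \<phi> (h [^]\<^bsub>FG\<^esub> j) u"
      have "length (h [^]\<^bsub>FG\<^esub> i) + length (h [^]\<^bsub>FG\<^esub> j) \<le> g"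
        using length_pow_free_group[of m h i] length_pow_free_group[of m h j] w1l[of i] w1l[of j] ij hc g
        by simp
      then have "h [^]\<^bsub>FG\<^esub> i = h [^]\<^bsub>FG\<^esub> j"
        using girth_eq[OF \<gamma> u _ _ _ ij(3)] hc by simp
      then show "i = j" using pow_free_group_inj hc by blast
    qed
    then show ?thesis by (simp add: card_image)
  qed
  have finZ: "finite Z" using ZV finite_V finite_subset by blast
  have "L0 \<le> card Z"
    using card_mono[OF finZ, of "(\<lambda>k. \<phi> (w1 [^]\<^bsub>FG\<^esub> k) v0) ` {1..L0}"] card_ray[of w1 v0] v0 pow_Z by auto
  moreover have "bd w1 w2 Z = 0"
  proof -
    have "{z \<in> Z. \<phi> s z \<notin> Z} = {}" if "s \<in> gens w1 w2" for s using Zclosed[OF _ that] by blast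
    then have "esc Z s = 0" if "s \<in> gens w1 w2" for s using that unfolding esc_def by (metis card.empty)
    then show ?thesis by (simp add: bd_def)
  qed
  moreover define Q where "Q = (\<lambda>A. A \<subseteq> Z \<and> L0 \<le> card A \<and> bd w1 w2 A \<le> M)"
  \<comment> \<open>The family is nonempty: the component has no boundary and contains the
    \<open>L0\<close> points of a ray.\<close>
  ultimately have "Q Z" by simp
  then obtain A where QA: "Q A" and minQ: "\<forall>B. Q B \<longrightarrow> card A \<le> card B"
    using ex_has_least_nat[of Q Z card] by blast
  have A: "A \<subseteq> Z" "L0 \<le> card A" "bd w1 w2 A \<le> M" using QA by (simp_all add: Q_def)
  have minA: "card A \<le> card B" if "B \<subseteq> Z" "L0 \<le> card B" "bd w1 w2 B \<le> M" for B
    using minQ that by (simp add: Q_def)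
  have AV: "A \<subseteq> V" using A ZV by blast
  have fA: "finite A" using AV finite_V finite_subset by blast
  \<comment> \<open>From \<open>L0\<close> to \<open>L1\<close> elements the boundary exceeds
    \<open>M\<close>, so the minimal set skips this range.\<close>
  have "L1 < card A"
  proof (rule ccontr)
    assume "\<not> L1 < card A"
    moreover have "8 * M * M < card A" using A(2) by (simp add: L0_def)
    ultimately have "M < bd w1 w2 A"
      using no_medium_sets[OF \<gamma> AV, of M L1 w1 w2] w nc g by (simp add: l_def)
    then show False using A(3) by simp
  qed
  define A' where "A' = deep A w1 L0"
  have A'A: "A' \<subseteq> A" by (auto simp: A'_def deep_def)
  have "card A \<le> card A' + 2 * L0 * L0 * M"
  proof -
    have "2 * L0 * L0 * esc A w1 \<le> 2 * L0 * L0 * M"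
      using A(3) by (intro mult_left_mono) (auto simp: bd_def)
    then show ?thesis using card_deep[OF AV w(1), of L0] unfolding A'_def by linarith
  qed
  then have "K * card {g \<in> carrier FG. length g \<le> D} < card A'"
    using \<open>L1 < card A\<close> by (simp add: L1_def)
  then obtain u :: "nat \<Rightarrow> nat list" where u: "\<And>j. j \<in> {1..K} \<Longrightarrow> u j \<in> A'"
    and far: "\<And>i j h. i \<in> {1..K} \<Longrightarrow> j \<in> {1..K} \<Longrightarrow> i \<noteq> j \<Longrightarrow> h \<in> carrier FG \<Longrightarrow> length h \<le> D \<Longrightarrow>
      \<phi> h (u i) \<noteq> u j"
    using far_points[of A' K D] A'A AV by blast
  have uV: "u j \<in> V" if "j \<in> {1..K}" for j using u[OF that] A'A AV by blast
  define E where "E = (\<lambda>k. geom_edge (\<phi> c (u k)) a)"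
  \<comment> \<open>The \<open>Y\<close>-edges that survive the deletion.\<close>
  define ok where "ok = (\<lambda>z s. \<forall>k\<in>{1..K}. passes (follow_word \<phi> z s) (E k) = 0)"
  have yV: "\<phi> c (u k) \<in> V" if "k \<in> {1..K}" for k using uV[OF that] c act_closed by blast
  have ok_inv: "ok (\<phi> s z) (inv_word s) \<longleftrightarrow> ok z s" if "z \<in> V" "s \<in> gens w1 w2" for z s
    unfolding ok_def E_def using passes_inv[OF that(1) gens_closed(1)[OF w that(2)] yV a] by simp
  have other: "passes (follow_word \<phi> (\<phi> h (u j)) s) (E k) = 0"
    if "j \<in> {1..K}" "k \<in> {1..K}" "j \<noteq> k" "h \<in> carrier FG" "length h \<le> L0 * length w1" "s \<in> {w1, iw}" for j k h s
    unfolding E_def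
  proof (rule passes_far[OF uV[OF that(1)] uV[OF that(2)] that(4) _ c a, of _ D])
    show "s \<in> carrier FG" using that w iw by auto
    show "length h + length s + length c \<le> D"
      using that(5,6) aw iw w1l[of "L0 + 2"] by (auto simp: algebra_simps)
    show "\<phi> h' (u j) \<noteq> u k" if "h' \<in> carrier FG" "length h' \<le> D" for h'
      using far[OF \<open>j \<in> _\<close> \<open>k \<in> _\<close> \<open>j \<noteq> k\<close> that] .
  qed
  have ok_fwd: "ok (\<phi> (w1 [^]\<^bsub>FG\<^esub> k) (u j)) w1" if "j \<in> {1..K}" "k \<in> {1..L0}" for j and k :: nat
    unfolding ok_def
  proof
    fix i assume i: "i \<in> {1..K}"
    have len: "length (w1 [^]\<^bsub>FG\<^esub> k) \<le> L0 * length w1"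
      using order.trans[OF length_pow_free_group[of m w1 k] mult_le_mono1[of k L0 "length w1"]] that(2) by simp
    have gb: "(k + 2) * length w1 \<le> g" using w1l[of "k + 2"] that(2) g by simp
    show "passes (follow_word \<phi> (\<phi> (w1 [^]\<^bsub>FG\<^esub> k) (u j)) w1) (E i) = 0"
    proof (cases "i = j")
      case True
      then show ?thesis
        using ray_forward[OF \<gamma> gb uV[OF that(1)] w(1) dec x] that(2) by (simp add: E_def a_def)
    next
      case False
      then show ?thesis using other[OF that(1) i _ _ len, of w1] w by simp
    qed
  qed
  \<comment> \<open>The backward ray includes \<open>k = 0\<close>; the forward ray must start at
    \<open>k = 1\<close>, because the edge \<open>(u j, w1)\<close> itself passes
    \<open>E j\<close>.\<close>
  have ok_bwd: "ok (\<phi> (iw [^]\<^bsub>FG\<^esub> k) (u j)) iw" if "j \<in> {1..K}" "k \<le> L0" for j and k :: nat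
    unfolding ok_def
  proof
    fix i assume i: "i \<in> {1..K}"
    have len: "length (iw [^]\<^bsub>FG\<^esub> k) \<le> L0 * length w1"
      using order.trans[OF length_pow_free_group[of m iw k] mult_le_mono1[of k L0 "length iw"]] that(2) iw by simp
    have gb: "(k + 4) * length w1 \<le> g" using w1l[of "k + 4"] that(2) g by simp
    show "passes (follow_word \<phi> (\<phi> (iw [^]\<^bsub>FG\<^esub> k) (u j)) iw) (E i) = 0"
    proof (cases "i = j")
      case True
      then show ?thesis
        using ray_backward[OF \<gamma> gb uV[OF that(1)] w(1) dec x] by (simp add: E_def a_def iw_def)
    next
      case False
      then show ?thesis using other[OF that(1) i _ _ len, of iw] iw by simp
    qed
  qed
  have edge: "passes (follow_word \<phi> (u j) w1) (E k) = (if j = k then 1 else 0)"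
    if jk: "j \<in> {1..K}" "k \<in> {1..K}" for j k
  proof (cases "j = k")
    case True
    have "2 * length w1 \<le> g" using w1l[of 2] g by simp
    then show ?thesis
      using passes_own_edge[OF \<gamma> _ uV[OF jk(1)] w(1) aw(3)] aw True by (simp add: E_def)
  next
    case False
    then show ?thesis
      using other[OF jk False, of "[]" w1] act_one[OF uV[OF jk(1)]] by (simp add: carrier_free_group)
  qed
  define okp where "okp = (\<lambda>p. \<forall>(z, s)\<in>set p. ok z s)"
  \<comment> \<open>The side of the cut containing \<open>u 1\<close>. A path back is recorded along
    with the path out, since both are needed to close the loops.\<close>
  define C where "C = {z. \<exists>p q. is_path (YG w1 w2) (u 1) p z \<and> is_path (YG w1 w2) z q (u 1) \<and> okp p \<and> okp q}"
  have C_step: "\<phi> s z \<in> C" if z: "z \<in> C" and s: "s \<in> gens w1 w2" and zs: "ok z s" for z s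
  proof -
    obtain p q where pq: "is_path (YG w1 w2) (u 1) p z" "is_path (YG w1 w2) z q (u 1)" "okp p" "okp q"
      using z unfolding C_def by blast
    have zV: "z \<in> V" by (rule is_path_snoc(1)[OF w pq(1) s])
    have isg: "inv_word s \<in> gens w1 w2" by (rule gens_closed(2)[OF w s])
    have "is_path (YG w1 w2) (u 1) (p @ [(z, s)]) (\<phi> s z)" by (rule is_path_snoc(2)[OF w pq(1) s])
    moreover have "is_path (YG w1 w2) (\<phi> s z) ((\<phi> s z, inv_word s) # q) (u 1)"
      using pq(2) isg act_closed[OF zV gens_closed(1)[OF w s]] act_inv(1)[OF zV gens_closed(1)[OF w s]]
      by (simp add: YG_simps[OF w])
    moreover have "okp (p @ [(z, s)])" "okp ((\<phi> s z, inv_word s) # q)"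
      using pq zs ok_inv[OF zV s] by (auto simp: okp_def)
    ultimately show ?thesis unfolding C_def by blast
  qed
  have C_iff: "\<phi> s z \<in> C \<longleftrightarrow> z \<in> C" if z: "z \<in> V" and s: "s \<in> gens w1 w2" and zs: "ok z s" for z s
    using C_step[OF _ s zs] C_step[OF _ gens_closed(2)[OF w s], of "\<phi> s z"] ok_inv[OF z s] zs
      act_inv(1)[OF z gens_closed(1)[OF w s]] by auto
  have fwd_C: "\<phi> (w1 [^]\<^bsub>FG\<^esub> k) (u j) \<in> C \<longleftrightarrow> \<phi> w1 (u j) \<in> C" if j: "j \<in> {1..K}" and k: "k \<in> {1..L0}" for j and k :: nat
    using k
  proof (induction k)
    case (Suc k)
    show ?case
    proof (cases "k = 0")
      case True
      then show ?thesis using w by simp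
    next
      case False
      have "\<phi> (w1 [^]\<^bsub>FG\<^esub> Suc k) (u j) = \<phi> w1 (\<phi> (w1 [^]\<^bsub>FG\<^esub> k) (u j))"
        using act_mult[OF uV[OF j], of "w1 [^]\<^bsub>FG\<^esub> k" w1] w by simp
      then show ?thesis
        using Suc False C_iff[OF act_closed[OF uV[OF j]] _ ok_fwd[OF j], of k] w by simp
    qed
  qed simp
  have bwd_C: "\<phi> (iw [^]\<^bsub>FG\<^esub> k) (u j) \<in> C \<longleftrightarrow> u j \<in> C" if j: "j \<in> {1..K}" and k: "k \<le> L0" for j and k :: nat
    using k
  proof (induction k)
    case 0
    then show ?case using act_one[OF uV[OF j]] by (simp add: one_free_group)
  next
    case (Suc k)
    have "\<phi> (iw [^]\<^bsub>FG\<^esub> Suc k) (u j) = \<phi> iw (\<phi> (iw [^]\<^bsub>FG\<^esub> k) (u j))"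
      using act_mult[OF uV[OF j], of "iw [^]\<^bsub>FG\<^esub> k" iw] iw by simp
    then show ?case
      using Suc C_iff[OF act_closed[OF uV[OF j]] _ ok_bwd[OF j], of k] iw by (simp add: iw_def)
  qed
  \<comment> \<open>An end on either side of the cut brings a ray of \<open>L0\<close> points of
    \<open>A\<close> to that side, so both pieces of a cut would be large.\<close>
  have ray: "\<exists>R\<subseteq>A. card R = L0 \<and> (\<forall>r\<in>R. r \<in> C \<longleftrightarrow> z \<in> C)"
    if j: "j \<in> {1..K}" and z: "z \<in> {u j, \<phi> w1 (u j)}" for j z
  proof -
    have dp: "\<phi> (w1 [^]\<^bsub>FG\<^esub> k) (u j) \<in> A" "\<phi> (iw [^]\<^bsub>FG\<^esub> k) (u j) \<in> A" if "k \<in> {1..L0}" for k :: nat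
      using u[OF j] that by (auto simp: A'_def deep_def iw_def)
    from z show ?thesis
    proof (elim insertE emptyE)
      assume "z = u j"
      then show ?thesis
        using dp(2) bwd_C[OF j] card_ray[of iw "u j"] uV[OF j]
        by (intro exI[of _ "(\<lambda>k. \<phi> (iw [^]\<^bsub>FG\<^esub> k) (u j)) ` {1..L0}"]) auto
    next
      assume "z = \<phi> w1 (u j)"
      then show ?thesis
        using dp(1) fwd_C[OF j] card_ray[of w1 "u j"] uV[OF j]
        by (intro exI[of _ "(\<lambda>k. \<phi> (w1 [^]\<^bsub>FG\<^esub> k) (u j)) ` {1..L0}"]) auto
    qed
  qed
  have one: "1 \<in> {1..K}" using K by simp
  have u1C: "u 1 \<in> C"
    using uV[OF one] unfolding C_def
    by (intro CollectI exI[of _ "[]"]) (simp add: okp_def YG_simps[OF w])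
  have ends_C: "z \<in> C" if j: "j \<in> {1..K}" and z: "z \<in> {u j, \<phi> w1 (u j)}" for j z
  proof (rule ccontr)
    assume zC: "z \<notin> C"
    obtain R where R: "R \<subseteq> A" "card R = L0" "\<forall>r\<in>R. r \<in> C \<longleftrightarrow> z \<in> C" using ray[OF j z] by blast
    obtain R1 where R1: "R1 \<subseteq> A" "card R1 = L0" "\<forall>r\<in>R1. r \<in> C \<longleftrightarrow> u 1 \<in> C"
      using ray[OF one, of "u 1"] by blast
    have "R \<subseteq> A - C" "R1 \<subseteq> A \<inter> C" using R R1 zC u1C by auto
    then have big: "L0 \<le> card (A - C)" "L0 \<le> card (A \<inter> C)"
      using R R1 fA card_mono[of "A - C" R] card_mono[of "A \<inter> C" R1] by auto
    have L0: "L0 > 0" by (simp add: L0_def)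
    have split: "card A = card (A \<inter> C) + card (A - C)" using card_Int_Diff fA by blast
    have small: "card (A - C) < card A" "card (A \<inter> C) < card A" using split big L0 by auto
    define B where "B = (\<lambda>s. {z \<in> V. \<not> (\<forall>k\<in>{1..K}. passes (follow_word \<phi> z s) (geom_edge (\<phi> c (u k)) a) = 0)})"
    have cB: "card (B s) \<le> 2 * K * length s" if "s \<in> {w1, w2}" for s
      unfolding B_def by (rule card_passing) (use that w yV a in auto)
    have "bd w1 w2 (A \<inter> C) + bd w1 w2 (A - C) \<le> bd w1 w2 A + card (B w1) + card (B w2)"
    proof (rule bd_cut[OF AV])
      show "z \<in> C \<longleftrightarrow> \<phi> w1 z \<in> C" if "z \<in> V" "z \<notin> B w1" for z
        using C_iff[OF that(1), of w1] that by (simp add: B_def ok_def E_def)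
      show "z \<in> C \<longleftrightarrow> \<phi> w2 z \<in> C" if "z \<in> V" "z \<notin> B w2" for z
        using C_iff[OF that(1), of w2] that by (simp add: B_def ok_def E_def)
    qed (auto simp: B_def)
    \<comment> \<open>\<open>M\<close> bounds the boundary of \<open>A\<close>; the deleted edges
      are counted separately for each generator and sum to \<open>M\<close> as well.\<close>
    also have "\<dots> \<le> M + 2 * K * length w1 + 2 * K * length w2"
      using A(3) cB[of w1] cB[of w2] by simp
    also have "\<dots> = 2 * M" by (simp add: M_def l_def algebra_simps)
    finally have "bd w1 w2 (A \<inter> C) \<le> M \<or> bd w1 w2 (A - C) \<le> M" by linarith
    moreover have "A \<inter> C \<subseteq> Z" "A - C \<subseteq> Z" using A(1) by auto
    ultimately show False using minA big small by (meson not_less)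
  qed
  have passes_okp: "passes (iota_path \<phi> p) (E k) = 0" if "okp p" "k \<in> {1..K}" for p k
    using that by (induction p) (auto simp: okp_def iota_path_Cons ok_def)
  have "\<exists>q. is_path (YG w1 w2) (u 1) q (u 1) \<and> reduced_path (YG w1 w2) q \<and>
     (\<forall>k\<in>{1..K}. passes (iota_path \<phi> q) (E k) = (if j = k then 1 else 0))" if j: "j \<in> {1..K}" for j
  proof -
    \<comment> \<open>The loop runs through surviving edges to \<open>u j\<close>, crosses
      \<open>(u j, w1)\<close>, and returns through surviving edges, so that only the middle edge
      passes any \<open>E k\<close>.\<close>
    obtain p where p: "is_path (YG w1 w2) (u 1) p (u j)" "okp p"
      using ends_C[OF j, of "u j"] unfolding C_def by blast
    obtain q where q: "is_path (YG w1 w2) (\<phi> w1 (u j)) q (u 1)" "okp q"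
      using ends_C[OF j, of "\<phi> w1 (u j)"] unfolding C_def by blast
    have "is_path (YG w1 w2) (u 1) (p @ [(u j, w1)]) (\<phi> w1 (u j))"
      by (rule is_path_snoc(2)[OF w p(1)]) simp
    then have path: "is_path (YG w1 w2) (u 1) ((p @ [(u j, w1)]) @ q) (u 1)"
      by (rule is_path_append[OF _ q(1)])
    have "passes (iota_path \<phi> ((p @ [(u j, w1)]) @ q)) (E k) = (if j = k then 1 else 0)"
      if "k \<in> {1..K}" for k
      using passes_okp[OF p(2) that] passes_okp[OF q(2) that] edge[OF j that] by (simp add: iota_path_Cons)
    then show ?thesis
      unfolding E_def by (intro reduced_representative[OF w yV a path]) auto
  qed
  then have "\<forall>j\<in>{1..K}. \<exists>q. is_path (YG w1 w2) (u 1) q (u 1) \<and> reduced_path (YG w1 w2) q \<and>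
     (\<forall>k\<in>{1..K}. passes (iota_path \<phi> q) (E k) = (if j = k then 1 else 0))" by blast
  from bchoice[OF this] obtain \<alpha> where \<alpha>: "\<forall>j\<in>{1..K}. is_path (YG w1 w2) (u 1) (\<alpha> j) (u 1) \<and>
     reduced_path (YG w1 w2) (\<alpha> j) \<and>
     (\<forall>k\<in>{1..K}. passes (iota_path \<phi> (\<alpha> j)) (E k) = (if j = k then 1 else 0))" ..
  have uZ: "u 1 \<in> Z" using u[OF one] A'A A(1) by blast
  have "\<alpha> j \<in> pi1 (induced (YG w1 w2) Z) (u 1)" if "j \<in> {1..K}" for j
  proof -
    have "is_path (induced (YG w1 w2) Z) (u 1) (\<alpha> j) (u 1)"
      by (rule is_path_induced[OF w ZV _ _ uZ]) (use Zclosed \<alpha> that in blast)+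
    moreover have "reduced_path (YG w1 w2) (\<alpha> j)" using \<alpha> that by blast
    ultimately show ?thesis by (simp add: pi1_def reduced_path_def induced_def)
  qed
  moreover have "E k \<in> geom_edges (schreier FG (free_gens m) V (hom_act \<phi>))" if "k \<in> {1..K}" for k
    unfolding E_def by (rule geom_edge_X[OF yV[OF that] a])
  ultimately show ?thesis using uZ \<alpha> by (intro exI[of _ "u 1"] exI[of _ \<alpha>] exI[of _ E] conjI) blast+
qed

end

section \<open>Fixed points in the random tree action\<close>

lemma level_0: "level d 0 = {[]}"
  by (auto simp: level_def tree_def)

lemma level_Suc: "level d (Suc n) = (\<lambda>(v, j). v @ [j]) ` (level d n \<times> {1..d})"
proof (rule equalityI; rule subsetI)
  fix u assume u: "u \<in> level d (Suc n)"
  then have "u \<noteq> []" by (auto simp: level_def)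
  then obtain v j where "u = v @ [j]" by (metis rev_exhaust)
  then show "u \<in> (\<lambda>(v, j). v @ [j]) ` (level d n \<times> {1..d})"
    using u by (intro image_eqI[of _ _ "(v, j)"]) (auto simp: level_def tree_def)
qed (auto simp: level_def tree_def)

lemma finite_level: "finite (level d n)"
  by (induction n) (simp_all add: level_0 level_Suc)

lemma card_level: "card (level d n) = d ^ n"
proof (induction n)
  case (Suc n)
  have "inj_on (\<lambda>(v, j). v @ [j]) (level d n \<times> {1..d})" by (auto simp: inj_on_def)
  then show ?case using Suc by (simp add: level_Suc card_image card_cartesian_product)
qed (simp add: level_0)

lemma tree_iff_level: "v \<in> tree d \<longleftrightarrow> v \<in> level d (length v)"
  by (simp add: level_def)

lemma length_level: "v \<in> level d n \<Longrightarrow> length v = n"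
  by (simp add: level_def)

lemma level_tree: "v \<in> level d n \<Longrightarrow> v \<in> tree d"
  by (simp add: level_def)

lemma tree_snoc: "v @ [j] \<in> tree d \<longleftrightarrow> v \<in> tree d \<and> j \<in> {1..d}"
  by (auto simp: tree_def)

section \<open>Local permutations of tree automorphisms\<close>

locale transitive_wreath =
  fixes d m :: nat and H :: "(nat \<Rightarrow> nat) set"
  assumes d: "2 \<le> d" and subgroup_H: "subgroup H (sym_group d)" and transitive_H: "transitive_perms d H"
begin

lemma H_permutes: "h \<in> H \<Longrightarrow> h permutes {1..d}"
  using subgroup.subset[OF subgroup_H] by (auto simp: sym_group_def)

lemma H_id: "id \<in> H"
  using subgroup.one_closed[OF subgroup_H] by (simp add: sym_group_def)

lemma H_comp: "g \<in> H \<Longrightarrow> h \<in> H \<Longrightarrow> g \<circ> h \<in> H"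
  using subgroup.m_closed[OF subgroup_H, of g h] by (simp add: sym_group_def)

lemma H_inv: "h \<in> H \<Longrightarrow> inv' h \<in> H"
  using subgroup.m_inv_closed[OF subgroup_H, of h] subgroup.subset[OF subgroup_H]
    sym_group_inv_equality[of h d] by auto

lemma H_bij: "h \<in> H \<Longrightarrow> bij h"
  using H_permutes permutes_bij by blast

lemma finite_H: "finite H"
proof (rule finite_subset)
  show "H \<subseteq> {h. h permutes {1..d}}" using H_permutes by blast
  show "finite {h. h permutes {1..d}}" by (rule finite_permutations) simp
qed

lemma H_in: "h \<in> H \<Longrightarrow> j \<in> {1..d} \<Longrightarrow> h j \<in> {1..d}"
  using H_permutes permutes_in_image by metis

lemma card_H_pos: "card H > 0"
  using finite_H H_id by (auto simp: card_gt_0_iff)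

text \<open>A uniform element of a transitive group sends \<open>k\<close> to each point with
  probability \<open>1 / d\<close>: composing with an element that takes \<open>a\<close> to
  \<open>b\<close> embeds the fibre over \<open>a\<close> into that over \<open>b\<close>.\<close>

lemma card_H_fibre:
  assumes k: "k \<in> {1..d}" "k' \<in> {1..d}"
  shows "d * card {g \<in> H. g k = k'} = card H"
proof -
  have le: "card {g \<in> H. g k = a} \<le> card {g \<in> H. g k = b}" if ab: "a \<in> {1..d}" "b \<in> {1..d}" for a b
  proof -
    obtain t where t: "t \<in> H" "t a = b" using transitive_H ab unfolding transitive_perms_def by blast
    have "card {g \<in> H. g k = a} = card ((\<circ>) t ` {g \<in> H. g k = a})"
      by (rule card_image[symmetric])
        (rule inj_on_subset[OF fun.inj_map[OF bij_is_inj[OF H_bij[OF t(1)]]]], simp)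
    also have "\<dots> \<le> card {g \<in> H. g k = b}"
      by (rule card_mono) (use finite_H H_comp t in auto)
    finally show ?thesis .
  qed
  have "card H = (\<Sum>b\<in>{1..d}. card {g \<in> H. g k = b})"
  proof -
    have "H = (\<Union>b\<in>{1..d}. {g \<in> H. g k = b})" using H_in k by auto
    then have "card H = card (\<Union>b\<in>{1..d}. {g \<in> H. g k = b})" by simp
    also have "\<dots> = (\<Sum>b\<in>{1..d}. card {g \<in> H. g k = b})"
      by (rule card_UN_disjoint) (use finite_H in auto)
    finally show ?thesis .
  qed
  also have "\<dots> = (\<Sum>b\<in>{1..d}. card {g \<in> H. g k = k'})"
    by (rule sum.cong) (use le k in \<open>auto intro!: antisym\<close>)
  finally show ?thesis by simp
qed

abbreviation W where "W \<equiv> carrier (wreath d H)"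

lemma W_Nil: "g \<in> W \<Longrightarrow> g [] = []"
  by (simp add: wreath_def)

lemma W_snoc: "g \<in> W \<Longrightarrow> v \<in> tree d \<Longrightarrow> \<exists>h\<in>H. \<forall>i\<in>{1..d}. g (v @ [i]) = g v @ [h i]"
  by (simp add: wreath_def)

text \<open>The choice is unique for \<open>g\<close> in \<open>W\<close> and \<open>v\<close> in
  the tree, since elements of \<open>H\<close> fix everything outside \<open>{1..d}\<close>.\<close>

definition lab :: "(nat list \<Rightarrow> nat list) \<Rightarrow> nat list \<Rightarrow> nat \<Rightarrow> nat" where
  "lab g v = (SOME h. h \<in> H \<and> (\<forall>i\<in>{1..d}. g (v @ [i]) = g v @ [h i]))"

lemma lab:
  assumes "g \<in> W" "v \<in> tree d"
  shows "lab g v \<in> H" "i \<in> {1..d} \<Longrightarrow> g (v @ [i]) = g v @ [lab g v i]"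
proof -
  have "\<exists>h. h \<in> H \<and> (\<forall>i\<in>{1..d}. g (v @ [i]) = g v @ [h i])" using W_snoc[OF assms] by blast
  from someI_ex[OF this, folded lab_def]
  show "lab g v \<in> H" "i \<in> {1..d} \<Longrightarrow> g (v @ [i]) = g v @ [lab g v i]" by blast+
qed

lemma W_level:
  assumes g: "g \<in> W" and v: "v \<in> level d n"
  shows "g v \<in> level d n"
  using v
proof (induction n arbitrary: v)
  case 0
  then show ?case using W_Nil[OF g] by (simp add: level_0)
next
  case (Suc n)
  then obtain u j where u: "v = u @ [j]" "u \<in> level d n" "j \<in> {1..d}" by (auto simp: level_Suc)
  then have "g v = g u @ [lab g u j]" "lab g u j \<in> {1..d}"
    using lab[OF g level_tree[OF u(2)]] H_in by auto
  then show ?case using Suc.IH[OF u(2)] by (auto simp: level_Suc)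
qed

lemma W_inj:
  assumes g: "g \<in> W"
  shows "inj_on g (level d n)"
proof (induction n)
  case (Suc n)
  show ?case
  proof (rule inj_onI)
    fix v v' assume v: "v \<in> level d (Suc n)" "v' \<in> level d (Suc n)" "g v = g v'"
    obtain u j where u: "v = u @ [j]" "u \<in> level d n" "j \<in> {1..d}" using v(1) by (auto simp: level_Suc)
    obtain u' j' where u': "v' = u' @ [j']" "u' \<in> level d n" "j' \<in> {1..d}" using v(2) by (auto simp: level_Suc)
    have e: "g u = g u' \<and> lab g u j = lab g u' j'"
      using v(3) lab(2)[OF g level_tree[OF u(2)] u(3)] lab(2)[OF g level_tree[OF u'(2)] u'(3)] u u' by simp
    then have "u = u'" using Suc u(2) u'(2) by (auto dest: inj_onD)
    then have "j = j'"
      using e H_bij[OF lab(1)[OF g level_tree[OF u(2)]]] by (auto simp: bij_def inj_eq)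
    then show "v = v'" using u u' \<open>u = u'\<close> by simp
  qed
qed (simp add: level_0)

lemma W_bij: "g \<in> W \<Longrightarrow> bij_betw g (level d n) (level d n)"
  unfolding bij_betw_def
  by (intro conjI W_inj endo_inj_surj finite_level) (auto intro: W_level)

section \<open>Tuples of automorphisms and monodromy\<close>

abbreviation tuples where "tuples \<equiv> PiE {1..m} (\<lambda>_. W)"

text \<open>Inverses are taken on the level of \<open>v\<close> alone, so the action on a level
  depends on nothing but the tuple on that level.\<close>

definition lact :: "(nat \<Rightarrow> nat list \<Rightarrow> nat list) \<Rightarrow> letter \<Rightarrow> nat list \<Rightarrow> nat list" where
  "lact x a v = (if snd a then x (fst a) v else inv_into (level d (length v)) (x (fst a)) v)"

fun wact :: "(nat \<Rightarrow> nat list \<Rightarrow> nat list) \<Rightarrow> letter list \<Rightarrow> nat list \<Rightarrow> nat list" where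
  "wact x [] v = v"
| "wact x (a # w) v = wact x w (lact x a v)"

abbreviation letters_ok :: "letter list \<Rightarrow> bool" where
  "letters_ok w \<equiv> fst ` set w \<subseteq> {1..m}"

lemma lact_level:
  assumes "x \<in> tuples" "fst a \<in> {1..m}" "v \<in> level d n"
  shows "lact x a v \<in> level d n"
proof -
  have g: "x (fst a) \<in> W" using assms by auto
  show ?thesis using W_level[OF g] W_bij[OF g, of n] assms(3) length_level[OF assms(3)]
    by (auto simp: lact_def bij_betw_def intro: inv_into_into)
qed

lemma lact_inv:
  assumes "x \<in> tuples" "fst a \<in> {1..m}" "v \<in> level d n"
  shows "lact x (inv_letter a) (lact x a v) = v"
proof -
  have g: "x (fst a) \<in> W" using assms by auto
  note lv = length_level[OF assms(3)]
  have "length (x (fst a) v) = n" using W_level[OF g assms(3)] length_level by blast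
  moreover have "inv_into (level d n) (x (fst a)) v \<in> level d n"
    using W_bij[OF g, of n] assms(3) by (auto simp: bij_betw_def intro: inv_into_into)
  then have "length (inv_into (level d n) (x (fst a)) v) = n" by (rule length_level)
  moreover have "v \<in> x (fst a) ` level d n" using W_bij[OF g, of n] assms(3) by (simp add: bij_betw_def)
  ultimately show ?thesis
    using W_inj[OF g, of n] assms(3) lv by (auto simp: lact_def inv_letter_def f_inv_into_f)
qed

lemma wact_level:
  assumes "x \<in> tuples" "letters_ok w" "v \<in> level d n"
  shows "wact x w v \<in> level d n"
  using assms(2,3) by (induction w arbitrary: v) (simp_all add: lact_level[OF assms(1)])

text \<open>The finite form of measurability: a random variable decided by level \<open>n\<close> is
  a function constant on the classes of this relation.\<close>

definition agree :: "nat \<Rightarrow> (nat \<Rightarrow> nat list \<Rightarrow> nat list) \<Rightarrow> (nat \<Rightarrow> nat list \<Rightarrow> nat list) \<Rightarrow> bool" where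
  "agree n x x' \<longleftrightarrow> (\<forall>i\<in>{1..m}. \<forall>v\<in>level d n. x i v = x' i v)"

lemma lact_cong:
  assumes "agree n x x'" "fst a \<in> {1..m}" "v \<in> level d n"
  shows "lact x a v = lact x' a v"
proof -
  have "x (fst a) u = x' (fst a) u" if "u \<in> level d n" for u using assms that by (auto simp: agree_def)
  then have "inv_into (level d n) (x (fst a)) v = inv_into (level d n) (x' (fst a)) v"
    unfolding inv_into_def by metis
  then show ?thesis
    using \<open>\<And>u. u \<in> level d n \<Longrightarrow> x (fst a) u = x' (fst a) u\<close>[OF assms(3)] length_level[OF assms(3)]
    by (simp add: lact_def)
qed

lemma wact_cong:
  assumes "agree n x x'" "x \<in> tuples" "letters_ok w" "v \<in> level d n"
  shows "wact x w v = wact x' w v"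
  using assms(3,4)
proof (induction w arbitrary: v)
  case (Cons a w)
  then show ?case using lact_cong[OF assms(1), of a v] lact_level[OF assms(2), of a v n] by simp
qed simp

text \<open>Labels: a permutation for every edge \<open>(i, v)\<close> of \<open>X\<^sub>n\<close>, the edge with label \<open>x\<^sub>i\<close> at \<open>v\<close>.\<close>

definition edge_at :: "(nat \<Rightarrow> nat list \<Rightarrow> nat list) \<Rightarrow> letter \<Rightarrow> nat list \<Rightarrow> nat \<times> nat list" where
  "edge_at x a v = (fst a, (if snd a then v else lact x a v))"

definition lperm :: "bool \<Rightarrow> (nat \<Rightarrow> nat) \<Rightarrow> nat \<Rightarrow> nat" where
  "lperm s h = (if s then h else inv' h)"

text \<open>The permutation that \<open>w\<close> would induce from the children of \<open>v\<close>
  to those of its image if \<open>L\<close> were the labels of that level. Labels are an argument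
  separate from \<open>x\<close>, so that they can be resampled with the action on the level held
  fixed.\<close>

fun monodromy ::
  "(nat \<times> nat list \<Rightarrow> nat \<Rightarrow> nat) \<Rightarrow> (nat \<Rightarrow> nat list \<Rightarrow> nat list) \<Rightarrow> letter list \<Rightarrow> nat list \<Rightarrow> nat \<Rightarrow> nat" where
  "monodromy L x [] v = id"
| "monodromy L x (a # w) v = monodromy L x w (lact x a v) \<circ> lperm (snd a) (L (edge_at x a v))"

definition idx :: "nat \<Rightarrow> (nat \<times> nat list) set" where
  "idx n = {1..m} \<times> level d n"

definition labels :: "nat \<Rightarrow> (nat \<times> nat list \<Rightarrow> nat \<Rightarrow> nat) set" where
  "labels n = PiE (idx n) (\<lambda>_. H)"

lemma finite_idx: "finite (idx n)"
  by (simp add: idx_def finite_level)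

lemma finite_labels: "finite (labels n)"
  by (simp add: labels_def finite_PiE finite_idx finite_H)

lemma card_labels: "card (labels n) = card H ^ card (idx n)"
  by (simp add: labels_def card_PiE finite_idx)

lemma edge_at_idx:
  assumes "x \<in> tuples" "fst a \<in> {1..m}" "v \<in> level d n"
  shows "edge_at x a v \<in> idx n"
  using assms lact_level[OF assms] by (simp add: edge_at_def idx_def)

lemma lperm_H: "h \<in> H \<Longrightarrow> lperm s h \<in> H"
  by (simp add: lperm_def H_inv)

lemma lperm_lperm: "h \<in> H \<Longrightarrow> lperm s (lperm s h) = h"
  by (simp add: lperm_def inv_inv_eq H_bij)

lemma monodromy_H:
  assumes "x \<in> tuples" "L \<in> labels n" "letters_ok w" "v \<in> level d n"
  shows "monodromy L x w v \<in> H"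
  using assms(3,4)
proof (induction w arbitrary: v)
  case (Cons a w)
  have "L (edge_at x a v) \<in> H"
    using assms(2) edge_at_idx[OF assms(1), of a v n] Cons.prems by (auto simp: labels_def)
  then show ?case
    using Cons lact_level[OF assms(1), of a v n] unfolding monodromy.simps
    by (intro H_comp lperm_H) simp_all
qed (simp add: H_id)

text \<open>\<open>edge_at\<close> names a geometric edge by its positively oriented form, so it
  identifies a directed edge with its inverse and with nothing else.\<close>

lemma edge_at_eq:
  assumes x: "x \<in> tuples" and ab: "fst a \<in> {1..m}" and v: "v \<in> level d n" "u \<in> level d n"
    and eq: "edge_at x b u = edge_at x a v"
  shows "(b = a \<and> u = v) \<or> (b = inv_letter a \<and> u = lact x a v)"
proof -
  have fb: "fst b = fst a" using eq by (simp add: edge_at_def)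
  show ?thesis
  proof (cases "snd a = snd b")
    case True
    then have "a = b" using fb by (simp add: prod_eq_iff)
    moreover have "u = v"
    proof (cases "snd a")
      case False
      then have "lact x a u = lact x a v" using eq \<open>a = b\<close> by (simp add: edge_at_def)
      then show ?thesis using lact_inv[OF x ab v(1)] lact_inv[OF x ab v(2)] by metis
    qed (use eq \<open>a = b\<close> in \<open>simp add: edge_at_def\<close>)
    ultimately show ?thesis by simp
  next
    case False
    then have b: "b = inv_letter a" using fb by (auto simp: inv_letter_def prod_eq_iff)
    moreover have "u = lact x a v"
    proof (cases "snd a")
      case True
      then have "lact x b u = v" using eq False by (simp add: edge_at_def)
      then show ?thesis using lact_inv[OF x, of b u n] b fb ab v by auto
    next
      case ns: False
      then show ?thesis using eq False by (simp add: edge_at_def)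
    qed
    ultimately show ?thesis by simp
  qed
qed

lemma monodromy_cong:
  assumes "\<And>p. p < length w \<Longrightarrow> L (edge_at x (w ! p) (wact x (take p w) v)) = L' (edge_at x (w ! p) (wact x (take p w) v))"
  shows "monodromy L x w v = monodromy L' x w v"
  using assms
proof (induction w arbitrary: v)
  case (Cons a w)
  have "monodromy L x w (lact x a v) = monodromy L' x w (lact x a v)"
    using Cons.prems[of "Suc _"] by (intro Cons.IH) simp
  then show ?case using Cons.prems[of 0] by simp
qed simp

lemma monodromy_id:
  assumes "\<And>p. p < length w \<Longrightarrow> L (edge_at x (w ! p) (wact x (take p w) v)) = id"
  shows "monodromy L x w v = id"
proof -
  have "monodromy L x w v = monodromy (\<lambda>_. id) x w v" by (rule monodromy_cong) (use assms in simp)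
  also have "\<dots> = id" by (induction w arbitrary: v) (auto simp: lperm_def)
  finally show ?thesis .
qed

lemma wact_lift:
  assumes x: "x \<in> tuples" "x' \<in> tuples" "agree n x x'" and L: "L \<in> labels n"
    and xL: "\<And>i v j. i \<in> {1..m} \<Longrightarrow> v \<in> level d n \<Longrightarrow> j \<in> {1..d} \<Longrightarrow> x' i (v @ [j]) = x i v @ [L (i, v) j]"
    and w: "letters_ok w" and v: "v \<in> level d n" "j \<in> {1..d}"
  shows "wact x' w (v @ [j]) = wact x w v @ [monodromy L x w v j]"
  using w v
proof (induction w arbitrary: v j)
  case (Cons a w)
  have a: "fst a \<in> {1..m}" using Cons.prems by simp
  have g: "x' (fst a) \<in> W" using x(2) a by auto
  let ?h = "L (edge_at x a v)"
  have h: "?h \<in> H" using L edge_at_idx[OF x(1) a Cons.prems(2)] by (auto simp: labels_def)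
  have j': "lperm (snd a) ?h j \<in> {1..d}" using H_in[OF lperm_H[OF h] Cons.prems(3)] .
  have "lact x' a (v @ [j]) = lact x a v @ [lperm (snd a) ?h j]"
  proof (cases "snd a")
    case True
    then show ?thesis using xL[OF a Cons.prems(2,3)] by (simp add: lact_def lperm_def edge_at_def)
  next
    case False
    let ?u = "lact x a v"
    have u: "?u \<in> level d n" by (rule lact_level[OF x(1) a Cons.prems(2)])
    have "x (fst a) ?u = v"
      using lact_inv[OF x(1) a Cons.prems(2)] False by (simp add: lact_def inv_letter_def)
    moreover have "?h (inv' ?h j) = j" using H_bij[OF h] by (simp add: bij_is_surj surj_f_inv_f)
    ultimately have "x' (fst a) (?u @ [inv' ?h j]) = v @ [j]"
      using xL[OF a u, of "inv' ?h j"] j' False by (simp add: lperm_def edge_at_def)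
    moreover have "?u @ [inv' ?h j] \<in> level d (Suc n)"
      using u j' False by (auto simp: level_Suc lperm_def)
    ultimately have "inv_into (level d (Suc n)) (x' (fst a)) (v @ [j]) = ?u @ [inv' ?h j]"
      using inv_into_f_f[OF W_inj[OF g]] by metis
    then show ?thesis using False length_level[OF Cons.prems(2)] by (simp add: lact_def lperm_def)
  qed
  then show ?case
    using Cons.IH[OF _ lact_level[OF x(1) a Cons.prems(2)] j'] Cons.prems(1) by simp
qed simp

section \<open>Fixed vertices and their lifts to the next level\<close>

definition Fix :: "(nat \<Rightarrow> nat list \<Rightarrow> nat list) \<Rightarrow> letter list \<Rightarrow> nat \<Rightarrow> nat list set" where
  "Fix x w n = {v \<in> level d n. wact x w v = v}"

definition short_words :: "nat \<Rightarrow> letter list set" where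
  "short_words l = {w \<in> carrier (free_group m). w \<noteq> [] \<and> length w \<le> l}"

text \<open>The counterpart of \<open>girth_gt\<close> for tuples.\<close>

definition good :: "(nat \<Rightarrow> nat list \<Rightarrow> nat list) \<Rightarrow> nat \<Rightarrow> nat \<Rightarrow> bool" where
  "good x l n \<longleftrightarrow> (\<forall>w\<in>short_words l. Fix x w n = {})"

lemma finite_short_words: "finite (short_words l)"
  using finite_free_group_ball[of m l] by (rule finite_subset[rotated]) (auto simp: short_words_def)

lemma short_words_letters: "w \<in> short_words l \<Longrightarrow> letters_ok w"
  by (simp add: short_words_def carrier_free_group)

lemma finite_Fix: "finite (Fix x w n)"
  by (simp add: Fix_def finite_level)

text \<open>The value that \<open>card (Fix x w (Suc n))\<close> takes when \<open>L\<close> gives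
  the labels of level \<open>n\<close>.\<close>

definition fix_count :: "(nat \<times> nat list \<Rightarrow> nat \<Rightarrow> nat) \<Rightarrow> (nat \<Rightarrow> nat list \<Rightarrow> nat list) \<Rightarrow> letter list \<Rightarrow> nat \<Rightarrow> nat" where
  "fix_count L x w n = (\<Sum>v\<in>Fix x w n. card {j \<in> {1..d}. monodromy L x w v j = j})"

lemma card_Fix_lift:
  assumes x: "x \<in> tuples" "x' \<in> tuples" "agree n x x'" and L: "L \<in> labels n"
    and xL: "\<And>i v j. i \<in> {1..m} \<Longrightarrow> v \<in> level d n \<Longrightarrow> j \<in> {1..d} \<Longrightarrow> x' i (v @ [j]) = x i v @ [L (i, v) j]"
    and w: "letters_ok w"
  shows "card (Fix x' w (Suc n)) = fix_count L x w n"
proof -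
  have "Fix x' w (Suc n) = (\<lambda>(v, j). v @ [j]) ` (SIGMA v:Fix x w n. {j \<in> {1..d}. monodromy L x w v j = j})"
    using wact_lift[OF x L xL w] by (auto simp: Fix_def level_Suc image_iff)
  moreover have "inj_on (\<lambda>(v, j). v @ [j]) (SIGMA v:Fix x w n. {j \<in> {1..d}. monodromy L x w v j = j})"
    by (auto simp: inj_on_def)
  ultimately show ?thesis by (simp add: card_image fix_count_def finite_Fix)
qed

end

section \<open>A bounded strictly concave potential\<close>

definition conc :: "nat \<Rightarrow> real" where
  "conc t = real t / (real t + 1)"

lemma conc_bounds: "0 \<le> conc t" "conc t \<le> 1"
  by (simp_all add: conc_def divide_simps)

text \<open>An exact identity: the linear term vanishes on average for a martingale, and the last
  term is the loss of potential at a jump from \<open>k\<close> to \<open>t\<close>.\<close>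

lemma conc_tangent:
  "conc t = conc k + (real t - real k) / (real k + 1)\<^sup>2 - (real t - real k)\<^sup>2 / ((real k + 1)\<^sup>2 * (real t + 1))"
proof -
  have "real t + 1 > 0" "real k + 1 > 0" by simp_all
  then show ?thesis unfolding conc_def
    by (simp add: divide_simps power2_eq_square) (simp add: algebra_simps)
qed

section \<open>Averages over the labels of one level\<close>

context transitive_wreath begin

text \<open>The walk of \<open>w\<close> from \<open>v\<close> crosses its first edge
  \<open>e0\<close> only once. Multiplying the label of \<open>e0\<close> by a uniform
  \<open>g\<close> therefore makes the monodromy of the form \<open>r \<circ> g \<circ> h\<close>
  with \<open>r\<close> and \<open>h\<close> fixed, and transitivity makes it fix \<open>j\<close>
  with probability \<open>1 / d\<close>.\<close>

lemma card_fixing_labels: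
  assumes x: "x \<in> tuples" and w: "w \<in> carrier (free_group m)" "w \<noteq> []"
    and good: "good x (length w - 1) n" and v: "v \<in> Fix x w n" and j: "j \<in> {1..d}"
  shows "d * card {L \<in> labels n. monodromy L x w v j = j} = card (labels n)"
proof -
  obtain a w' where aw: "w = a # w'" using w(2) by (cases w) auto
  have a: "fst a \<in> {1..m}" and w': "letters_ok w'" using w(1) aw by (auto simp: carrier_free_group)
  have vl: "v \<in> level d n" using v by (simp add: Fix_def)
  define v1 where "v1 = lact x a v"
  have v1: "v1 \<in> level d n" unfolding v1_def by (rule lact_level[OF x a vl])
  define e0 where "e0 = edge_at x a v"
  define s where "s = snd a"
  have e0: "e0 \<in> idx n" unfolding e0_def by (rule edge_at_idx[OF x a vl])
  \<comment> \<open>A second crossing in the same direction closes a proper prefix of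
    \<open>w\<close> at \<open>v\<close>; one in the opposite direction closes a prefix of
    \<open>w'\<close> at \<open>v1\<close>, or is an immediate backtracking if
    \<open>p = 0\<close>.\<close>
  have indep: "edge_at x (w' ! p) (wact x (take p w') v1) \<noteq> e0" if p: "p < length w'" for p
  proof
    assume eq: "edge_at x (w' ! p) (wact x (take p w') v1) = e0"
    let ?u = "wact x (take p w') v1"
    have tp: "letters_ok (take p w')" using w' set_take_subset[of p w'] by blast
    have u: "?u \<in> level d n" by (rule wact_level[OF x tp v1])
    have nofix: "wact x t z \<noteq> z" if "t \<in> carrier (free_group m)" "t \<noteq> []" "length t < length w" "z \<in> level d n" for t z
      using good that unfolding good_def by (force simp: short_words_def Fix_def)
    have "(w' ! p = a \<and> ?u = v) \<or> (w' ! p = inv_letter a \<and> ?u = lact x a v)"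
      by (rule edge_at_eq[OF x a vl u]) (use eq in \<open>simp add: e0_def\<close>)
    then show False
    proof (elim disjE conjE)
      assume "?u = v"
      then have "wact x (take (Suc p) w) v = v" by (simp add: aw v1_def)
      then show False using nofix[OF take_closed[OF w(1)], of "Suc p" v] vl p aw by simp
    next
      assume l: "w' ! p = inv_letter a" "?u = lact x a v"
      show False
      proof (cases "p = 0")
        case True
        then show False using l(1) w(1) aw p by (cases w') (auto simp: carrier_free_group reduced_word_Cons)
      next
        case False
        have "w' \<in> carrier (free_group m)" using append_closedD(2)[of "[a]" w' m] w(1) aw by simp
        moreover have "w' \<noteq> []" using p by auto
        ultimately show False using nofix[OF take_closed, of w' p v1] l(2) False p v1 aw by (simp add: v1_def)
      qed
    qed
  qed
  \<comment> \<open>The shift by \<open>g\<close> is performed in the direction in which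
    \<open>w\<close> crosses \<open>e0\<close>; the outer \<open>lperm s\<close> converts back to
    the stored orientation.\<close>
  define sh where "sh = (\<lambda>g L. L(e0 := lperm s (g \<circ> lperm s (L e0))))"
  have Le0: "L e0 \<in> H" if "L \<in> labels n" for L using that e0 by (auto simp: labels_def)
  have sh_labels: "sh g L \<in> labels n" if "g \<in> H" "L \<in> labels n" for g L
    using that e0 Le0[OF that(2)] by (auto simp: labels_def sh_def PiE_iff extensional_def intro!: lperm_H H_comp)
  have sh_mono: "monodromy (sh g L) x w v = monodromy L x w' v1 \<circ> (g \<circ> lperm s (L e0))"
    if g: "g \<in> H" and L: "L \<in> labels n" for g L
  proof -
    have "monodromy (sh g L) x w' v1 = monodromy L x w' v1"
      by (rule monodromy_cong) (use indep in \<open>simp add: sh_def\<close>)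
    moreover have "lperm s (sh g L e0) = g \<circ> lperm s (L e0)"
      unfolding sh_def fun_upd_same by (rule lperm_lperm[OF H_comp[OF g lperm_H[OF Le0[OF L]]]])
    ultimately show ?thesis by (simp add: aw v1_def e0_def s_def)
  qed
  have sh_inv: "sh (inv' g) (sh g L) = L" if g: "g \<in> H" and L: "L \<in> labels n" for g L
  proof -
    have "inv' g \<circ> lperm s (lperm s (g \<circ> lperm s (L e0))) = lperm s (L e0)"
      using lperm_lperm[OF H_comp[OF g lperm_H[OF Le0[OF L]]], of s s] H_bij[OF g]
      by (simp add: fun_eq_iff bij_is_inj)
    then show ?thesis using lperm_lperm[OF Le0[OF L], of s] by (simp add: sh_def)
  qed
  have bij: "bij_betw (sh g) (labels n) (labels n)" if g: "g \<in> H" for g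
  proof (rule bij_betw_byWitness[where f' = "sh (inv' g)"])
    show "\<forall>L\<in>labels n. sh (inv' g) (sh g L) = L" using sh_inv[OF g] by blast
    show "\<forall>L\<in>labels n. sh g (sh (inv' g) L) = L"
      using sh_inv[OF H_inv[OF g]] by (simp add: inv_inv_eq[OF H_bij[OF g]])
  qed (use sh_labels g H_inv in auto)
  have fib: "d * card {g \<in> H. monodromy (sh g L) x w v j = j} = card H" if L: "L \<in> labels n" for L
  proof -
    let ?r = "monodromy L x w' v1" and ?k = "lperm s (L e0) j"
    have r: "?r \<in> H" by (rule monodromy_H[OF x L w' v1])
    have k: "?k \<in> {1..d}" by (rule H_in[OF lperm_H[OF Le0[OF L]] j])
    have "{g \<in> H. monodromy (sh g L) x w v j = j} = {g \<in> H. g ?k = inv' ?r j}"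
      using sh_mono[OF _ L] bij_inv_eq_iff[OF H_bij[OF r]] by (auto simp: eq_commute)
    then show ?thesis using card_H_fibre[OF k H_in[OF H_inv[OF r] j]] by simp
  qed
  let ?P = "\<lambda>L. monodromy L x w v j = j"
  \<comment> \<open>Each \<open>sh g\<close> permutes the labels, so the count may be averaged over
    \<open>g\<close> and the two sums exchanged.\<close>
  have "card H * card {L \<in> labels n. ?P L} = (\<Sum>g\<in>H. card {L \<in> labels n. ?P L})" by simp
  also have "\<dots> = (\<Sum>g\<in>H. card {L \<in> labels n. ?P (sh g L)})"
  proof (rule sum.cong[OF refl])
    fix g assume g: "g \<in> H"
    have im: "sh g ` {L \<in> labels n. ?P (sh g L)} = {L \<in> labels n. ?P L}"
    proof (rule equalityI; rule subsetI)
      fix L assume "L \<in> {L \<in> labels n. ?P L}"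
      moreover from this obtain L' where "L' \<in> labels n" "L = sh g L'"
        using bij_betw_imp_surj_on[OF bij[OF g]] by blast
      ultimately show "L \<in> sh g ` {L \<in> labels n. ?P (sh g L)}" by blast
    qed (use sh_labels[OF g] in auto)
    have "inj_on (sh g) {L \<in> labels n. ?P (sh g L)}"
      by (rule inj_on_subset[OF bij_betw_imp_inj_on[OF bij[OF g]]]) simp
    from card_image[OF this] show "card {L \<in> labels n. ?P L} = card {L \<in> labels n. ?P (sh g L)}"
      unfolding im .
  qed
  also have "\<dots> = (\<Sum>L\<in>labels n. card {g \<in> H. ?P (sh g L)})"
    unfolding card_filter_sum[OF finite_labels] card_filter_sum[OF finite_H] by (rule sum.swap)
  finally have "d * (card H * card {L \<in> labels n. ?P L}) = (\<Sum>L\<in>labels n. d * card {g \<in> H. ?P (sh g L)})"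
    by (simp only: sum_distrib_left)
  also have "\<dots> = (\<Sum>L\<in>labels n. card H)" by (rule sum.cong[OF refl fib])
  also have "\<dots> = card H * card (labels n)" by simp
  finally have "card H * (d * card {L \<in> labels n. ?P L}) = card H * card (labels n)" by (simp add: mult.left_commute)
  then show ?thesis using card_H_pos by simp
qed

text \<open>The martingale property: each of the \<open>d\<close> children of a fixed vertex is
  fixed with probability \<open>1 / d\<close>.\<close>

lemma sum_fix_count:
  assumes x: "x \<in> tuples" and w: "w \<in> carrier (free_group m)" "w \<noteq> []" and good: "good x (length w - 1) n"
  shows "(\<Sum>L\<in>labels n. fix_count L x w n) = card (labels n) * card (Fix x w n)"
proof -
  have "(\<Sum>L\<in>labels n. fix_count L x w n) =
      (\<Sum>v\<in>Fix x w n. \<Sum>L\<in>labels n. \<Sum>j\<in>{1..d}. if monodromy L x w v j = j then 1 else 0)"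
    unfolding fix_count_def card_filter_sum[OF finite_atLeastAtMost] by (rule sum.swap)
  also have "\<dots> = (\<Sum>v\<in>Fix x w n. \<Sum>j\<in>{1..d}. card {L \<in> labels n. monodromy L x w v j = j})"
    unfolding card_filter_sum[OF finite_labels] by (intro sum.cong refl sum.swap)
  finally have "d * (\<Sum>L\<in>labels n. fix_count L x w n) =
      (\<Sum>v\<in>Fix x w n. \<Sum>j\<in>{1..d}. d * card {L \<in> labels n. monodromy L x w v j = j})"
    by (simp only: sum_distrib_left)
  also have "\<dots> = (\<Sum>v\<in>Fix x w n. \<Sum>j\<in>{1..d}. card (labels n))"
    by (intro sum.cong refl card_fixing_labels[OF x w good])
  finally show ?thesis using d by simp
qed

text \<open>If the labels met along the loops of \<open>w\<close> at its fixed vertices are all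
  \<open>id\<close>, every child of a fixed vertex is fixed. This prescribes at most
  \<open>card (Fix x w n) * length w\<close> labels, each at the cost of a factor
  \<open>card H\<close>.\<close>

lemma card_trivial_labels:
  assumes x: "x \<in> tuples" and w: "letters_ok w"
  shows "card (labels n) \<le> card {L \<in> labels n. fix_count L x w n = card (Fix x w n) * d}
    * card H ^ (card (Fix x w n) * length w)"
proof -
  define U where "U = (\<lambda>(v, p). edge_at x (w ! p) (wact x (take p w) v)) ` (Fix x w n \<times> {..<length w})"
  have "card U \<le> card (Fix x w n \<times> {..<length w})"
    unfolding U_def by (rule card_image_le) (simp add: finite_Fix)
  then have cU: "card U \<le> card (Fix x w n) * length w" by (simp add: card_cartesian_product)
  have U: "U \<subseteq> idx n"
  proof -
    have "edge_at x (w ! p) (wact x (take p w) v) \<in> idx n" if "v \<in> Fix x w n" "p < length w" for v p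
    proof (rule edge_at_idx[OF x])
      show "fst (w ! p) \<in> {1..m}" using w nth_mem[OF that(2)] by blast
      have "letters_ok (take p w)" using w set_take_subset[of p w] by blast
      then show "wact x (take p w) v \<in> level d n" using wact_level[OF x] that(1) by (simp add: Fix_def)
    qed
    then show ?thesis by (auto simp: U_def)
  qed
  define T where "T = PiE (idx n) (\<lambda>e. if e \<in> U then {id} else H)"
  have "T \<subseteq> {L \<in> labels n. fix_count L x w n = card (Fix x w n) * d}"
  proof
    fix L assume L: "L \<in> T"
    have LU: "L e = id" if "e \<in> U" for e
    proof -
      have "L e \<in> (if e \<in> U then {id} else H)"
        using L U that unfolding T_def by (blast intro: PiE_mem)
      then show ?thesis using that by simp
    qed
    have Ll: "L \<in> labels n"
      using L H_id unfolding T_def labels_def by (auto simp: PiE_iff split: if_splits)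
    have "monodromy L x w v = id" if "v \<in> Fix x w n" for v
    proof (rule monodromy_id)
      fix p assume "p < length w"
      then have "edge_at x (w ! p) (wact x (take p w) v) \<in> U"
        unfolding U_def using that by (intro image_eqI[of _ _ "(v, p)"]) auto
      then show "L (edge_at x (w ! p) (wact x (take p w) v)) = id" by (rule LU)
    qed
    then have "{j \<in> {1..d}. monodromy L x w v j = j} = {1..d}" if "v \<in> Fix x w n" for v
      using that by auto
    then have "fix_count L x w n = (\<Sum>v\<in>Fix x w n. card {1..d})"
      unfolding fix_count_def by (intro sum.cong refl arg_cong[where f = card])
    then have "fix_count L x w n = card (Fix x w n) * d" by simp
    with Ll show "L \<in> {L \<in> labels n. fix_count L x w n = card (Fix x w n) * d}" by simp
  qed
  then have "card T \<le> card {L \<in> labels n. fix_count L x w n = card (Fix x w n) * d}"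
    by (rule card_mono[rotated]) (simp add: finite_labels)
  moreover have "card (labels n) \<le> card T * card H ^ (card (Fix x w n) * length w)"
  proof -
    have "card T = (\<Prod>e\<in>idx n. card (if e \<in> U then {id} else H))"
      unfolding T_def by (rule card_PiE[OF finite_idx])
    also have "\<dots> = (\<Prod>e\<in>idx n - U. card H)"
      using U finite_idx[of n] by (intro prod.mono_neutral_cong_right) auto
    also have "\<dots> = card H ^ (card (idx n) - card U)"
      using U finite_idx[of n] by (simp add: card_Diff_subset finite_subset)
    finally have T: "card T = card H ^ (card (idx n) - card U)" .
    have "card U \<le> card (idx n)" using U finite_idx card_mono by blast
    then have "card (labels n) = card T * card H ^ card U"
      unfolding T card_labels by (simp flip: power_add)
    also have "\<dots> \<le> card T * card H ^ (card (Fix x w n) * length w)"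
      using card_H_pos cU by (intro mult_left_mono power_increasing) auto
    finally show ?thesis .
  qed
  ultimately show ?thesis by (meson mult_le_mono1 order_trans)
qed

text \<open>The remainder term of \<open>conc_tangent\<close> for a jump from \<open>k\<close> to
  \<open>k * d\<close>, times the lower bound from \<open>card_trivial_labels\<close> for the
  probability of this jump.\<close>

definition conc_drop :: "nat \<Rightarrow> nat \<Rightarrow> real" where
  "conc_drop l k = (real (k * d) - real k)\<^sup>2 / ((real k + 1)\<^sup>2 * (real (k * d) + 1)) / real (card H) ^ (k * l)"

lemma conc_drop_pos: "k > 0 \<Longrightarrow> conc_drop l k > 0"
proof -
  assume k: "k > 0"
  have "k < k * d" using d k by simp
  then have "real k < real (k * d)" by (simp only: of_nat_less_iff)
  then show "conc_drop l k > 0" unfolding conc_drop_def using card_H_pos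
    by (intro divide_pos_pos mult_pos_pos zero_less_power) auto
qed

lemma conc_drop_nonneg: "conc_drop l k \<ge> 0"
  by (simp add: conc_drop_def)

text \<open>Summing \<open>conc_tangent\<close>, the linear term cancels by the martingale property,
  and the remainder is kept only on the labels that give \<open>k * d\<close> fixed
  vertices.\<close>

lemma sum_conc_fix_count:
  assumes x: "x \<in> tuples" and w: "w \<in> carrier (free_group m)" "w \<noteq> []" and good: "good x (length w - 1) n"
  defines "k \<equiv> card (Fix x w n)"
  shows "(\<Sum>L\<in>labels n. conc (fix_count L x w n)) \<le> card (labels n) * (conc k - conc_drop (length w) k)"
proof -
  define G where "G = {L \<in> labels n. fix_count L x w n = k * d}"
  define gap where "gap = (real (k * d) - real k)\<^sup>2 / ((real k + 1)\<^sup>2 * (real (k * d) + 1))"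
  have gap0: "gap \<ge> 0" by (simp add: gap_def)
  have "conc (fix_count L x w n) \<le> conc k + (real (fix_count L x w n) - real k) / (real k + 1)\<^sup>2
      - (if L \<in> G then gap else 0)" if "L \<in> labels n" for L
    using conc_tangent[of "fix_count L x w n" k] by (auto simp: G_def gap_def)
  then have "(\<Sum>L\<in>labels n. conc (fix_count L x w n)) \<le>
     (\<Sum>L\<in>labels n. conc k + (real (fix_count L x w n) - real k) / (real k + 1)\<^sup>2 - (if L \<in> G then gap else 0))"
    by (rule sum_mono)
  also have "\<dots> = card (labels n) * conc k
      + (real (\<Sum>L\<in>labels n. fix_count L x w n) - card (labels n) * real k) / (real k + 1)\<^sup>2 - card G * gap"
    by (simp add: sum.distrib sum_subtractf finite_labels sum.If_cases G_def Int_def conj_commute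
        flip: sum_divide_distrib)
  also have "real (\<Sum>L\<in>labels n. fix_count L x w n) - card (labels n) * real k = 0"
    unfolding sum_fix_count[OF x w good] by (simp add: k_def)
  finally have 1: "(\<Sum>L\<in>labels n. conc (fix_count L x w n)) \<le> card (labels n) * conc k - card G * gap" by simp
  have "letters_ok w" using w by (simp add: carrier_free_group)
  then have "card (labels n) \<le> card G * card H ^ (k * length w)"
    using card_trivial_labels[OF x, of w n] by (simp add: G_def k_def)
  then have "real (card (labels n)) \<le> real (card G) * real (card H) ^ (k * length w)"
    by (metis of_nat_le_iff of_nat_mult of_nat_power)
  then have "real (card (labels n)) / real (card H) ^ (k * length w) \<le> real (card G)"
    using card_H_pos by (simp add: divide_simps)
  then have "real (card (labels n)) / real (card H) ^ (k * length w) * gap \<le> card G * gap"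
    using gap0 by (rule mult_right_mono)
  then have "card (labels n) * conc_drop (length w) k \<le> card G * gap"
    unfolding conc_drop_def gap_def[symmetric] by simp
  with 1 show ?thesis by (simp add: right_diff_distrib)
qed


section \<open>Resampling the labels of a level by kicks\<close>

lemma W_compose:
  assumes "g \<in> W" "h \<in> W"
  shows "compose (tree d) h g \<in> W"
proof -
  have "\<exists>k\<in>H. \<forall>i\<in>{1..d}. compose (tree d) h g (v @ [i]) = compose (tree d) h g v @ [k i]" if v: "v \<in> tree d" for v
  proof (intro bexI ballI)
    fix i assume i: "i \<in> {1..d}"
    have gv: "g v \<in> tree d" using W_level[OF assms(1)] v level_tree tree_iff_level by blast
    show "compose (tree d) h g (v @ [i]) = compose (tree d) h g v @ [(lab h (g v) \<circ> lab g v) i]"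
      using v i lab(2)[OF assms(1) v i] lab(2)[OF assms(2) gv H_in[OF lab(1)[OF assms(1) v] i]]
      by (simp add: compose_def tree_snoc)
  next
    have gv: "g v \<in> tree d" using W_level[OF assms(1)] v level_tree tree_iff_level by blast
    show "lab h (g v) \<circ> lab g v \<in> H" by (intro H_comp lab assms v gv)
  qed
  moreover have "[] \<in> tree d" by (simp add: tree_def)
  ultimately show ?thesis
    using W_Nil[OF assms(1)] W_Nil[OF assms(2)] by (simp add: wreath_def compose_def)
qed

text \<open>Left multiplication by a \<open>kick\<close> changes the labels on level \<open>n\<close> in an arbitrary way, without
  changing the action on the levels up to \<open>n\<close>.\<close>

definition kick :: "nat \<Rightarrow> (nat \<times> nat list \<Rightarrow> nat \<Rightarrow> nat) \<Rightarrow> nat \<Rightarrow> nat list \<Rightarrow> nat list" where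
  "kick n \<eta> i = (\<lambda>v\<in>tree d. if n < length v then v[n := \<eta> (i, take n v) (v ! n)] else v)"

definition kicked :: "nat \<Rightarrow> (nat \<times> nat list \<Rightarrow> nat \<Rightarrow> nat) \<Rightarrow> (nat \<Rightarrow> nat list \<Rightarrow> nat list) \<Rightarrow> nat \<Rightarrow> nat list \<Rightarrow> nat list" where
  "kicked n \<eta> x = (\<lambda>i\<in>{1..m}. compose (tree d) (x i) (kick n \<eta> i))"

lemma take_level: "v \<in> tree d \<Longrightarrow> n \<le> length v \<Longrightarrow> take n v \<in> level d n"
  using set_take_subset[of n v] by (auto simp: level_def tree_def)

lemma labels_H: "\<eta> \<in> labels n \<Longrightarrow> i \<in> {1..m} \<Longrightarrow> v \<in> level d n \<Longrightarrow> \<eta> (i, v) \<in> H"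
  by (auto simp: labels_def idx_def)

lemma kick_snoc:
  assumes "v \<in> level d n" "j \<in> {1..d}"
  shows "kick n \<eta> i (v @ [j]) = v @ [\<eta> (i, v) j]"
  using assms by (simp add: kick_def tree_snoc level_def list_update_append nth_append)

lemma kick_W:
  assumes \<eta>: "\<eta> \<in> labels n" and i: "i \<in> {1..m}"
  shows "kick n \<eta> i \<in> W"
proof -
  have "\<exists>h\<in>H. \<forall>j\<in>{1..d}. kick n \<eta> i (v @ [j]) = kick n \<eta> i v @ [h j]" if v: "v \<in> tree d" for v
  proof -
    consider "length v < n" | "length v = n" | "n < length v" by linarith
    then show ?thesis
    proof cases
      case 1
      then show ?thesis using H_id v by (intro bexI[of _ id]) (auto simp: kick_def tree_snoc)
    next
      case 2
      then have vl: "v \<in> level d n" using v by (simp add: level_def)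
      show ?thesis
        using labels_H[OF \<eta> i vl] kick_snoc[OF vl, of _ \<eta> i] v 2
        by (intro bexI[of _ "\<eta> (i, v)"]) (auto simp: kick_def)
    next
      case 3
      then show ?thesis using H_id v
        by (intro bexI[of _ id]) (auto simp: kick_def tree_snoc list_update_append nth_append)
    qed
  qed
  then show ?thesis by (simp add: wreath_def kick_def tree_def)
qed

lemma kicked_tuples: "\<eta> \<in> labels n \<Longrightarrow> x \<in> tuples \<Longrightarrow> kicked n \<eta> x \<in> tuples"
  by (auto simp: kicked_def intro!: W_compose kick_W)

lemma agree_kicked:
  assumes "n' \<le> n"
  shows "agree n' x (kicked n \<eta> x)"
  using assms by (auto simp: agree_def kicked_def compose_def kick_def level_def)

lemma labels_arb: "\<eta> \<in> labels n \<Longrightarrow> e \<notin> idx n \<Longrightarrow> \<eta> e = undefined"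
  unfolding labels_def by (rule PiE_arb)

lemma labels_mem: "\<eta> \<in> labels n \<Longrightarrow> e \<in> idx n \<Longrightarrow> \<eta> e \<in> H"
  unfolding labels_def by (rule PiE_mem)

lemma restrict_labels: "(\<And>e. e \<in> idx n \<Longrightarrow> f e \<in> H) \<Longrightarrow> restrict f (idx n) \<in> labels n"
  unfolding labels_def by (simp add: restrict_PiE_iff)

definition kicked_labels where
  "kicked_labels n x \<eta> = (\<lambda>e\<in>idx n. lab (x (fst e)) (snd e) \<circ> \<eta> e)"

lemma lab_idx: "x \<in> tuples \<Longrightarrow> e \<in> idx n \<Longrightarrow> lab (x (fst e)) (snd e) \<in> H"
  by (auto simp: idx_def intro!: lab level_tree)

lemma kicked_snoc:
  assumes "\<eta> \<in> labels n" "x \<in> tuples" "i \<in> {1..m}" "v \<in> level d n" "j \<in> {1..d}"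
  shows "kicked n \<eta> x i (v @ [j]) = x i v @ [kicked_labels n x \<eta> (i, v) j]"
proof -
  have g: "x i \<in> W" using assms by auto
  have "v @ [j] \<in> tree d" using assms(4,5) by (simp add: tree_snoc level_def)
  then have "kicked n \<eta> x i (v @ [j]) = x i (v @ [\<eta> (i, v) j])"
    using assms(3) by (simp add: kicked_def compose_def kick_snoc[OF assms(4,5)])
  also have "\<dots> = x i v @ [lab (x i) v (\<eta> (i, v) j)]"
    by (rule lab(2)[OF g level_tree[OF assms(4)] H_in[OF labels_H[OF assms(1,3,4)] assms(5)]])
  finally show ?thesis using assms(3,4) by (simp add: kicked_labels_def idx_def)
qed

text \<open>Composition with the labels of \<open>x\<close> is undone by composition with their
  inverses. Averaging over kicks of a fixed tuple is thus averaging over all labels of level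
  \<open>n\<close>.\<close>

lemma bij_kicked_labels:
  assumes x: "x \<in> tuples"
  shows "bij_betw (kicked_labels n x) (labels n) (labels n)"
proof (rule bij_betw_byWitness[where f' = "\<lambda>L. \<lambda>e\<in>idx n. inv' (lab (x (fst e)) (snd e)) \<circ> L e"])
  note lx = lab_idx[OF x]
  show "\<forall>\<eta>\<in>labels n. (\<lambda>e\<in>idx n. inv' (lab (x (fst e)) (snd e)) \<circ> kicked_labels n x \<eta> e) = \<eta>"
  proof (intro ballI, rule ext)
    fix \<eta> e assume \<eta>: "\<eta> \<in> labels n"
    have "inv' (lab (x (fst e)) (snd e)) \<circ> (lab (x (fst e)) (snd e) \<circ> \<eta> e) = \<eta> e" if "e \<in> idx n"
      using bij_is_inj[OF H_bij[OF lx[OF that]]] by (simp add: fun_eq_iff)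
    then show "(\<lambda>e\<in>idx n. inv' (lab (x (fst e)) (snd e)) \<circ> kicked_labels n x \<eta> e) e = \<eta> e"
      using labels_arb[OF \<eta>, of e] by (cases "e \<in> idx n") (simp_all add: kicked_labels_def)
  qed
  show "\<forall>L\<in>labels n. kicked_labels n x (\<lambda>e\<in>idx n. inv' (lab (x (fst e)) (snd e)) \<circ> L e) = L"
  proof (intro ballI, rule ext)
    fix L e assume L: "L \<in> labels n"
    have "lab (x (fst e)) (snd e) \<circ> (inv' (lab (x (fst e)) (snd e)) \<circ> L e) = L e" if "e \<in> idx n"
      using bij_is_surj[OF H_bij[OF lx[OF that]]] by (simp add: fun_eq_iff surj_f_inv_f)
    then show "kicked_labels n x (\<lambda>e\<in>idx n. inv' (lab (x (fst e)) (snd e)) \<circ> L e) e = L e"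
      using labels_arb[OF L, of e] by (cases "e \<in> idx n") (simp_all add: kicked_labels_def)
  qed
  show "kicked_labels n x ` labels n \<subseteq> labels n"
    unfolding kicked_labels_def by (intro image_subsetI restrict_labels H_comp lx labels_mem)
  show "(\<lambda>L. \<lambda>e\<in>idx n. inv' (lab (x (fst e)) (snd e)) \<circ> L e) ` labels n \<subseteq> labels n"
    by (intro image_subsetI restrict_labels H_comp H_inv lx labels_mem)
qed

lemma card_Fix_kicked:
  assumes \<eta>: "\<eta> \<in> labels n" and x: "x \<in> tuples" and w: "letters_ok w"
  shows "card (Fix (kicked n \<eta> x) w (Suc n)) = fix_count (kicked_labels n x \<eta>) x w n"
proof (rule card_Fix_lift[OF x kicked_tuples[OF \<eta> x] agree_kicked[OF order_refl] _ _ w])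
  show "kicked_labels n x \<eta> \<in> labels n" using bij_kicked_labels[OF x, of n] \<eta> by (auto simp: bij_betw_def)
qed (rule kicked_snoc[OF \<eta> x])

lemma sum_kicked:
  assumes x: "x \<in> tuples"
  shows "(\<Sum>\<eta>\<in>labels n. F (kicked_labels n x \<eta>)) = (\<Sum>L\<in>labels n. F L)"
  by (rule sum.reindex_bij_betw[OF bij_kicked_labels[OF x]])

definition inv_labels where
  "inv_labels n \<eta> = (\<lambda>e\<in>idx n. inv' (\<eta> e))"

lemma inv_labels: "\<eta> \<in> labels n \<Longrightarrow> inv_labels n \<eta> \<in> labels n"
  unfolding inv_labels_def by (intro restrict_labels H_inv labels_mem)

lemma inv_labels_inv_labels:
  assumes "\<eta> \<in> labels n"
  shows "inv_labels n (inv_labels n \<eta>) = \<eta>"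
proof
  fix e
  have "\<eta> e \<in> H" if "e \<in> idx n" by (rule labels_mem[OF assms that])
  then show "inv_labels n (inv_labels n \<eta>) e = \<eta> e"
    using labels_arb[OF assms, of e]
    by (cases "e \<in> idx n") (simp_all add: inv_labels_def inv_inv_eq H_bij)
qed

text \<open>A kick alters one entry by a permutation that depends only on the earlier entries, which
  it leaves in place.\<close>

lemma kicked_inverse:
  assumes \<eta>: "\<eta> \<in> labels n" and x: "x \<in> tuples"
  shows "kicked n \<eta> (kicked n (inv_labels n \<eta>) x) = x"
proof
  fix i
  show "kicked n \<eta> (kicked n (inv_labels n \<eta>) x) i = x i"
  proof (cases "i \<in> {1..m}")
    case True
    have g: "x i \<in> W" using x True by auto
    have k: "kick n (inv_labels n \<eta>) i (kick n \<eta> i v) = v" if v: "v \<in> tree d" for v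
    proof (cases "n < length v")
      case nv: True
      have tl: "take n v \<in> level d n" using take_level v nv by simp
      have e: "(i, take n v) \<in> idx n" using True tl by (simp add: idx_def)
      have b: "bij (\<eta> (i, take n v))" using labels_H[OF \<eta> True tl] H_bij by blast
      have "kick n \<eta> i v \<in> tree d"
        using W_level[OF kick_W[OF \<eta> True]] v level_tree tree_iff_level by blast
      then show ?thesis
        using v nv e b by (simp add: kick_def inv_labels_def bij_is_inj)
    qed (use v in \<open>simp add: kick_def\<close>)
    have "compose (tree d) (compose (tree d) (x i) (kick n (inv_labels n \<eta>) i)) (kick n \<eta> i) v = x i v" for v
    proof (cases "v \<in> tree d")
      case v: True
      have "kick n \<eta> i v \<in> tree d"
        using W_level[OF kick_W[OF \<eta> True]] v level_tree tree_iff_level by blast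
      then show ?thesis using v k by (simp add: compose_def)
    next
      case False
      then show ?thesis using g by (auto simp: compose_def wreath_def extensional_def)
    qed
    then show ?thesis using True by (simp add: kicked_def fun_eq_iff)
  next
    case False
    then show ?thesis using PiE_arb[OF x False] by (simp add: kicked_def del: atLeastAtMost_iff)
  qed
qed

lemma Fix_cong:
  "agree n x x' \<Longrightarrow> x \<in> tuples \<Longrightarrow> letters_ok w \<Longrightarrow> Fix x w n = Fix x' w n"
  using wact_cong[of n x x' w] by (auto simp: Fix_def)

lemma good_cong:
  assumes "agree n x x'" "x \<in> tuples"
  shows "good x l n \<longleftrightarrow> good x' l n"
  using Fix_cong[OF assms short_words_letters] by (simp add: good_def)

text \<open>A fixed vertex lies below a fixed vertex. The lift formula is applied to
  \<open>x\<close> itself, whose labels are \<open>kicked_labels\<close> of the trivial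
  kick.\<close>

lemma good_mono:
  assumes x: "x \<in> tuples" and g: "good x l n" and n: "n \<le> n'"
  shows "good x l n'"
  using n
proof (induction n' rule: dec_induct)
  case (step n)
  have "Fix x w (Suc n) = {}" if w: "w \<in> short_words l" for w
  proof -
    let ?L = "kicked_labels n x (\<lambda>e\<in>idx n. id)"
    have L: "?L \<in> labels n"
      unfolding kicked_labels_def by (intro restrict_labels) (simp add: lab_idx[OF x])
    have "card (Fix x w (Suc n)) = fix_count ?L x w n"
    proof (rule card_Fix_lift[OF x x _ L _ short_words_letters[OF w]])
      show "x i (v @ [j]) = x i v @ [?L (i, v) j]" if "i \<in> {1..m}" "v \<in> level d n" "j \<in> {1..d}" for i v j
        using lab(2)[OF PiE_mem[OF x that(1)] level_tree[OF that(2)] that(3)] that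
        by (simp add: kicked_labels_def idx_def)
    qed (simp add: agree_def)
    also have "\<dots> = 0" using step w by (simp add: good_def fix_count_def)
    finally show ?thesis using finite_Fix by simp
  qed
  then show ?case by (simp add: good_def)
qed (rule g)

end

section \<open>Invariance of Haar measure under kicks\<close>

locale haar_tuple = transitive_wreath +
  fixes Q :: "(nat \<Rightarrow> nat list \<Rightarrow> nat list) measure"
  assumes sets_Q: "sets Q = sets (PiM {1..m} (\<lambda>_. wreath_borel d H))"
    and haar_Q: "haar_probability (product_group {1..m} (\<lambda>_. wreath d H)) Q"
begin

sublocale prob_space Q
  using haar_Q by (simp add: haar_probability_def)

lemma space_Q: "space Q = tuples"
  using haar_Q by (simp add: haar_probability_def)

lemma kicked_mult:
  "(\<lambda>i\<in>{1..m}. kick n \<eta> i) \<otimes>\<^bsub>product_group {1..m} (\<lambda>_. wreath d H)\<^esub> x = kicked n \<eta> x"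
  by (auto simp: kicked_def wreath_def)

lemma kicked_image:
  assumes \<eta>: "\<eta> \<in> labels n" and A: "A \<in> sets Q"
  shows "kicked n \<eta> ` A \<in> sets Q" "emeasure Q (kicked n \<eta> ` A) = emeasure Q A"
proof -
  have g: "(\<lambda>i\<in>{1..m}. kick n \<eta> i) \<in> carrier (product_group {1..m} (\<lambda>_. wreath d H))"
    using kick_W[OF \<eta>] by simp
  have eq: "(\<lambda>x. (\<lambda>i\<in>{1..m}. kick n \<eta> i) \<otimes>\<^bsub>product_group {1..m} (\<lambda>_. wreath d H)\<^esub> x) = kicked n \<eta>"
    by (rule ext) (rule kicked_mult)
  have "\<forall>g\<in>carrier (product_group {1..m} (\<lambda>_. wreath d H)). \<forall>A\<in>sets Q.
      (\<lambda>x. g \<otimes>\<^bsub>product_group {1..m} (\<lambda>_. wreath d H)\<^esub> x) ` A \<in> sets Q \<and>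
      emeasure Q ((\<lambda>x. g \<otimes>\<^bsub>product_group {1..m} (\<lambda>_. wreath d H)\<^esub> x) ` A) = emeasure Q A"
    using haar_Q unfolding haar_probability_def by blast
  from bspec[OF bspec[OF this g] A]
  show "kicked n \<eta> ` A \<in> sets Q" "emeasure Q (kicked n \<eta> ` A) = emeasure Q A"
    unfolding eq by blast+
qed

text \<open>Invariance is given for images, whereas measurability and \<open>distr\<close> concern
  preimages; the inverse kick translates between them.\<close>

lemma kicked_vimage:
  assumes \<eta>: "\<eta> \<in> labels n" and A: "A \<in> sets Q"
  shows "kicked n \<eta> -` A \<inter> space Q = kicked n (inv_labels n \<eta>) ` A"
proof (rule equalityI; rule subsetI)
  note i\<eta> = inv_labels[OF \<eta>]
  have AQ: "A \<subseteq> tuples" using sets.sets_into_space[OF A] by (simp add: space_Q)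
  fix x
  show "x \<in> kicked n (inv_labels n \<eta>) ` A" if x: "x \<in> kicked n \<eta> -` A \<inter> space Q"
  proof (rule image_eqI)
    have "x \<in> tuples" using x by (simp add: space_Q)
    from kicked_inverse[OF i\<eta> this]
    show "x = kicked n (inv_labels n \<eta>) (kicked n \<eta> x)" by (simp only: inv_labels_inv_labels[OF \<eta>])
    show "kicked n \<eta> x \<in> A" using x by simp
  qed
  show "x \<in> kicked n \<eta> -` A \<inter> space Q" if x: "x \<in> kicked n (inv_labels n \<eta>) ` A"
  proof -
    obtain y where y: "y \<in> A" "x = kicked n (inv_labels n \<eta>) y" using x by blast
    then have yt: "y \<in> tuples" using AQ by blast
    have "kicked n \<eta> x = y" unfolding y(2) by (rule kicked_inverse[OF \<eta> yt])
    moreover have "x \<in> tuples" unfolding y(2) by (rule kicked_tuples[OF i\<eta> yt])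
    ultimately show ?thesis using y(1) by (simp add: space_Q)
  qed
qed

lemma measurable_kicked:
  assumes "\<eta> \<in> labels n"
  shows "kicked n \<eta> \<in> measurable Q Q"
proof (rule measurableI)
  show "kicked n \<eta> x \<in> space Q" if "x \<in> space Q" for x
    using kicked_tuples[OF assms] that by (simp only: space_Q)
  show "kicked n \<eta> -` A \<inter> space Q \<in> sets Q" if "A \<in> sets Q" for A
    unfolding kicked_vimage[OF assms that] by (rule kicked_image(1)[OF inv_labels[OF assms] that])
qed

lemma distr_kicked:
  assumes "\<eta> \<in> labels n"
  shows "distr Q Q (kicked n \<eta>) = Q"
proof (rule measure_eqI)
  fix A assume "A \<in> sets (distr Q Q (kicked n \<eta>))"
  then have A: "A \<in> sets Q" by simp
  then show "emeasure (distr Q Q (kicked n \<eta>)) A = emeasure Q A"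
    using kicked_vimage[OF assms A] kicked_image(2)[OF inv_labels[OF assms] A]
    by (simp add: emeasure_distr[OF measurable_kicked[OF assms] A])
qed simp

lemma integral_kicked:
  fixes F :: "_ \<Rightarrow> real"
  assumes "\<eta> \<in> labels n" "F \<in> borel_measurable Q"
  shows "(\<integral>x. F (kicked n \<eta> x) \<partial>Q) = (\<integral>x. F x \<partial>Q)"
  using integral_distr[OF measurable_kicked[OF assms(1)] assms(2)] by (simp add: distr_kicked[OF assms(1)])

lemma measurable_coordinate:
  assumes "i \<in> {1..m}" "v \<in> tree d"
  shows "{x \<in> space Q. x i v = u} \<in> sets Q"
proof -
  let ?B = "wreath_borel d H"
  have "{g \<in> W. g v = u} \<in> sets ?B"
    unfolding wreath_borel_def using assms(2) by (intro in_measure_of) auto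
  moreover have "(\<lambda>x. x i) \<in> measurable (PiM {1..m} (\<lambda>_. ?B)) ?B"
    using assms(1) by (rule measurable_component_singleton)
  ultimately have "(\<lambda>x. x i) -` {g \<in> W. g v = u} \<inter> space (PiM {1..m} (\<lambda>_. ?B)) \<in> sets (PiM {1..m} (\<lambda>_. ?B))"
    by (rule measurable_sets[rotated])
  moreover have "space (PiM {1..m} (\<lambda>_. ?B)) = space Q" using sets_eq_imp_space_eq[OF sets_Q] by simp
  moreover have "(\<lambda>x. x i) -` {g \<in> W. g v = u} \<inter> space Q = {x \<in> space Q. x i v = u}"
    using assms(1) by (auto simp: space_Q)
  ultimately show ?thesis by (simp add: sets_Q)
qed

text \<open>On level \<open>n\<close> a tuple takes only finitely many values, each on a finite
  intersection of generating events, so every function of these values is measurable, whatever its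
  target.\<close>

lemma measurable_level:
  assumes F: "\<And>x x'. x \<in> tuples \<Longrightarrow> x' \<in> tuples \<Longrightarrow> agree n x x' \<Longrightarrow> F x = F x'"
  shows "F \<in> measurable Q (count_space UNIV)"
proof (rule measurableI)
  fix A
  define T where "T = (\<lambda>x :: nat \<Rightarrow> nat list \<Rightarrow> nat list. \<lambda>e\<in>idx n. x (fst e) (snd e))"
  define R where "R = PiE (idx n) (\<lambda>_. level d n)"
  have finR: "finite R" by (simp add: R_def finite_PiE finite_idx finite_level)
  have T: "T x \<in> R" if "x \<in> tuples" for x
  proof -
    have "x (fst e) (snd e) \<in> level d n" if "e \<in> idx n" for e
    proof (rule W_level[of "x (fst e)" "snd e"])
      show "x (fst e) \<in> W" by (rule PiE_mem[OF \<open>x \<in> tuples\<close>]) (use that in \<open>auto simp: idx_def\<close>)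
      show "snd e \<in> level d n" using that by (auto simp: idx_def)
    qed
    then show ?thesis by (auto simp: T_def R_def)
  qed
  have agr: "agree n x x'" if "T x = T x'" for x x'
    unfolding agree_def
  proof (intro ballI)
    fix i v assume "i \<in> {1..m}" "v \<in> level d n"
    then show "x i v = x' i v" using fun_cong[OF that, of "(i, v)"] by (simp add: T_def idx_def)
  qed
  have Tr: "{x \<in> space Q. T x = r} \<in> sets Q" if r: "r \<in> R" for r
  proof -
    have "T x = r \<longleftrightarrow> (\<forall>e\<in>idx n. x (fst e) (snd e) = r e)" for x
      using PiE_arb[OF r[unfolded R_def]] by (auto simp: T_def fun_eq_iff)
    moreover have "{x \<in> space Q. \<forall>e\<in>idx n. x (fst e) (snd e) = r e} \<in> sets Q"
    proof (rule sets.sets_Collect_finite_All[OF _ finite_idx])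
      show "{x \<in> space Q. x (fst e) (snd e) = r e} \<in> sets Q" if "e \<in> idx n" for e
        using that by (intro measurable_coordinate) (auto simp: idx_def level_tree)
    qed
    ultimately show ?thesis by simp
  qed
  have "F -` A \<inter> space Q = (\<Union>r\<in>{r \<in> R. \<exists>x\<in>tuples. T x = r \<and> F x \<in> A}. {x \<in> space Q. T x = r})"
  proof (rule equalityI; rule subsetI)
    fix x assume "x \<in> F -` A \<inter> space Q"
    then show "x \<in> (\<Union>r\<in>{r \<in> R. \<exists>x\<in>tuples. T x = r \<and> F x \<in> A}. {x \<in> space Q. T x = r})"
      using T[of x] unfolding space_Q by (intro UN_I[of "T x"]) blast+
  next
    fix x assume "x \<in> (\<Union>r\<in>{r \<in> R. \<exists>x\<in>tuples. T x = r \<and> F x \<in> A}. {x \<in> space Q. T x = r})"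
    then obtain x' where "x' \<in> tuples" "F x' \<in> A" "x \<in> tuples" "T x = T x'" by (auto simp: space_Q)
    then show "x \<in> F -` A \<inter> space Q" using F[of x x'] agr[of x x'] by (simp add: space_Q)
  qed
  also have "\<dots> \<in> sets Q" using finR Tr by (intro sets.finite_UN) auto
  finally show "F -` A \<inter> space Q \<in> sets Q" .
qed simp

lemma integrable_level:
  fixes F :: "_ \<Rightarrow> real"
  assumes F: "\<And>x x'. x \<in> tuples \<Longrightarrow> x' \<in> tuples \<Longrightarrow> agree n x x' \<Longrightarrow> F x = F x'"
    and C: "\<And>x. x \<in> tuples \<Longrightarrow> \<bar>F x\<bar> \<le> C"
  shows "integrable Q F"
proof (rule integrable_const_bound[where B = C])
  have "F \<in> measurable Q (count_space UNIV)" by (rule measurable_level[OF F])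
  then show "F \<in> borel_measurable Q" using measurable_compose[of F Q "count_space UNIV" "\<lambda>x. x" borel] by simp
  show "AE x in Q. norm (F x) \<le> C" by (rule AE_I2) (simp add: C space_Q)
qed

text \<open>Conditioning on level \<open>n\<close> in elementary form: by invariance the integral of
  \<open>F\<close> equals that of its average over the kicks of level \<open>n\<close>, and this
  average is bounded by \<open>G\<close> pointwise.\<close>

lemma integral_average:
  fixes F G :: "_ \<Rightarrow> real"
  assumes F: "\<And>x x'. x \<in> tuples \<Longrightarrow> x' \<in> tuples \<Longrightarrow> agree (Suc n) x x' \<Longrightarrow> F x = F x'"
    and G: "integrable Q G"
    and bd: "\<And>x. x \<in> tuples \<Longrightarrow> \<bar>F x\<bar> \<le> C"
    and le: "\<And>x. x \<in> tuples \<Longrightarrow> (\<Sum>\<eta>\<in>labels n. F (kicked n \<eta> x)) \<le> card (labels n) * G x"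
  shows "(\<integral>x. F x \<partial>Q) \<le> (\<integral>x. G x \<partial>Q)"
proof -
  have iF: "integrable Q F" by (rule integrable_level[OF F bd])
  have ik: "integrable Q (\<lambda>x. F (kicked n \<eta> x))" if "\<eta> \<in> labels n" for \<eta>
    using integrable_distr[OF measurable_kicked[OF that], of F] iF by (simp add: distr_kicked[OF that])
  have "card (labels n) * (\<integral>x. F x \<partial>Q) = (\<Sum>\<eta>\<in>labels n. \<integral>x. F (kicked n \<eta> x) \<partial>Q)"
    using integral_kicked[OF _ borel_measurable_integrable[OF iF]] by simp
  also have "\<dots> = (\<integral>x. (\<Sum>\<eta>\<in>labels n. F (kicked n \<eta> x)) \<partial>Q)"
    by (rule Bochner_Integration.integral_sum[symmetric]) (rule ik)
  also have "\<dots> \<le> (\<integral>x. card (labels n) * G x \<partial>Q)"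
    by (rule integral_mono) (use ik G le space_Q in auto)
  also have "\<dots> = card (labels n) * (\<integral>x. G x \<partial>Q)" by simp
  finally have "card (labels n) * (\<integral>x. F x \<partial>Q) \<le> card (labels n) * (\<integral>x. G x \<partial>Q)" .
  moreover have "card (labels n) > 0" using card_H_pos by (simp add: card_labels)
  ultimately show ?thesis by simp
qed


text \<open>The image of \<open>v\<close> is read off from the image of its child
  \<open>v @ [1]\<close>.\<close>

lemma agree_mono:
  assumes x: "x \<in> tuples" "x' \<in> tuples" and agr: "agree n' x x'" and n: "n \<le> n'"
  shows "agree n x x'"
  using n
proof (induction n rule: inc_induct)
  case (step n)
  show ?case unfolding agree_def
  proof (intro ballI)
    fix i v assume i: "i \<in> {1..m}" and v: "v \<in> level d n"
    have 1: "1 \<in> {1..d}" using d by simp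
    then have "v @ [1] \<in> level d (Suc n)" using v by (auto simp: level_Suc)
    then have "x i (v @ [1]) = x' i (v @ [1])" using step i by (auto simp: agree_def)
    then show "x i v = x' i v"
      using lab(2)[OF PiE_mem[OF x(1) i] level_tree[OF v] 1] lab(2)[OF PiE_mem[OF x(2) i] level_tree[OF v] 1]
      by simp
  qed
qed (rule agr)

lemma card_Fix_le: "card (Fix x w n) \<le> d ^ n"
  using card_mono[OF finite_level, of "Fix x w n" d n] card_level[of d n] by (auto simp: Fix_def)

end

section \<open>Extinction of the fixed vertices of one word\<close>

context haar_tuple begin

lemma level_event:
  assumes "\<And>x x'. x \<in> tuples \<Longrightarrow> x' \<in> tuples \<Longrightarrow> agree n x x' \<Longrightarrow> R x = R x'"
  shows "{x \<in> space Q. R x} \<in> sets Q"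
  using measurable_level[of n R, OF assms] by (rule predE)

context
  fixes w :: "letter list" and n0 :: nat
  assumes w: "w \<in> carrier (free_group m)" "w \<noteq> []"
begin

text \<open>This event is decided at level \<open>n0\<close> and persists by
  \<open>good_mono\<close>, so on it \<open>nfix\<close> is a martingale from level
  \<open>n0\<close> on.\<close>

definition start_good where "start_good x \<longleftrightarrow> good x (length w - 1) n0"

definition nfix where "nfix n x = card (Fix x w (n0 + n))"

lemma w_letters: "letters_ok w"
  using w by (simp add: carrier_free_group)

lemma nfix_cong:
  assumes "x \<in> tuples" "x' \<in> tuples" "agree (n0 + n) x x'"
  shows "start_good x = start_good x'" "nfix n x = nfix n x'"
  using good_cong[OF agree_mono[OF assms, of n0]] Fix_cong[OF assms(3,1) w_letters] assms
  by (simp_all add: start_good_def nfix_def)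

lemma start_good_kicked: "x \<in> tuples \<Longrightarrow> start_good (kicked (n0 + n) \<eta> x) = start_good x"
  using good_cong[OF agree_kicked[of n0 "n0 + n"], of x] by (simp add: start_good_def)

lemma nfix_kicked:
  assumes "\<eta> \<in> labels (n0 + n)" "x \<in> tuples"
  shows "nfix (Suc n) (kicked (n0 + n) \<eta> x) = fix_count (kicked_labels (n0 + n) x \<eta>) x w (n0 + n)"
  using card_Fix_kicked[OF assms w_letters] by (simp add: nfix_def)

lemma good_if_start_good: "x \<in> tuples \<Longrightarrow> start_good x \<Longrightarrow> good x (length w - 1) (n0 + n)"
  unfolding start_good_def by (erule (1) good_mono) simp

lemma integrable_nfix:
  assumes "\<And>k. k \<le> d ^ (n0 + n) \<Longrightarrow> \<bar>g k\<bar> \<le> C"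
  shows "integrable Q (\<lambda>x. if start_good x then g (nfix n x) else (0::real))"
proof (rule integrable_level)
  show "(if start_good x then g (nfix n x) else 0) = (if start_good x' then g (nfix n x') else 0)"
    if "x \<in> tuples" "x' \<in> tuples" "agree (n0 + n) x x'" for x x'
    using nfix_cong[OF that] by simp
  show "\<bar>if start_good x then g (nfix n x) else 0\<bar> \<le> C" for x
    using assms[of "nfix n x"] assms[of 0] card_Fix_le[of x w "n0 + n"] by (auto simp: nfix_def)
qed

lemma nfix_event: "{x \<in> space Q. start_good x \<and> nfix n x = k} \<in> sets Q" "{x \<in> space Q. start_good x \<and> nfix n x \<noteq> 0} \<in> sets Q"
  using nfix_cong[of _ _ n] by (intro level_event[of "n0 + n"]; metis)+

lemma mean_decreases:
  "(\<integral>x. (if start_good x then real (nfix (Suc n) x) else 0) \<partial>Q) \<le> (\<integral>x. (if start_good x then real (nfix n x) else 0) \<partial>Q)"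
proof (rule integral_average[of "n0 + n"])
  show "(if start_good x then real (nfix (Suc n) x) else 0) = (if start_good x' then real (nfix (Suc n) x') else 0)"
    if "x \<in> tuples" "x' \<in> tuples" "agree (Suc (n0 + n)) x x'" for x x'
    using nfix_cong[of x x' "Suc n"] that by simp
  show "integrable Q (\<lambda>x. if start_good x then real (nfix n x) else 0)"
    by (rule integrable_nfix[where C = "d ^ (n0 + n)"]) (metis abs_of_nat of_nat_le_iff)
  show "\<bar>if start_good x then real (nfix (Suc n) x) else 0\<bar> \<le> d ^ (n0 + Suc n)" for x
    using card_Fix_le[of x w "n0 + Suc n"] unfolding nfix_def by (metis abs_0 abs_of_nat of_nat_0_le_iff of_nat_le_iff)
  show "(\<Sum>\<eta>\<in>labels (n0 + n). if start_good (kicked (n0 + n) \<eta> x) then real (nfix (Suc n) (kicked (n0 + n) \<eta> x)) else 0)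
      \<le> card (labels (n0 + n)) * (if start_good x then real (nfix n x) else 0)" if x: "x \<in> tuples" for x
  proof (cases "start_good x")
    case True
    have "(\<Sum>\<eta>\<in>labels (n0 + n). if start_good (kicked (n0 + n) \<eta> x) then real (nfix (Suc n) (kicked (n0 + n) \<eta> x)) else 0)
        = (\<Sum>\<eta>\<in>labels (n0 + n). real (fix_count (kicked_labels (n0 + n) x \<eta>) x w (n0 + n)))"
      by (rule sum.cong) (simp_all add: start_good_kicked[OF x] True nfix_kicked[OF _ x])
    also have "\<dots> = (\<Sum>L\<in>labels (n0 + n). real (fix_count L x w (n0 + n)))" by (rule sum_kicked[OF x])
    also have "\<dots> = real (\<Sum>L\<in>labels (n0 + n). fix_count L x w (n0 + n))" by simp
    also have "\<dots> = card (labels (n0 + n)) * real (nfix n x)"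
      unfolding sum_fix_count[OF x w good_if_start_good[OF x True]] by (simp add: nfix_def)
    finally show ?thesis using True by simp
  qed (simp add: start_good_kicked[OF x])
qed

lemma potential_decreases:
  "(\<integral>x. (if start_good x then conc (nfix (Suc n) x) else 0) \<partial>Q) \<le>
   (\<integral>x. (if start_good x then conc (nfix n x) else 0) \<partial>Q) - conc_drop (length w) k * prob {x \<in> space Q. start_good x \<and> nfix n x = k}"
proof -
  let ?D = "{x \<in> space Q. start_good x \<and> nfix n x = k}" and ?c = "conc_drop (length w) k"
  have int: "integrable Q (\<lambda>x. if start_good x then conc (nfix n x) else 0)"
    by (rule integrable_nfix[where C = 1]) (metis conc_bounds abs_of_nonneg)
  have intD: "integrable Q (\<lambda>x. ?c * indicator ?D x)"
    using nfix_event(1) by (intro integrable_mult_right integrable_real_indicator) (auto simp: emeasure_eq_measure)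
  have "(\<integral>x. (if start_good x then conc (nfix (Suc n) x) else 0) \<partial>Q) \<le>
     (\<integral>x. ((if start_good x then conc (nfix n x) else 0) - ?c * indicator ?D x) \<partial>Q)"
  proof (rule integral_average[of "n0 + n"])
    show "(if start_good x then conc (nfix (Suc n) x) else 0) = (if start_good x' then conc (nfix (Suc n) x') else 0)"
      if "x \<in> tuples" "x' \<in> tuples" "agree (Suc (n0 + n)) x x'" for x x'
      using nfix_cong[of x x' "Suc n"] that by simp
    show "integrable Q (\<lambda>x. (if start_good x then conc (nfix n x) else 0) - ?c * indicator ?D x)"
      by (rule Bochner_Integration.integrable_diff[OF int intD])
    show "\<bar>if start_good x then conc (nfix (Suc n) x) else 0\<bar> \<le> 1" for x
      using conc_bounds by auto
    show "(\<Sum>\<eta>\<in>labels (n0 + n). if start_good (kicked (n0 + n) \<eta> x) then conc (nfix (Suc n) (kicked (n0 + n) \<eta> x)) else 0)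
        \<le> card (labels (n0 + n)) * ((if start_good x then conc (nfix n x) else 0) - ?c * indicator ?D x)"
      if x: "x \<in> tuples" for x
    proof (cases "start_good x")
      case True
      have "(\<Sum>\<eta>\<in>labels (n0 + n). if start_good (kicked (n0 + n) \<eta> x) then conc (nfix (Suc n) (kicked (n0 + n) \<eta> x)) else 0)
          = (\<Sum>\<eta>\<in>labels (n0 + n). conc (fix_count (kicked_labels (n0 + n) x \<eta>) x w (n0 + n)))"
        by (rule sum.cong) (simp_all add: start_good_kicked[OF x] True nfix_kicked[OF _ x])
      also have "\<dots> = (\<Sum>L\<in>labels (n0 + n). conc (fix_count L x w (n0 + n)))" by (rule sum_kicked[OF x])
      also have "\<dots> \<le> card (labels (n0 + n)) * (conc (nfix n x) - conc_drop (length w) (nfix n x))"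
        unfolding nfix_def by (rule sum_conc_fix_count[OF x w good_if_start_good[OF x True]])
      \<comment> \<open>Of the drop of the potential, only the part at the value \<open>k\<close> is
        kept.\<close>
      also have "\<dots> \<le> card (labels (n0 + n)) * (conc (nfix n x) - ?c * indicator ?D x)"
        by (intro mult_left_mono diff_left_mono) (auto simp: indicator_def conc_drop_nonneg)
      finally show ?thesis using True by simp
    qed (simp add: start_good_kicked[OF x] indicator_def)
  qed
  also have "\<dots> = (\<integral>x. (if start_good x then conc (nfix n x) else 0) \<partial>Q) - ?c * prob ?D"
    using int intD nfix_event(1) by (simp add: Bochner_Integration.integral_diff)
  finally show ?thesis .
qed

text \<open>The expected potential is decreasing and nonnegative, hence convergent; its decrements
  tend to \<open>0\<close> and dominate the probabilities up to the constant
  \<open>conc_drop (length w) k\<close>.\<close>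

lemma prob_nfix_eq_tendsto:
  assumes k: "k > 0"
  shows "(\<lambda>n. prob {x \<in> space Q. start_good x \<and> nfix n x = k}) \<longlonglongrightarrow> 0"
proof -
  define J where "J = (\<lambda>n. \<integral>x. (if start_good x then conc (nfix n x) else 0) \<partial>Q)"
  have J0: "0 \<le> J n" for n
    unfolding J_def by (rule Bochner_Integration.integral_nonneg) (simp add: conc_bounds)
  let ?c = "conc_drop (length w) k"
  have c: "?c > 0" by (rule conc_drop_pos[OF k])
  have step: "J (Suc n) \<le> J n - ?c * prob {x \<in> space Q. start_good x \<and> nfix n x = k}" for n
    unfolding J_def by (rule potential_decreases)
  have "decseq J"
  proof (rule decseq_SucI)
    fix n
    have "0 \<le> ?c * prob {x \<in> space Q. start_good x \<and> nfix n x = k}" using c by simp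
    then show "J (Suc n) \<le> J n" using step[of n] by linarith
  qed
  then obtain l where l: "J \<longlonglongrightarrow> l" using J0 decseq_convergent[of J 0] by blast
  have "(\<lambda>n. (J n - J (Suc n)) / ?c) \<longlonglongrightarrow> (l - l) / ?c"
    by (intro tendsto_intros l LIMSEQ_Suc[OF l]) (use c in simp)
  then have lim: "(\<lambda>n. (J n - J (Suc n)) / ?c) \<longlonglongrightarrow> 0" by simp
  show ?thesis
  proof (rule tendsto_sandwich[OF _ _ tendsto_const lim])
    show "\<forall>\<^sub>F n in sequentially. prob {x \<in> space Q. start_good x \<and> nfix n x = k} \<le> (J n - J (Suc n)) / ?c"
    proof (rule always_eventually, rule allI)
      fix n
      show "prob {x \<in> space Q. start_good x \<and> nfix n x = k} \<le> (J n - J (Suc n)) / ?c"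
        using step[of n] c by (simp add: pos_le_divide_eq mult.commute)
    qed
  qed simp
qed

text \<open>Values of \<open>M\<close> and more are rare by Markov's inequality, because the mean
  never exceeds its initial bound \<open>E\<close>; each of the finitely many smaller positive
  values has vanishing probability.\<close>

lemma extinction:
  "(\<lambda>n. prob {x \<in> space Q. start_good x \<and> nfix n x \<noteq> 0}) \<longlonglongrightarrow> 0"
proof (rule LIMSEQ_I)
  fix r :: real assume r: "r > 0"
  \<comment> \<open>The number of vertices of level \<open>n0\<close>, which bounds the initial
    count.\<close>
  define E where "E = real d ^ n0"
  have mean: "(\<integral>x. (if start_good x then real (nfix n x) else 0) \<partial>Q) \<le> E" for n
  proof (induction n)
    case 0
    have "(\<integral>x. (if start_good x then real (nfix 0 x) else 0) \<partial>Q) \<le> (\<integral>x. E \<partial>Q)"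
    proof (rule integral_mono)
      show "integrable Q (\<lambda>x. if start_good x then real (nfix 0 x) else 0)"
        by (rule integrable_nfix[where C = "d ^ (n0 + 0)"]) (metis abs_of_nat of_nat_le_iff)
      show "(if start_good x then real (nfix 0 x) else 0) \<le> E" for x
        using card_Fix_le[of x w n0] unfolding nfix_def E_def by (simp flip: of_nat_power)
    qed simp
    then show ?case by (simp add: prob_space)
  next
    case (Suc n)
    then show ?case using mean_decreases[of n] by linarith
  qed
  \<comment> \<open>Large enough for the Markov bound \<open>E / M\<close> to be below
    \<open>r / 2\<close>.\<close>
  obtain M :: nat where M: "real M > 2 * E / r" using reals_Archimedean2 by blast
  have E0: "E > 0" using d by (simp add: E_def)
  have M0: "real M > 0" using M E0 r by (meson divide_pos_pos less_trans mult_pos_pos zero_less_numeral)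
  have bound: "prob {x \<in> space Q. start_good x \<and> nfix n x \<noteq> 0} \<le>
    (\<Sum>k\<in>{1..<M}. prob {x \<in> space Q. start_good x \<and> nfix n x = k}) + E / M" for n
  proof -
    have int: "integrable Q (\<lambda>x. if start_good x then real (nfix n x) else 0)"
      by (rule integrable_nfix[where C = "d ^ (n0 + n)"]) (metis abs_of_nat of_nat_le_iff)
    have ev: "{x \<in> space Q. start_good x \<and> M \<le> nfix n x} \<in> sets Q"
      using nfix_cong[of _ _ n] by (intro level_event[of "n0 + n"]) metis
    have intM: "integrable Q (\<lambda>x. real M * indicator {x \<in> space Q. start_good x \<and> M \<le> nfix n x} x)"
      using ev by (intro integrable_mult_right integrable_real_indicator) (auto simp: emeasure_eq_measure)
    have "real M * prob {x \<in> space Q. start_good x \<and> M \<le> nfix n x} = (\<integral>x. real M * indicator {x \<in> space Q. start_good x \<and> M \<le> nfix n x} x \<partial>Q)"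
      using ev by simp
    also have "\<dots> \<le> (\<integral>x. (if start_good x then real (nfix n x) else 0) \<partial>Q)"
      by (rule integral_mono[OF intM int]) (auto simp: indicator_def)
    also have "\<dots> \<le> E" by (rule mean)
    finally have 1: "prob {x \<in> space Q. start_good x \<and> M \<le> nfix n x} \<le> E / M"
      using M0 by (simp add: pos_le_divide_eq mult.commute)
    have fin: "finite {1..<M}" by simp
    have "prob {x \<in> space Q. start_good x \<and> nfix n x \<noteq> 0} \<le>
        prob ((\<Union>k\<in>{1..<M}. {x \<in> space Q. start_good x \<and> nfix n x = k}) \<union> {x \<in> space Q. start_good x \<and> M \<le> nfix n x})"
      by (rule finite_measure_mono) (use nfix_event(1) ev in \<open>auto intro!: sets.finite_UN\<close>)
    also have "\<dots> \<le> prob (\<Union>k\<in>{1..<M}. {x \<in> space Q. start_good x \<and> nfix n x = k}) + prob {x \<in> space Q. start_good x \<and> M \<le> nfix n x}"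
      by (rule measure_Un_le) (use nfix_event(1) ev in \<open>auto intro!: sets.finite_UN\<close>)
    also have "prob (\<Union>k\<in>{1..<M}. {x \<in> space Q. start_good x \<and> nfix n x = k}) \<le> (\<Sum>k\<in>{1..<M}. prob {x \<in> space Q. start_good x \<and> nfix n x = k})"
      by (rule finite_measure_subadditive_finite) (use nfix_event(1) in auto)
    finally show ?thesis using 1 by linarith
  qed
  have "(\<lambda>n. \<Sum>k\<in>{1..<M}. prob {x \<in> space Q. start_good x \<and> nfix n x = k}) \<longlonglongrightarrow> (\<Sum>k\<in>{1..<M}. 0)"
    by (intro tendsto_sum prob_nfix_eq_tendsto) simp
  then have "(\<lambda>n. \<Sum>k\<in>{1..<M}. prob {x \<in> space Q. start_good x \<and> nfix n x = k}) \<longlonglongrightarrow> 0" by simp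
  from LIMSEQ_D[OF this, of "r / 2"] r obtain N where
    N: "\<And>n. n \<ge> N \<Longrightarrow> norm ((\<Sum>k\<in>{1..<M}. prob {x \<in> space Q. start_good x \<and> nfix n x = k}) - 0) < r / 2" by auto
  have N': "(\<Sum>k\<in>{1..<M}. prob {x \<in> space Q. start_good x \<and> nfix n x = k}) < r / 2" if "n \<ge> N" for n
    using N[OF that] unfolding real_norm_def by linarith
  have "E / M < r / 2" using M r M0 by (simp add: divide_simps mult.commute)
  then have "prob {x \<in> space Q. start_good x \<and> nfix n x \<noteq> 0} < r" if "n \<ge> N" for n
    using N'[OF that] bound[of n] by linarith
  then show "\<exists>no. \<forall>n\<ge>no. norm (prob {x \<in> space Q. start_good x \<and> nfix n x \<noteq> 0} - 0) < r"
    by (intro exI[of _ N]) simp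
qed

end

section \<open>Almost sure growth of the girth\<close>

lemma good_event: "{x \<in> space Q. good x l n} \<in> sets Q" "{x \<in> space Q. \<not> good x l n} \<in> sets Q"
  using good_cong[of n] by (intro level_event[of n]; metis)+

text \<open>By induction a level \<open>n0\<close> exists at which shorter words have fixed vertices
  with probability below \<open>r / 2\<close>. From there on each of the finitely many words of
  length \<open>Suc l\<close> dies out, and \<open>good_mono\<close> carries the shorter ones
  along.\<close>

lemma prob_not_good_tendsto: "(\<lambda>n. prob {x \<in> space Q. \<not> good x l n}) \<longlonglongrightarrow> 0"
proof (induction l)
  case 0
  have "good x 0 n" for x n by (simp add: good_def short_words_def)
  then show ?case by simp
next
  case (Suc l)
  define S where "S = {w \<in> short_words (Suc l). length w = Suc l}"
  have S: "w \<in> carrier (free_group m)" "w \<noteq> []" "length w - 1 = l" if "w \<in> S" for w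
    using that by (auto simp: S_def short_words_def)
  have finS: "finite S" using finite_short_words by (simp add: S_def)
  show ?case
  proof (rule LIMSEQ_I)
    fix r :: real assume r: "r > 0"
    obtain n0 where n0: "prob {x \<in> space Q. \<not> good x l n0} < r / 2"
      using LIMSEQ_D[OF Suc, of "r / 2"] r by fastforce
    let ?A = "\<lambda>w n. {x \<in> space Q. good x l n0 \<and> Fix x w (n0 + n) \<noteq> {}}"
    have A: "?A w n = {x \<in> space Q. start_good w n0 x \<and> nfix w n0 n x \<noteq> 0}" if "w \<in> S" for w n
      using S[OF that] finite_Fix by (simp add: start_good_def[OF S(1,2)[OF that]] nfix_def[OF S(1,2)[OF that]])
    have Aev: "?A w n \<in> sets Q" if "w \<in> S" for w n
      unfolding A[OF that] by (rule nfix_event(2)[OF S(1,2)[OF that]])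
    have "(\<lambda>n. \<Sum>w\<in>S. prob (?A w n)) \<longlonglongrightarrow> (\<Sum>w\<in>S. 0)"
    proof (rule tendsto_sum)
      fix w assume w: "w \<in> S"
      show "(\<lambda>n. prob (?A w n)) \<longlonglongrightarrow> 0"
        unfolding A[OF w] by (rule extinction[OF S(1,2)[OF w]])
    qed
    then have "(\<lambda>n. \<Sum>w\<in>S. prob (?A w n)) \<longlonglongrightarrow> 0" by simp
    from LIMSEQ_D[OF this, of "r / 2"] r obtain N where
      N: "\<And>n. n \<ge> N \<Longrightarrow> norm ((\<Sum>w\<in>S. prob (?A w n)) - 0) < r / 2" by auto
    have N': "(\<Sum>w\<in>S. prob (?A w n)) < r / 2" if "n \<ge> N" for n
      using N[OF that] unfolding real_norm_def by linarith
    have "prob {x \<in> space Q. \<not> good x (Suc l) n} < r" if n: "n \<ge> n0 + N" for n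
    proof -
      define k where "k = n - n0"
      have k: "n = n0 + k" "k \<ge> N" using n by (auto simp: k_def)
      have sub: "{x \<in> space Q. \<not> good x (Suc l) n} \<subseteq> {x \<in> space Q. \<not> good x l n0} \<union> (\<Union>w\<in>S. ?A w k)"
      proof
        fix x assume x: "x \<in> {x \<in> space Q. \<not> good x (Suc l) n}"
        then obtain w where w: "w \<in> short_words (Suc l)" "Fix x w n \<noteq> {}" by (auto simp: good_def)
        show "x \<in> {x \<in> space Q. \<not> good x l n0} \<union> (\<Union>w\<in>S. ?A w k)"
        proof (cases "good x l n0")
          case True
          then have "good x l n" using good_mono[of x l n0 n] x k by (simp add: space_Q)
          then have "w \<notin> short_words l" using w(2) by (auto simp: good_def)
          then have "w \<in> S" using w(1) by (auto simp: S_def short_words_def)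
          then show ?thesis using x True w(2) k by blast
        qed (use x in simp)
      qed
      have "prob {x \<in> space Q. \<not> good x (Suc l) n} \<le> prob ({x \<in> space Q. \<not> good x l n0} \<union> (\<Union>w\<in>S. ?A w k))"
        by (rule finite_measure_mono[OF sub]) (use good_event(2) Aev finS in \<open>intro sets.Un sets.finite_UN; simp\<close>)
      also have "\<dots> \<le> prob {x \<in> space Q. \<not> good x l n0} + prob (\<Union>w\<in>S. ?A w k)"
        by (rule measure_Un_le) (use good_event(2) Aev finS in \<open>auto intro!: sets.finite_UN\<close>)
      also have "prob (\<Union>w\<in>S. ?A w k) \<le> (\<Sum>w\<in>S. prob (?A w k))"
        by (rule finite_measure_subadditive_finite[OF finS]) (use Aev in auto)
      finally show ?thesis using n0 N'[OF k(2)] by linarith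
    qed
    then show "\<exists>no. \<forall>n\<ge>no. norm (prob {x \<in> space Q. \<not> good x (Suc l) n} - 0) < r"
      by (intro exI[of _ "n0 + N"]) simp
  qed
qed

theorem AE_good: "AE x in Q. \<exists>n. good x l n"
proof -
  let ?N = "\<Inter>n. {x \<in> space Q. \<not> good x l n}"
  have N: "?N \<in> sets Q" using good_event(2) by (intro sets.countable_INT) auto
  have "prob ?N \<le> prob {x \<in> space Q. \<not> good x l n}" for n
    by (rule finite_measure_mono[OF _ good_event(2)]) blast
  then have "prob ?N \<le> 0"
    by (intro LIMSEQ_le_const[OF prob_not_good_tendsto[of l]]) blast
  then have "prob ?N = 0" using measure_nonneg[of Q ?N] by linarith
  then have "emeasure Q ?N = 0" by (simp add: emeasure_eq_measure)
  then show ?thesis by (intro AE_I[of _ _ ?N] N) auto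
qed

end

section \<open>Measurable choice of the loops\<close>

lemma follow_word_cong:
  assumes eq: "\<And>g v. g \<in> carrier (free_group m) \<Longrightarrow> v \<in> V \<Longrightarrow> \<phi> g v = \<phi>' g v"
    and closed: "\<And>g v. g \<in> carrier (free_group m) \<Longrightarrow> v \<in> V \<Longrightarrow> \<phi> g v \<in> V"
    and w: "w \<in> carrier (free_group m)" "v \<in> V"
  shows "follow_word \<phi> v w = follow_word \<phi>' v w"
  using w
proof (induction w arbitrary: v)
  case (Cons a w)
  have c: "[a] \<in> carrier (free_group m)" "w \<in> carrier (free_group m)"
    using append_closedD[of "[a]" w m] Cons.prems by simp_all
  then show ?case
    using Cons.IH[OF c(2) closed[OF c(1) Cons.prems(2)]] eq[OF c(1) Cons.prems(2)] by (simp add: hom_act_def)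
qed simp

text \<open>The three choices form one triple, so that they are made simultaneously by a single
  choice for each level and component.\<close>

definition witness ::
  "nat \<Rightarrow> nat \<Rightarrow> nat \<Rightarrow> letter list \<Rightarrow> letter list \<Rightarrow> nat list set \<Rightarrow> nat \<Rightarrow>
   (letter list \<Rightarrow> nat list \<Rightarrow> nat list) \<Rightarrow>
   nat list \<times> (nat \<Rightarrow> (nat list \<times> letter list) list) \<times> (nat \<Rightarrow> (nat list \<times> letter list) set) \<Rightarrow> bool" where
  "witness d m K w1 w2 Z n \<phi> = (\<lambda>(v, \<alpha>, e). v \<in> Z \<and>
     (\<forall>j\<in>{1..K}. \<alpha> j \<in> pi1 (induced (Y_graph d m w1 w2 \<phi> n) Z) v) \<and>
     (\<forall>k\<in>{1..K}. e k \<in> geom_edges (X_graph d m \<phi> n)) \<and>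
     (\<forall>j\<in>{1..K}. \<forall>k\<in>{1..K}. passes (iota_path \<phi> (\<alpha> j)) (e k) = (if j = k then 1 else 0)))"

text \<open>The graphs carry \<open>\<phi>\<close> as a total function, but \<open>witness\<close>
  evaluates it only at edges, whose labels lie in the free group and whose sources lie on level
  \<open>n\<close>.\<close>

lemma witness_cong_imp:
  assumes eq: "\<And>g v. g \<in> carrier (free_group m) \<Longrightarrow> v \<in> level d n \<Longrightarrow> \<phi> g v = \<phi>' g v"
    and closed: "\<And>g v. g \<in> carrier (free_group m) \<Longrightarrow> v \<in> level d n \<Longrightarrow> \<phi> g v \<in> level d n"
    and w: "w1 \<in> carrier (free_group m)" "w2 \<in> carrier (free_group m)"
    and wit: "witness d m K w1 w2 Z n \<phi> t"
  shows "witness d m K w1 w2 Z n \<phi>' t"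
proof -
  let ?Y = "Y_graph d m w1 w2 \<phi> n" and ?Y' = "Y_graph d m w1 w2 \<phi>' n"
  let ?X = "X_graph d m \<phi> n" and ?X' = "X_graph d m \<phi>' n"
  let ?D = "subgroup_generated (free_group m) {w1, w2}"
  interpret D: group ?D by simp
  obtain v \<alpha> e where t: "t = (v, \<alpha>, e)" by (metis prod.exhaust)
  have sub: "{w1, w2} \<subseteq> carrier ?D"
    by (rule free_group.subgroup_generated_subset_carrier_subset) (use w in auto)
  have Dc: "s \<in> {w1, w2} \<union> m_inv ?D ` {w1, w2} \<Longrightarrow> s \<in> carrier (free_group m)" for s
    using sub D.inv_closed free_group.carrier_subgroup_generated_subset[of m "{w1, w2}"] by blast
  have gc: "free_gens m \<subseteq> carrier (free_group m)"
    by (auto simp: free_gens_def carrier_free_group reduced_word_Cons)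
  then have Xc: "s \<in> free_gens m \<union> m_inv (free_group m) ` free_gens m \<Longrightarrow> s \<in> carrier (free_group m)" for s
    using free_group.inv_closed by blast
  have eY: "tgt ?Y f = tgt ?Y' f \<and> bar ?Y f = bar ?Y' f" if "f \<in> Edges ?Y" for f
    using that eq[OF Dc] by (auto simp: Y_graph_def schreier_def hom_act_def)
  have eX: "bar ?X f = bar ?X' f" if "f \<in> Edges ?X" for f
    using that eq[OF Xc] by (auto simp: X_graph_def schreier_def hom_act_def)
  have EY: "Edges ?Y' = Edges ?Y" "src ?Y' = src ?Y" "Edges ?X' = Edges ?X"
    by (simp_all add: Y_graph_def X_graph_def schreier_def)
  have path: "is_path (induced ?Y' Z) u p v \<and> set p \<subseteq> Edges ?Y" if "is_path (induced ?Y Z) u p v" for u p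
    using that
  proof (induction p arbitrary: u)
    case (Cons f p)
    then show ?case using eY[of f] by (auto simp: induced_def EY)
  qed (simp add: induced_def)
  have pi: "p \<in> pi1 (induced ?Y' Z) v \<and> iota_path \<phi> p = iota_path \<phi>' p" if p: "p \<in> pi1 (induced ?Y Z) v" for p
  proof -
    have pe: "set p \<subseteq> Edges ?Y" and pp: "is_path (induced ?Y' Z) v p v"
      using p path by (auto simp: pi1_def)
    have "reduced_path (induced ?Y' Z) p \<longleftrightarrow> reduced_path (induced ?Y Z) p"
      unfolding reduced_path_def by (rule successively_cong) (use pe eY in \<open>auto simp: induced_def\<close>)
    moreover have "follow_word \<phi> u s = follow_word \<phi>' u s" if "(u, s) \<in> set p" for u s
    proof (rule follow_word_cong[OF eq closed])
      show "s \<in> carrier (free_group m)" "u \<in> level d n"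
        using that pe Dc by (auto simp: Y_graph_def schreier_def)
    qed
    then have "iota_path \<phi> p = iota_path \<phi>' p"
      unfolding iota_path_def by (intro arg_cong[where f = concat] map_cong refl) auto
    ultimately show ?thesis using p pp by (simp add: pi1_def)
  qed
  have ge: "E \<in> geom_edges ?X'" if E: "E \<in> geom_edges ?X" for E
  proof -
    obtain f where f: "f \<in> Edges ?X" "E = {f, bar ?X f}" using E unfolding geom_edges_def by blast
    then have "E = {f, bar ?X' f}" using eX by metis
    then show ?thesis using f(1) unfolding geom_edges_def EY by blast
  qed
  show ?thesis using wit pi ge unfolding t witness_def by auto
qed

section \<open>From homomorphisms to tuples of generator images\<close>

context transitive_wreath begin

lemma Hom_facts:
  assumes \<phi>: "\<phi> \<in> Hom_wreath d H m"
  shows Hom_W: "g \<in> carrier (free_group m) \<Longrightarrow> \<phi> g \<in> W"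
    and Hom_mult: "g \<in> carrier (free_group m) \<Longrightarrow> h \<in> carrier (free_group m) \<Longrightarrow> v \<in> tree d \<Longrightarrow>
      \<phi> (g \<otimes>\<^bsub>free_group m\<^esub> h) v = \<phi> h (\<phi> g v)"
    and Hom_gen: "gen_images m \<phi> \<in> tuples"
proof -
  have hom: "\<phi> \<in> hom (free_group m) (wreath d H)" using \<phi> by (simp add: Hom_wreath_def)
  show W: "g \<in> carrier (free_group m) \<Longrightarrow> \<phi> g \<in> W" for g using hom by (auto simp: hom_def)
  show "g \<in> carrier (free_group m) \<Longrightarrow> h \<in> carrier (free_group m) \<Longrightarrow> v \<in> tree d \<Longrightarrow>
      \<phi> (g \<otimes>\<^bsub>free_group m\<^esub> h) v = \<phi> h (\<phi> g v)"
    using hom_mult[OF hom, of g h] by (simp add: wreath_def compose_def)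
  show "gen_images m \<phi> \<in> tuples"
    using W by (auto simp: gen_images_def carrier_free_group reduced_word_Cons)
qed

lemma Hom_one:
  assumes \<phi>: "\<phi> \<in> Hom_wreath d H m" and v: "v \<in> level d n"
  shows "\<phi> [] v = v"
proof -
  have c: "[] \<in> carrier (free_group m)" by (simp add: carrier_free_group)
  have "\<phi> [] (\<phi> [] v) = \<phi> [] v"
    using Hom_mult[OF \<phi> c c level_tree[OF v]] by (simp add: mult_free_group)
  then show ?thesis
    using W_inj[OF Hom_W[OF \<phi> c], of n] W_level[OF Hom_W[OF \<phi> c] v] v by (auto dest: inj_onD)
qed

lemma free_action_Hom:
  assumes "\<phi> \<in> Hom_wreath d H m"
  shows "free_action m (level d n) \<phi>"
  by unfold_locales
    (auto simp: finite_level Hom_one[OF assms] Hom_mult[OF assms] level_tree intro: W_level Hom_W[OF assms])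

text \<open>A homomorphism is determined on each level by the images of the generators. At a
  negative letter its value is a preimage on that level and so coincides with the
  \<open>inv_into\<close> in \<open>lact\<close>.\<close>

lemma Hom_eq_wact:
  assumes \<phi>: "\<phi> \<in> Hom_wreath d H m" and w: "w \<in> carrier (free_group m)" and v: "v \<in> level d n"
  shows "\<phi> w v = wact (gen_images m \<phi>) w v"
  using w v
proof (induction w arbitrary: v)
  case Nil
  then show ?case using Hom_one[OF \<phi>] by simp
next
  case (Cons a w)
  let ?x = "gen_images m \<phi>"
  have c: "[a] \<in> carrier (free_group m)" "w \<in> carrier (free_group m)"
    using append_closedD[of "[a]" w m] Cons.prems by simp_all
  have i: "fst a \<in> {1..m}" using c(1) by (simp add: carrier_free_group)
  have t: "[(fst a, True)] \<in> carrier (free_group m)"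
    using i by (simp add: carrier_free_group reduced_word_Cons)
  have x: "?x (fst a) = \<phi> [(fst a, True)]" using i by (simp add: gen_images_def)
  have 1: "\<phi> [a] v = lact ?x a v"
  proof (cases "snd a")
    case True
    then have "a = (fst a, True)" by (simp add: prod_eq_iff)
    then show ?thesis using True x by (simp add: lact_def)
  next
    case False
    then have a: "a = (fst a, False)" by (simp add: prod_eq_iff)
    have "[a] \<otimes>\<^bsub>free_group m\<^esub> [(fst a, True)] = []"
      by (subst a) (simp add: mult_free_group inv_letter_def)
    then have "\<phi> [(fst a, True)] (\<phi> [a] v) = v"
      using Hom_mult[OF \<phi> c(1) t level_tree[OF Cons.prems(2)]] Hom_one[OF \<phi> Cons.prems(2)] by simp
    then have "inv_into (level d n) (?x (fst a)) v = \<phi> [a] v"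
      unfolding x by (intro inv_into_f_eq W_inj Hom_W[OF \<phi> t] W_level[OF Hom_W[OF \<phi> c(1)] Cons.prems(2)])
    then show ?thesis using False length_level[OF Cons.prems(2)] by (simp add: lact_def)
  qed
  have "\<phi> (a # w) v = \<phi> w (\<phi> [a] v)"
    using Hom_mult[OF \<phi> c level_tree[OF Cons.prems(2)]] mult_free_group_append[of "[a]" w m] Cons.prems(1)
    by (simp add: carrier_free_group)
  then show ?case
    using Cons.IH[OF c(2) W_level[OF Hom_W[OF \<phi> c(1)] Cons.prems(2)]] 1 by simp
qed

lemma Hom_agree:
  assumes \<phi>: "\<phi> \<in> Hom_wreath d H m" "\<phi>' \<in> Hom_wreath d H m"
    and agr: "agree n (gen_images m \<phi>) (gen_images m \<phi>')"
    and g: "g \<in> carrier (free_group m)" "v \<in> level d n"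
  shows "\<phi> g v = \<phi>' g v"
  using wact_cong[OF agr Hom_gen[OF \<phi>(1)] _ g(2), of g] g
    Hom_eq_wact[OF \<phi>(1) g] Hom_eq_wact[OF \<phi>(2) g] by (simp add: carrier_free_group)

lemma girth_if_good:
  assumes \<phi>: "\<phi> \<in> Hom_wreath d H m" and good: "good (gen_images m \<phi>) \<gamma> n"
  shows "free_action.girth_gt m (level d n) \<phi> \<gamma>"
proof -
  interpret free_action m "level d n" \<phi> by (rule free_action_Hom[OF \<phi>])
  show ?thesis unfolding girth_gt_def
  proof (intro ballI impI notI)
    fix v g assume v: "v \<in> level d n" and g: "g \<in> carrier (free_group m)" "g \<noteq> [] \<and> length g \<le> \<gamma>"
      and eq: "\<phi> g v = v"
    have "g \<in> short_words \<gamma>" using g by (simp add: short_words_def)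
    then have "Fix (gen_images m \<phi>) g n = {}" using good by (simp add: good_def)
    moreover have "v \<in> Fix (gen_images m \<phi>) g n"
      using v eq Hom_eq_wact[OF \<phi> g(1) v] by (simp add: Fix_def)
    ultimately show False by blast
  qed
qed

text \<open>An equality of predicates, so that the choice operator returns the same triple for
  homomorphisms that agree on level \<open>n\<close>.\<close>

lemma witness_agree:
  assumes "\<phi> \<in> Hom_wreath d H m" "\<phi>' \<in> Hom_wreath d H m" "agree n (gen_images m \<phi>) (gen_images m \<phi>')"
    and "w1 \<in> carrier (free_group m)" "w2 \<in> carrier (free_group m)"
  shows "witness d m K w1 w2 Z n \<phi> = witness d m K w1 w2 Z n \<phi>'"
proof
  fix t
  have W: "\<psi> g v \<in> level d n" if "\<psi> \<in> Hom_wreath d H m" "g \<in> carrier (free_group m)" "v \<in> level d n" for \<psi> g v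
    using W_level[OF Hom_W[OF that(1,2)] that(3)] .
  note eq = Hom_agree[OF assms(1-3)]
  show "witness d m K w1 w2 Z n \<phi> t = witness d m K w1 w2 Z n \<phi>' t"
  proof
    show "witness d m K w1 w2 Z n \<phi>' t" if "witness d m K w1 w2 Z n \<phi> t"
      by (rule witness_cong_imp[OF eq W[OF assms(1)] assms(4,5) that])
    show "witness d m K w1 w2 Z n \<phi> t" if "witness d m K w1 w2 Z n \<phi>' t"
      by (rule witness_cong_imp[OF eq[symmetric] W[OF assms(2)] assms(4,5) that])
  qed
qed

end

section \<open>Assembly of the random variables\<close>

theorem theorem4p4:
  fixes d m K :: nat
    and H :: "(nat \<Rightarrow> nat) set"
    and w1 w2 :: "letter list"
    and P :: "(letter list \<Rightarrow> nat list \<Rightarrow> nat list) measure"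
  assumes "2 \<le> d"
    and "subgroup H (sym_group d)"
    and "transitive_perms d H"
    and "w1 \<in> carrier (free_group m)" and "w2 \<in> carrier (free_group m)"
    and "\<not> cyclic_group (subgroup_generated (free_group m) {w1, w2})"
    and "haar_random_hom d H m P"
  shows "\<exists>(N :: (letter list \<Rightarrow> nat list \<Rightarrow> nat list) \<Rightarrow> nat)
      (v :: nat list set \<Rightarrow> (letter list \<Rightarrow> nat list \<Rightarrow> nat list) \<Rightarrow> nat list)
      (\<alpha> :: nat \<Rightarrow> nat list set \<Rightarrow> (letter list \<Rightarrow> nat list \<Rightarrow> nat list) \<Rightarrow>
             (nat list \<times> letter list) list)
      (e :: nat \<Rightarrow> nat list set \<Rightarrow> (letter list \<Rightarrow> nat list \<Rightarrow> nat list) \<Rightarrow>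
             (nat list \<times> letter list) set).
      N \<in> measurable P (count_space UNIV) \<and>
      (\<forall>Z. v Z \<in> measurable P (count_space UNIV)) \<and>
      (\<forall>j\<in>{1..K}. \<forall>Z. \<alpha> j Z \<in> measurable P (count_space UNIV)) \<and>
      (\<forall>j\<in>{1..K}. \<forall>Z. e j Z \<in> measurable P (count_space UNIV)) \<and>
      (AE \<phi> in P. \<forall>Z \<in> component_verts (Y_graph d m w1 w2 \<phi> (N \<phi>)).
         v Z \<phi> \<in> Z \<and>
         (\<forall>j\<in>{1..K}. \<alpha> j Z \<phi> \<in> pi1 (induced (Y_graph d m w1 w2 \<phi> (N \<phi>)) Z) (v Z \<phi>)) \<and>
         (\<forall>k\<in>{1..K}. e k Z \<phi> \<in> geom_edges (X_graph d m \<phi> (N \<phi>))) \<and>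
         (\<forall>j\<in>{1..K}. \<forall>k\<in>{1..K}.
            passes (iota_path \<phi> (\<alpha> j Z \<phi>)) (e k Z \<phi>) = (if j = k then 1 else 0)))"
proof -
  interpret transitive_wreath d m H by (rule transitive_wreath.intro) (rule assms)+
  let ?B = "PiM {1..m} (\<lambda>_. wreath_borel d H)"
  have spP: "space P = Hom_wreath d H m"
    and seP: "sets P = sets (vimage_algebra (Hom_wreath d H m) (gen_images m) ?B)"
    and haar: "haar_probability (product_group {1..m} (\<lambda>_. wreath d H)) (distr P ?B (gen_images m))"
    using assms(7) by (simp_all add: haar_random_hom_def Let_def)
  define Q where "Q = distr P ?B (gen_images m)"
  interpret haar_tuple d m H Q
  proof unfold_locales
    show "sets Q = sets ?B" by (simp add: Q_def)
    show "haar_probability (product_group {1..m} (\<lambda>_. wreath d H)) Q" unfolding Q_def by (rule haar)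
  qed
  have "space (wreath_borel d H) = W"
    unfolding wreath_borel_def by (rule space_measure_of) auto
  then have spB: "space ?B = tuples" by (simp add: space_PiM)
  have "gen_images m \<in> measurable (vimage_algebra (Hom_wreath d H m) (gen_images m) ?B) ?B"
    by (rule measurable_vimage_algebra1) (use Hom_gen spB in auto)
  then have genB: "gen_images m \<in> measurable P ?B"
    using measurable_cong_sets[OF seP refl] by blast
  then have genQ: "gen_images m \<in> measurable P Q" by (simp add: Q_def)
  have meas: "F \<in> measurable P (count_space UNIV)"
    if F: "\<And>\<phi> \<phi>'. \<phi> \<in> Hom_wreath d H m \<Longrightarrow> \<phi>' \<in> Hom_wreath d H m \<Longrightarrow>
      agree n (gen_images m \<phi>) (gen_images m \<phi>') \<Longrightarrow> F \<phi> = F \<phi>'" for F :: "_ \<Rightarrow> 'z" and n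
  proof -
    \<comment> \<open>\<open>measurable_level\<close> concerns tuples, so \<open>F\<close> is
      factored through \<open>gen_images m\<close>; any homomorphism representing the tuple on level
      \<open>n\<close> gives the same value.\<close>
    define F' where "F' = (\<lambda>x. F (SOME \<phi>. \<phi> \<in> Hom_wreath d H m \<and> agree n (gen_images m \<phi>) x))"
    have "F' \<in> measurable Q (count_space UNIV)"
    proof (rule measurable_level[of n])
      fix x x' assume "agree n x x'"
      then have "agree n y x = agree n y x'" for y by (auto simp: agree_def)
      then show "F' x = F' x'" by (simp add: F'_def)
    qed
    then have "(\<lambda>\<phi>. F' (gen_images m \<phi>)) \<in> measurable P (count_space UNIV)"
      by (rule measurable_compose[OF genQ])
    moreover have "F' (gen_images m \<phi>) = F \<phi>" if \<phi>: "\<phi> \<in> space P" for \<phi>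
    proof -
      let ?R = "\<lambda>\<psi>. \<psi> \<in> Hom_wreath d H m \<and> agree n (gen_images m \<psi>) (gen_images m \<phi>)"
      have "?R \<phi>" using \<phi> spP by (simp add: agree_def)
      then have "?R (SOME \<psi>. ?R \<psi>)" by (rule someI[of ?R])
      then show ?thesis using F[of "SOME \<psi>. ?R \<psi>" \<phi>] \<phi> spP by (simp add: F'_def)
    qed
    ultimately show ?thesis using measurable_cong[of P "\<lambda>\<phi>. F' (gen_images m \<phi>)" F] by blast
  qed
  \<comment> \<open>The extremal argument starts from the point \<open>u 1\<close> and needs at
    least one edge, so \<open>K = 0\<close> is settled through the case of one loop.\<close>
  define K' where "K' = max K 1"
  define \<gamma> where "\<gamma> = free_action.girth_bound m K' w1 w2"
  \<comment> \<open>If no level is good, the value is unspecified; this happens only on a null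
    set.\<close>
  define N where "N = (\<lambda>\<phi>. LEAST n. good (gen_images m \<phi>) \<gamma> n)"
  define T where "T = (\<lambda>Z n \<phi>. SOME t. witness d m K w1 w2 Z n \<phi> t)"
  have N: "N \<in> measurable P (count_space UNIV)"
    unfolding N_def
  proof (rule measurable_Least)
    show "Measurable.pred P (\<lambda>\<phi>. good (gen_images m \<phi>) \<gamma> n)" for n
      by (rule meas[of n]) (use good_cong Hom_gen in blast)
  qed
  \<comment> \<open>For each fixed \<open>n\<close> the choice is decided by level \<open>n\<close>,
    and \<open>N\<close> takes countably many values.\<close>
  have T: "(\<lambda>\<phi>. G (T Z (N \<phi>) \<phi>)) \<in> measurable P (count_space UNIV)" for G :: "_ \<Rightarrow> 'z" and Z
  proof (rule measurable_compose_countable[OF _ N])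
    show "(\<lambda>\<phi>. G (T Z n \<phi>)) \<in> measurable P (count_space UNIV)" for n
      by (rule meas[of n]) (simp add: T_def witness_agree[OF _ _ _ assms(4,5)])
  qed
  have wit: "witness d m K w1 w2 Z (N \<phi>) \<phi> (T Z (N \<phi>) \<phi>)"
    if \<phi>: "\<phi> \<in> Hom_wreath d H m" and ex: "\<exists>n. good (gen_images m \<phi>) \<gamma> n"
      and Z: "Z \<in> component_verts (Y_graph d m w1 w2 \<phi> (N \<phi>))" for \<phi> Z
  proof -
    interpret free_action m "level d (N \<phi>)" \<phi> by (rule free_action_Hom[OF \<phi>])
    have "good (gen_images m \<phi>) \<gamma> (N \<phi>)" unfolding N_def by (rule LeastI_ex[OF ex])
    then have girth: "girth_gt (girth_bound K' w1 w2)" using girth_if_good[OF \<phi>] by (simp add: \<gamma>_def)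
    have "\<exists>t. witness d m K w1 w2 Z (N \<phi>) \<phi> t"
      using loops_if_large_girth[OF assms(4-6) girth _ Z[unfolded Y_graph_def]]
      unfolding witness_def X_graph_def Y_graph_def K'_def by fastforce
    then show ?thesis unfolding T_def by (rule someI_ex)
  qed
  have "AE \<phi> in P. \<exists>n. good (gen_images m \<phi>) \<gamma> n"
    using AE_distrD[OF genB] AE_good[of \<gamma>] unfolding Q_def by blast
  then have ae: "AE \<phi> in P. \<forall>Z \<in> component_verts (Y_graph d m w1 w2 \<phi> (N \<phi>)).
      witness d m K w1 w2 Z (N \<phi>) \<phi> (T Z (N \<phi>) \<phi>)"
    using AE_space by eventually_elim (use wit spP in blast)
  show ?thesis
  proof (intro exI conjI allI ballI)
    show "N \<in> measurable P (count_space UNIV)" by (rule N)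
    show "(\<lambda>\<phi>. fst (T Z (N \<phi>) \<phi>)) \<in> measurable P (count_space UNIV)" for Z by (rule T)
    show "(\<lambda>\<phi>. fst (snd (T Z (N \<phi>) \<phi>)) j) \<in> measurable P (count_space UNIV)" for j Z by (rule T)
    show "(\<lambda>\<phi>. snd (snd (T Z (N \<phi>) \<phi>)) j) \<in> measurable P (count_space UNIV)" for j Z by (rule T)
    show "AE \<phi> in P. \<forall>Z \<in> component_verts (Y_graph d m w1 w2 \<phi> (N \<phi>)).
         fst (T Z (N \<phi>) \<phi>) \<in> Z \<and>
         (\<forall>j\<in>{1..K}. fst (snd (T Z (N \<phi>) \<phi>)) j \<in> pi1 (induced (Y_graph d m w1 w2 \<phi> (N \<phi>)) Z) (fst (T Z (N \<phi>) \<phi>))) \<and>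
         (\<forall>k\<in>{1..K}. snd (snd (T Z (N \<phi>) \<phi>)) k \<in> geom_edges (X_graph d m \<phi> (N \<phi>))) \<and>
         (\<forall>j\<in>{1..K}. \<forall>k\<in>{1..K}.
            passes (iota_path \<phi> (fst (snd (T Z (N \<phi>) \<phi>)) j)) (snd (snd (T Z (N \<phi>) \<phi>)) k) = (if j = k then 1 else 0))"
      using ae by eventually_elim (simp add: witness_def split_beta)
  qed
qed

end
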